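(* Let $\theta\in\mathbb C\setminus\{0\}$. The symplectic invariants $F^{(g)}_{\rm Bessel}$ of the Bessel curve $Y^2=\frac{X+\theta^2}{4X^2}$, parametrized by $$X(z)=\theta^2(z^2-1),\qquad Y(z)=\frac{z}{2\theta(z^2-1)},$$ are given by $$F^{(g)}_{\rm Bessel}=\frac{B_{2g}}{2g(2g-2)\,\theta^{2g-2}}\qquad\text{for all } g\ge2 .$$
   Context: **Bernoulli numbers.** $\frac{u}{e^u-1}-1+\frac u2=\sum_{m\ge1}B_{2m}\frac{u^{2m}}{(2m)!}$. **Topological recursion.** The Bessel curve has the single branch point $z=0$, so $R=\{0\}$, and conjugation $\bar z=-z$. Put $\omega^{(0)}_1=Y\,dX$, $\omega^{(0)}_2(z_1,z_2)=\frac{dz_1dz_2}{(z_1-z_2)^2}$, $K(z_0,z)=\frac12\frac{\int_z^{\bar z}\omega^{(0)}_2(\cdot,z_0)}{(Y(z)-Y(\bar z))dX(z)}$ and $$\omega^{(g)}_{n+1}(z_0,z_1,\dots,z_n)=\sum_{r\in R}\mathop{\rm Res}_{z=r}K(z_0,z)\Big[\omega^{(g-1)}_{n+2}(z,\bar z,z_1,\dots,z_n)+\sum'\omega^{(g_1)}_{1+|I|}(z,z_I)\,\omega^{(g_2)}_{1+|J|}(\bar z,z_J)\Big],$$ $\sum'$ being over $g_1+g_2=g$, $I\sqcup J=\{1,\dots,n\}$ with $(g_1,I),(g_2,J)\neq(0,\emptyset)$ (and $\omega^{(-1)}=0$). For $g\ge2$, $$F^{(g)}_{\rm Bessel}=\frac1{2-2g}\sum_{r\in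 R}\mathop{\rm Res}_{z=r}\Phi(z)\,\omega^{(g)}_1(z),\qquad \Phi(z)=\int_{z_o}^zY\,dX,$$ $z_o$ an arbitrary generic point. *)

theory Defs
  imports
    "HOL-Complex_Analysis.Complex_Analysis"
    "HOL-Computational_Algebra.Formal_Power_Series"
begin

text \<open>
  \<open>B\<^sub>n = n! [u\<^sup>n] u / (e\<^sup>u - 1)\<close>, as a formal power series. The correction
  \<open>- 1 + u / 2\<close> in the even part of the expansion only touches the coefficients of \<open>u\<^sup>0\<close> and \<open>u\<^sup>1\<close>.
\<close>

definition bernoulli :: "nat \<Rightarrow> complex" where
  "bernoulli n = fact n * fps_nth (fps_X / (fps_exp 1 - 1)) n"

lemma bernoulli_gen_fun: "fps_X / (fps_exp 1 - 1) * (fps_exp 1 - 1) = (fps_X :: complex fps)"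
proof -
  have "subdegree (fps_exp 1 - 1 :: complex fps) = 1"
    by (rule subdegreeI) auto
  moreover from this have "fps_exp 1 - 1 \<noteq> (0 :: complex fps)"
    by auto
  ultimately have "fps_exp 1 - 1 dvd (fps_X :: complex fps)"
    by (simp add: fps_dvd_iff)
  thus ?thesis
    by simp
qed

text \<open>
  Topological recursion for a rational curve with global coordinate \<open>z\<close>, branch points \<open>R\<close>
  and conjugation \<open>\<sigma>\<close>. A multi-differential
  \<open>\<omega>(z\<^sub>1, \<dots>, z\<^sub>n) = W(z\<^sub>1, \<dots>, z\<^sub>n) dz\<^sub>1 \<dots> dz\<^sub>n\<close> is represented by its
  coefficient \<open>W\<close>, applied to the list \<open>[z\<^sub>1, \<dots>, z\<^sub>n]\<close>; each argument \<open>\<sigma> z\<close>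
  therefore contributes a factor \<open>d(\<sigma> z)/dz\<close>. The values are meaningful for pairwise
  distinct arguments that are not poles (in particular, not branch points).
\<close>

definition tr_kernel ::
  "(complex \<Rightarrow> complex) \<Rightarrow> (complex \<Rightarrow> complex) \<Rightarrow> (complex \<Rightarrow> complex) \<Rightarrow> complex \<Rightarrow> complex \<Rightarrow> complex" where
  "tr_kernel X Y \<sigma> z0 z =
     1 / 2 * contour_integral (linepath z (\<sigma> z)) (\<lambda>w. 1 / (w - z0)\<^sup>2) /
       ((Y z - Y (\<sigma> z)) * deriv X z)"

text \<open>
  In the sum, \<open>h\<close> and \<open>g - h\<close> are the two genera, and the index sets \<open>I\<close> and
  \<open>{..<length zs} - I\<close> refer to positions (counted from 0) in the list \<open>zs\<close>.
\<close>

function tr_omega ::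
  "complex set \<Rightarrow> (complex \<Rightarrow> complex) \<Rightarrow> (complex \<Rightarrow> complex) \<Rightarrow> (complex \<Rightarrow> complex) \<Rightarrow>
   nat \<Rightarrow> complex list \<Rightarrow> complex" where
  "tr_omega R X Y \<sigma> g [] = 0"
| "tr_omega R X Y \<sigma> g (z0 # zs) =
     (if g = 0 \<and> length zs = 0 then Y z0 * deriv X z0
      else if g = 0 \<and> length zs = 1 then 1 / (z0 - hd zs)\<^sup>2
      else \<Sum>r\<in>R. residue (\<lambda>z. tr_kernel X Y \<sigma> z0 z *
        ((if g = 0 then 0
          else tr_omega R X Y \<sigma> (g - 1) (z # \<sigma> z # zs) * deriv \<sigma> z) +
         (\<Sum>h\<in>{0..g}. \<Sum>I\<in>Pow {..<length zs}.
           if (h = 0 \<and> I = {}) \<or> (g - h = 0 \<and> {..<length zs} - I = {}) then 0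
           else tr_omega R X Y \<sigma> h (z # nths zs I) *
                (tr_omega R X Y \<sigma> (g - h) (\<sigma> z # nths zs ({..<length zs} - I)) * deriv \<sigma> z)))) r)"
  by pat_completeness auto
termination
proof (relation "Wellfounded.measure (\<lambda>(R, X, Y, \<sigma>, g, zs). 2 * g + length zs)", goal_cases)
  case (3 R X Y \<sigma> g z0 zs r z h I)
  have "length (nths zs I) \<le> card I"
    using 3 by (auto simp: length_nths intro!: card_mono finite_subset[of I "{..<length zs}"])
  moreover have "card I \<le> length zs"
    using 3 card_mono[of "{..<length zs}" I] by auto
  moreover have "card I < length zs" if "h = g"
    using 3 that psubset_card_mono[of "{..<length zs}" I] by auto
  ultimately show ?case
    using 3 by (cases "h = g") auto
next
  case (4 R X Y \<sigma> g z0 zs r z h I)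
  let ?J = "{..<length zs} - I"
  have "length (nths zs ?J) \<le> card ?J"
    by (auto simp: length_nths intro!: card_mono)
  moreover have "card ?J \<le> length zs"
    using card_mono[of "{..<length zs}" ?J] by auto
  moreover have "card ?J < length zs" if "h = 0"
    using 4 that psubset_card_mono[of "{..<length zs}" ?J] by auto
  ultimately show ?case
    using 4 by (cases "h = 0") auto
qed auto

declare tr_omega.simps [simp del]

definition tr_F ::
  "complex set \<Rightarrow> (complex \<Rightarrow> complex) \<Rightarrow> (complex \<Rightarrow> complex) \<Rightarrow> (complex \<Rightarrow> complex) \<Rightarrow>
   (complex \<Rightarrow> complex) \<Rightarrow> nat \<Rightarrow> complex" where
  "tr_F R X Y \<sigma> \<Phi> g =
     1 / (2 - 2 * of_nat g) * (\<Sum>r\<in>R. residue (\<lambda>z. \<Phi> z * tr_omega R X Y \<sigma> g [z]) r)"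

definition bessel_X :: "complex \<Rightarrow> complex \<Rightarrow> complex" where
  "bessel_X \<theta> z = \<theta>\<^sup>2 * (z\<^sup>2 - 1)"

definition bessel_Y :: "complex \<Rightarrow> complex \<Rightarrow> complex" where
  "bessel_Y \<theta> z = z / (2 * \<theta> * (z\<^sup>2 - 1))"

lemma bessel_curve:
  assumes "\<theta> \<noteq> 0"
  shows "(bessel_Y \<theta> z)\<^sup>2 = (bessel_X \<theta> z + \<theta>\<^sup>2) / (4 * (bessel_X \<theta> z)\<^sup>2)"
proof -
  have "(bessel_X \<theta> z + \<theta>\<^sup>2) / (4 * (bessel_X \<theta> z)\<^sup>2) =
        (\<theta>\<^sup>2 * z\<^sup>2) / (\<theta>\<^sup>2 * (4 * \<theta>\<^sup>2 * (z\<^sup>2 - 1)\<^sup>2))"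
    by (simp add: bessel_X_def power2_eq_square algebra_simps)
  also have "\<dots> = z\<^sup>2 / (4 * \<theta>\<^sup>2 * (z\<^sup>2 - 1)\<^sup>2)"
    using assms by simp
  finally show ?thesis
    by (simp add: bessel_Y_def power_divide power_mult_distrib)
qed

lemma bessel_branch_points:
  assumes "\<theta> \<noteq> 0"
  shows "{z. deriv (bessel_X \<theta>) z = 0} = {0}"
proof -
  have "deriv (bessel_X \<theta>) z = 2 * \<theta>\<^sup>2 * z" for z
    unfolding bessel_X_def by (rule DERIV_imp_deriv) (auto intro!: derivative_eq_intros)
  thus ?thesis
    using assms by auto
qed

lemma bessel_conj: "bessel_X \<theta> (- z) = bessel_X \<theta> z"
  by (simp add: bessel_X_def)

text \<open>
  The primitive \<open>\<Phi>\<close> of \<open>Y dX\<close> near the branch point \<open>0\<close>. As \<open>Y dX\<close> has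
  nonzero residues at \<open>\<plusminus>1\<close>, \<open>\<Phi>\<close> depends on the choice of a path \<open>\<gamma>\<close> from
  \<open>z\<^sub>o\<close> to \<open>0\<close>; this path is then continued to \<open>z\<close> by a segment.
\<close>

definition bessel_Phi :: "complex \<Rightarrow> (real \<Rightarrow> complex) \<Rightarrow> complex \<Rightarrow> complex" where
  "bessel_Phi \<theta> \<gamma> z =
     contour_integral (\<gamma> +++ linepath 0 z) (\<lambda>w. bessel_Y \<theta> w * deriv (bessel_X \<theta>) w)"

definition bessel_F :: "complex \<Rightarrow> (real \<Rightarrow> complex) \<Rightarrow> nat \<Rightarrow> complex" where
  "bessel_F \<theta> \<gamma> g = tr_F {0} (bessel_X \<theta>) (bessel_Y \<theta>) uminus (bessel_Phi \<theta> \<gamma>) g"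

end

(*
  Near the branch point Y dX = - theta (z^2 + z^4 + ...) dz, so the stable correlators are even polynomials
  in the 1/z_i without constant term, and the recursion is a set of Virasoro constraints for their
  coefficients. In terms of the exponential generating function Z of the coefficients (graded by
  k = 2g - 2 + n with formal parameter hbar) the constraints become linear, and they are integrable because
  the operators satisfy the Virasoro relations.

  Evaluate Z at the times T_d = - (p^(2d+1) + tau) / (2d+1), that is, insert one point at z = 1/p and tau
  points at z = 1. The constraints give a second order differential equation in p (for tau = 0 it is the
  equation of the Debye polynomials of the Bessel function) with polynomial solutions, and a first-order
  operator maps the solution for tau = 0 to the one for tau = 1. At p = 1 this yields
  (1 - hbar) Z(2) = Z(1)^2, where Z(tau) := Z|_{p=0}.

  By the dilaton equation, Z(tau) satisfies d/dtau Z = (h + hbar tau^2 / 2 + hbar^2 d/dhbar) Z, where the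
  coefficient of hbar^(2g-1) in h is (2 - 2g) F_g for g >= 2 and theta = 1. The Borel transform in hbar of the
  logarithmic derivative of Z(tau) is therefore explicit in terms of that of h, and the relation between Z(2)
  and Z(1) turns into an equation that expresses h through u / (e^u - 1).
*)

theory Submission
  imports Defs
begin

subsection \<open>Virasoro operators on coefficient functions\<close>

text \<open>The free energies are not among the coefficients that the recursion produces; they enter
  only as a residue of the one-point function against a primitive of \<open>Y dX\<close>. They
  become accessible because z = 1 is a pole of \<open>Y dX\<close>: apart from d = 0, the times of a
  point inserted there are, for theta = 1, the odd Taylor coefficients of that primitive. Changing
  tau therefore amounts to the dilaton field minus a \<open>pd 0\<close> that the constraints
  evaluate explicitly. A point at z = 1/p becomes such a point at p = 1, so a statement about the
  dependence on p yields an equation in tau alone. The recursion singles out its first argument,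
  whereas evaluation at prescribed times needs coefficients symmetric in all arguments; this is the
  use of the Virasoro relations. Each constraint is a difference of two neighbouring operators,
  since division by \<open>Y\<close> puts a factor 1 - z^2 into the kernel. The operator from tau =
  0 to tau = 1 has a Bessel origin: with hbar = 1 / nu, the solution for tau = 0 is the large-order
  series of K_nu, and the operator is, up to elementary factors, the recurrence leading to K_(nu -
  1).\<close>

type_synonym coeffs = "nat multiset \<Rightarrow> complex"

definition pd :: "nat \<Rightarrow> coeffs \<Rightarrow> coeffs" where
  "pd a f M = f (add_mset a M)"

definition sh :: "nat \<Rightarrow> coeffs \<Rightarrow> coeffs" where
  "sh n f = (if n = 0 then (\<lambda>_. 0) else pd (n - 1) f)"

definition x0 :: "coeffs \<Rightarrow> coeffs" where
  "x0 f M = of_nat (count M 0) * f (M - {#0#})"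

definition lin_op :: "nat \<Rightarrow> coeffs \<Rightarrow> coeffs" where
  "lin_op m f M = (\<Sum>d\<in>#M. 2 * of_nat (2 * d + 1) * sh (m + d) f (M - {#d#}))"

text \<open>
  A function \<open>f\<close> on multisets stands for the exponential generating function of its values in variables
  \<open>x\<^sub>d\<close>: then \<open>pd a\<close> is \<open>\<partial>/\<partial>x\<^sub>a\<close>, \<open>sh n\<close> is \<open>\<partial>/\<partial>x\<^sub>n\<^sub>-\<^sub>1\<close> (with \<open>sh 0 = 0\<close>) and \<open>x0\<close> is multiplication by \<open>x\<^sub>0\<close>.
\<close>

definition vir :: "nat \<Rightarrow> coeffs \<Rightarrow> coeffs" where
  "vir m f M = (\<Sum>i\<le>m. sh i (sh (m - i) f) M) + lin_op m f M
     + (if m = 1 then f M / 4 else 0) + (if m = 0 then x0 (x0 f) M else 0)"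

lemma pd_zero [simp]: "pd a (\<lambda>_. 0) = (\<lambda>_. 0)"
  by (simp add: fun_eq_iff pd_def)

lemma sh_0 [simp]: "sh 0 f = (\<lambda>_. 0)" and sh_Suc [simp]: "sh (Suc n) f = pd n f"
  by (simp_all add: sh_def)

lemma sh_zero [simp]: "sh n (\<lambda>_. 0) = (\<lambda>_. 0)"
  by (cases n) simp_all

lemma pd_pd: "pd a (pd b f) M = pd b (pd a f) M"
  by (simp add: pd_def add_mset_commute)

lemma pd_sh: "pd a (sh n f) = sh n (pd a f)"
  by (cases n) (auto simp: fun_eq_iff pd_pd)

lemma sh_sh: "sh a (sh b f) M = sh b (sh a f) M"
  by (cases a; cases b) (auto simp: pd_pd)

text \<open>The end terms i = 0 and i = m contain \<open>sh 0\<close> and vanish; shifting the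
  others by one gives the index range that \<open>conn\<close> uses.\<close>

lemma sum_sh_sh: "(\<Sum>i\<le>m. sh i (sh (m - i) f) M) = (\<Sum>i<m - 1. f (add_mset i (add_mset (m - 2 - i) M)))"
proof (cases m)
  case (Suc n)
  have "(\<Sum>i\<le>m. sh i (sh (m - i) f) M) = (\<Sum>i\<in>{1..n}. sh i (sh (m - i) f) M)"
  proof (rule sum.mono_neutral_right)
    show "\<forall>i\<in>{..m} - {1..n}. sh i (sh (m - i) f) M = 0"
    proof
      fix i assume "i \<in> {..m} - {1..n}"
      then have "i = 0 \<or> i = m" using Suc by auto
      then show "sh i (sh (m - i) f) M = 0" by auto
    qed
  qed (use Suc in auto)
  also have "\<dots> = (\<Sum>i<m - 1. f (add_mset i (add_mset (m - 2 - i) M)))"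
    by (rule sum.reindex_bij_witness[of _ Suc "\<lambda>i. i - 1"])
       (use Suc in \<open>auto simp: sh_def pd_def Suc_diff_le add_mset_commute\<close>)
  finally show ?thesis .
qed simp

lemma pd_x0: "pd a (x0 f) M = x0 (pd a f) M + (if a = 0 then f M else 0)"
proof (cases "0 \<in># M")
  case True
  then have "add_mset a M - {#0#} = add_mset a (M - {#0#})" by simp
  then show ?thesis using True by (auto simp: pd_def x0_def algebra_simps)
next
  case False
  then show ?thesis by (auto simp: pd_def x0_def not_in_iff)
qed

text \<open>The extra term is the summand of \<open>lin_op\<close> that belongs to the newly
  inserted element \<open>a\<close>; all other summands commute with \<open>pd a\<close>.\<close>

lemma pd_lin_op:
  "pd a (lin_op m f) M = lin_op m (pd a f) M + 2 * of_nat (2 * a + 1) * sh (m + a) f M"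
proof -
  have "sh (m + d) f (add_mset a M - {#d#}) = sh (m + d) (pd a f) (M - {#d#})" if "d \<in># M" for d
  proof -
    have "add_mset a M - {#d#} = add_mset a (M - {#d#})" using that by simp
    then show ?thesis by (metis pd_def pd_sh)
  qed
  then have "(\<Sum>d\<in>#M. 2 * of_nat (2 * d + 1) * sh (m + d) f (add_mset a M - {#d#}))
     = lin_op m (pd a f) M"
    unfolding lin_op_def by (intro arg_cong[where f = sum_mset] image_mset_cong) simp
  then show ?thesis by (simp add: pd_def[of a "lin_op m f"] lin_op_def[of m f])
qed

lemma sh_add: "sh n (\<lambda>M. f M + g M) M = sh n f M + sh n g M"
  and sh_scale: "sh n (\<lambda>M. c * f M) M = c * sh n f M"
  by (cases n; simp add: pd_def)+

lemma x0_add: "x0 (\<lambda>M. f M + g M) M = x0 f M + x0 g M"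
  and x0_scale: "x0 (\<lambda>M. c * f M) M = c * x0 f M"
  by (simp_all add: x0_def algebra_simps)

lemma lin_op_add: "lin_op m (\<lambda>M. f M + g M) M = lin_op m f M + lin_op m g M"
  by (simp add: lin_op_def sh_add sum_mset.distrib ring_distribs)

lemma lin_op_scale: "lin_op m (\<lambda>M. c * f M) M = c * lin_op m f M"
  by (simp add: lin_op_def sh_scale sum_mset_distrib_left mult_ac)

lemma sh2_add: "sh n (sh k (\<lambda>M. f M + g M)) M = sh n (sh k f) M + sh n (sh k g) M"
  and sh2_scale: "sh n (sh k (\<lambda>M. c * f M)) M = c * sh n (sh k f) M"
  by (cases n; cases k; simp add: pd_def sh_def)+

lemma vir_add: "vir m (\<lambda>M. f M + g M) M = vir m f M + vir m g M"
proof -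
  have "x0 (x0 (\<lambda>M. f M + g M)) M = x0 (x0 f) M + x0 (x0 g) M"
    by (simp add: x0_def algebra_simps)
  then show ?thesis
    by (simp add: vir_def sh2_add lin_op_add sum.distrib add_divide_distrib)
qed

lemma vir_scale: "vir m (\<lambda>M. c * f M) M = c * vir m f M"
proof -
  have "x0 (x0 (\<lambda>M. c * f M)) M = c * x0 (x0 f) M"
    by (simp add: x0_def algebra_simps)
  then show ?thesis
    by (simp add: vir_def sh2_scale lin_op_scale sum_distrib_left algebra_simps)
qed

lemma vir_zero [simp]: "vir m (\<lambda>_. 0) M = 0"
  using vir_scale[of m 0 "\<lambda>_. 0"] by simp

text \<open>Inserting an element into the argument is differentiation, so commutators with
  \<open>pd a\<close> are the induction steps for operator identities proved over multisets. The
  second-order part commutes with \<open>pd a\<close>; only \<open>lin_op\<close> and the square of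
  \<open>x0\<close> contribute.\<close>

lemma pd_vir:
  "pd a (vir m f) M = vir m (pd a f) M + 2 * of_nat (2 * a + 1) * sh (m + a) f M
     + (if m = 0 \<and> a = 0 then 2 * x0 f M else 0)"
proof -
  have A: "pd a (\<lambda>M. \<Sum>i\<le>m. sh i (sh (m - i) f) M) M = (\<Sum>i\<le>m. sh i (sh (m - i) (pd a f)) M)"
    unfolding pd_def[of a "\<lambda>M. \<Sum>i\<le>m. sh i (sh (m - i) f) M"]
    by (rule sum.cong) (simp_all add: pd_sh flip: pd_def[of a "sh _ _"])
  have X: "pd a (x0 (x0 f)) M = x0 (x0 (pd a f)) M + (if a = 0 then 2 * x0 f M else 0)"
  proof -
    have "pd a (x0 f) = (\<lambda>M. x0 (pd a f) M + (if a = 0 then 1 else 0) * f M)"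
      by (auto simp: fun_eq_iff pd_x0)
    then show ?thesis by (simp add: pd_x0 x0_add x0_scale)
  qed
  show ?thesis using A X pd_lin_op[of a m f M]
    unfolding vir_def[of m f, abs_def] vir_def[of m "pd a f"] by (auto simp: pd_def)
qed

lemma sh_vir:
  assumes "c > 0"
  shows "sh c (vir n f) M = vir n (sh c f) M + 2 * of_nat (2 * c - 1) * sh (n + c - 1) f M
     + (if n = 0 \<and> c = 1 then 2 * x0 f M else 0)"
proof -
  obtain d where "c = Suc d" using assms by (cases c) auto
  then show ?thesis by (simp add: pd_vir)
qed

lemma vir_empty: "vir m f {#} = (\<Sum>i\<le>m. sh i (sh (m - i) f) {#}) + (if m = 1 then f {#} / 4 else 0)"
  by (simp add: vir_def lin_op_def x0_def)

text \<open>Commuting \<open>pd 0\<close> past \<open>vir 0\<close> leaves a factor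
  \<open>x0\<close>, which must then be moved past \<open>vir m\<close> in the proof of the Virasoro
  relations. The first correction comes from the second derivatives hitting \<open>x0\<close>, the
  other one from \<open>lin_op 1\<close>.\<close>

lemma vir_x0:
  assumes "m > 0"
  shows "vir m (x0 f) M - x0 (vir m f) M = 2 * sh (m - 1) f M + (if m = 1 then 2 * x0 f M else 0)"
proof (induction M arbitrary: f)
  case empty
  \<comment> \<open>At the empty multiset \<open>x0\<close> survives only if one of the two
    derivatives is \<open>pd 0\<close>, that is for i = 1 or m - i = 1; for m = 2 both happen at
    once.\<close>
  have S: "sh i (sh (m - i) (x0 f)) {#} = (if i = 1 then sh (m - 1) f {#} else 0)
        + (if i = m - 1 then sh (m - 1) f {#} else 0)" if i: "i \<le> m" for i
  proof (cases "i = 0 \<or> i = m")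
    case True
    then show ?thesis using assms by (auto simp: sh_def pd_def)
  next
    case False
    then have ab: "i = Suc (i - 1)" "m - i = Suc (m - i - 1)" using i by linarith+
    then obtain a b where ab: "i = Suc a" "m - i = Suc b" by blast
    then have m: "m = Suc (Suc (a + b))" using i by linarith
    have p: "pd b (x0 f) = (\<lambda>M. x0 (pd b f) M + (if b = 0 then 1 else 0) * f M)"
      by (auto simp: fun_eq_iff pd_x0)
    have ppp: "pd a (pd b (x0 f)) {#} = x0 (pd a (pd b f)) {#} + (if a = 0 then pd b f {#} else 0)
       + (if b = 0 then pd a f {#} else 0)"
      unfolding p pd_def[of a "\<lambda>M. x0 (pd b f) M + (if b = 0 then 1 else 0) * f M"]
      using pd_x0[of a "pd b f" "{#}"] by (simp add: pd_def)
    show ?thesis using m ppp by (simp add: x0_def ab(1))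
  qed
  have "(\<Sum>i\<le>m. sh i (sh (m - i) (x0 f)) {#}) = (\<Sum>i\<le>m. (if i = 1 then sh (m - 1) f {#} else 0)
        + (if i = m - 1 then sh (m - 1) f {#} else 0))"
    by (rule sum.cong) (simp_all add: S)
  also have "\<dots> = 2 * sh (m - 1) f {#}"
    using assms by (simp add: sum.distrib)
  finally show ?case by (auto simp: vir_empty x0_def[of _ "{#}"])
next
  case (add a M)
  have e: "vir m (x0 f) (add_mset a M) = pd a (vir m (x0 f)) M"
    "x0 (vir m f) (add_mset a M) = pd a (x0 (vir m f)) M"
    "sh (m - 1) f (add_mset a M) = pd a (sh (m - 1) f) M"
    "x0 f (add_mset a M) = pd a (x0 f) M"
    by (simp_all add: pd_def)
  have 1: "pd a (x0 f) = (\<lambda>M. x0 (pd a f) M + (if a = 0 then 1 else 0) * f M)"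
    by (auto simp: fun_eq_iff pd_x0)
  have 2: "pd a (vir m f) = (\<lambda>M. vir m (pd a f) M + 2 * of_nat (2 * a + 1) * sh (m + a) f M)"
    using assms by (auto simp: fun_eq_iff pd_vir)
  have 3: "sh (m + a) (x0 f) M = x0 (sh (m + a) f) M + (if m + a = 1 then f M else 0)"
    using assms by (cases "m + a") (auto simp: pd_x0)
  have L: "pd a (vir m (x0 f)) M = vir m (x0 (pd a f)) M + (if a = 0 then 1 else 0) * vir m f M
     + 2 * of_nat (2 * a + 1) * (x0 (sh (m + a) f) M + (if m + a = 1 then f M else 0))"
    using assms unfolding pd_vir 1 vir_add vir_scale 3 by simp
  have R: "pd a (x0 (vir m f)) M = x0 (vir m (pd a f)) M + 2 * of_nat (2 * a + 1) * x0 (sh (m + a) f) M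
     + (if a = 0 then vir m f M else 0)"
    unfolding pd_x0 2 x0_add x0_scale by simp
  show ?case unfolding e L R
    using add.IH[of "pd a f"] assms by (auto simp: algebra_simps pd_sh pd_x0 pd_def[of a "\<lambda>_. 0"])
qed

text \<open>After reindexing by the first argument of \<open>G\<close>, both sums carry the same
  weight 2k - 2n + 1 up to sign. By the symmetry of \<open>G\<close> the weight may be averaged over
  k and m + n - 1 - k, and the average is m - n.\<close>

lemma antisym_sum:
  fixes G :: "nat \<Rightarrow> nat \<Rightarrow> complex"
  assumes sym: "\<And>i j. G i j = G j i" and mn: "m + n \<ge> 1"
  shows "(\<Sum>i=1..m. of_nat (2 * i - 1) * G (n + i - 1) (m - i))
       - (\<Sum>i=1..n. of_nat (2 * i - 1) * G (m + i - 1) (n - i))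
       = (of_nat m - of_nat n) * (\<Sum>k\<le>m + n - 1. G k (m + n - 1 - k))"
proof -
  define K where "K = m + n - 1"
  define w where "w k = (2 * of_nat k - 2 * of_nat n + 1 :: complex)" for k :: nat
  have A: "(\<Sum>i=1..m. of_nat (2 * i - 1) * G (n + i - 1) (m - i)) = (\<Sum>k\<in>{n..K}. w k * G k (K - k))"
    by (rule sum.reindex_bij_witness[of _ "\<lambda>k. k + 1 - n" "\<lambda>i. n + i - 1"])
       (use mn in \<open>auto simp: K_def w_def of_nat_diff intro!: arg_cong2[where f = "(*)"] arg_cong2[where f = G]\<close>)
  have B: "(\<Sum>i=1..n. of_nat (2 * i - 1) * G (m + i - 1) (n - i)) = (\<Sum>k<n. - w k * G k (K - k))"
  proof (rule sum.reindex_bij_witness[of _ "\<lambda>k. n - k" "\<lambda>i. n - i"])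
    fix i assume i: "i \<in> {1..n}"
    have "G (n - i) (K - (n - i)) = G (m + i - 1) (n - i)"
      by (subst sym, rule arg_cong2[where f = G]) (use i in \<open>auto simp: K_def\<close>)
    then show "- w (n - i) * G (n - i) (K - (n - i)) = of_nat (2 * i - 1) * G (m + i - 1) (n - i)"
      using i by (simp add: w_def of_nat_diff)
  qed auto
  have "{..K} = {..<n} \<union> {n..K}" "{..<n} \<inter> {n..K} = {}"
    using mn by (auto simp: K_def)
  then have D: "(\<Sum>k\<in>{n..K}. w k * G k (K - k)) - (\<Sum>k<n. - w k * G k (K - k)) = (\<Sum>k\<le>K. w k * G k (K - k))"
    by (simp add: sum.union_disjoint sum_negf)
  define S where "S = (\<Sum>k\<le>K. w k * G k (K - k))"
  have "S = (\<Sum>k\<le>K. w (K - k) * G k (K - k))"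
    unfolding S_def by (rule sum.reindex_bij_witness[of _ "\<lambda>k. K - k" "\<lambda>k. K - k"]) (use sym in auto)
  then have "S + S = (\<Sum>k\<le>K. (w k + w (K - k)) * G k (K - k))"
    by (simp add: S_def sum.distrib ring_distribs)
  also have "\<dots> = (\<Sum>k\<le>K. 2 * (of_nat m - of_nat n) * G k (K - k))"
    by (rule sum.cong) (use mn in \<open>auto simp: w_def K_def of_nat_diff\<close>)
  also have "\<dots> = 2 * ((of_nat m - of_nat n) * (\<Sum>k\<le>K. G k (K - k)))"
    by (simp only: sum_distrib_left mult.assoc)
  finally have "S = (of_nat m - of_nat n) * (\<Sum>k\<le>K. G k (K - k))"
    by simp
  then show ?thesis unfolding A B D by (simp only: S_def K_def)
qed

lemma sh_sh_vir_empty: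
  "sh i (sh j (vir n f)) {#} = vir n (sh i (sh j f)) {#}
     + (if i > 0 then 2 * of_nat (2 * i - 1) * sh (n + i - 1) (sh j f) {#} else 0)
     + (if j > 0 then 2 * of_nat (2 * j - 1) * sh (n + j - 1) (sh i f) {#} else 0)
     + (if n = 0 \<and> i = 1 \<and> j = 1 then 2 * f {#} else 0)"
proof (cases "i = 0 \<or> j = 0")
  case True
  then show ?thesis by (auto simp: sh_def pd_def)
next
  case False
  then obtain a b where ab: "i = Suc a" "j = Suc b" by (metis not0_implies_Suc)
  have p: "pd b (vir n f) = (\<lambda>M. (vir n (pd b f) M + 2 * of_nat (2 * b + 1) * sh (n + b) f M)
     + (if n = 0 \<and> b = 0 then 2 else 0) * x0 f M)"
    by (auto simp: fun_eq_iff pd_vir)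
  have "pd a (pd b (vir n f)) {#} = pd a (vir n (pd b f)) {#} + 2 * of_nat (2 * b + 1) * pd a (sh (n + b) f) {#}
     + (if n = 0 \<and> b = 0 then 2 else 0) * pd a (x0 f) {#}"
    unfolding p by (simp add: pd_def)
  also have "\<dots> = vir n (pd a (pd b f)) {#} + 2 * of_nat (2 * a + 1) * sh (n + a) (pd b f) {#}
     + 2 * of_nat (2 * b + 1) * sh (n + b) (pd a f) {#}
     + (if n = 0 \<and> b = 0 \<and> a = 0 then 2 * f {#} else 0)"
    by (simp add: pd_vir pd_x0 pd_sh x0_def)
  finally show ?thesis by (simp add: ab conj_commute)
qed

text \<open>At the empty multiset \<open>lin_op\<close> and \<open>x0\<close> vanish, so only second
  derivatives of the inner operator matter. Fourfold derivatives cancel by symmetry, and the single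
  contractions combine by \<open>antisym_sum\<close>.\<close>

lemma vir_vir_empty:
  assumes "m + n \<ge> 1"
  shows "vir m (vir n f) {#} - vir n (vir m f) {#}
    = 4 * (of_nat m - of_nat n) * vir (m + n - 1) f {#}"
proof -
  define G where "G i j = sh i (sh j f) {#}" for i j
  have sym: "G i j = G j i" for i j by (simp add: G_def sh_sh)
  have S: "vir m (vir n f) {#} = (\<Sum>i\<le>m. vir n (sh i (sh (m - i) f)) {#})
      + 4 * (\<Sum>i=1..m. of_nat (2 * i - 1) * G (n + i - 1) (m - i))
      + (if n = 0 \<and> m = 2 then 2 * f {#} else 0) + (if m = 1 then vir n f {#} / 4 else 0)" for m n
  proof -
    define w where "w i = (if i > 0 then 2 * of_nat (2 * i - 1) * G (n + i - 1) (m - i) else 0)" for i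
    have "(\<Sum>i\<le>m. sh i (sh (m - i) (vir n f)) {#}) = (\<Sum>i\<le>m. vir n (sh i (sh (m - i) f)) {#})
       + (\<Sum>i\<le>m. w i) + (\<Sum>i\<le>m. w (m - i)) + (\<Sum>i\<le>m. if n = 0 \<and> i = 1 \<and> m - i = 1 then 2 * f {#} else 0)"
      unfolding sum.distrib[symmetric]
      by (rule sum.cong) (auto simp: sh_sh_vir_empty w_def G_def)
    moreover have "(\<Sum>i\<le>m. w (m - i)) = (\<Sum>i\<le>m. w i)"
      by (rule sum.reindex_bij_witness[of _ "\<lambda>k. m - k" "\<lambda>k. m - k"]) auto
    moreover have "(\<Sum>i\<le>m. w i) = (\<Sum>i=1..m. 2 * (of_nat (2 * i - 1) * G (n + i - 1) (m - i)))"
      by (rule sum.mono_neutral_cong_right) (auto simp: w_def)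
    then have "(\<Sum>i\<le>m. w i) = 2 * (\<Sum>i=1..m. of_nat (2 * i - 1) * G (n + i - 1) (m - i))"
      by (simp only: sum_distrib_left)
    \<comment> \<open>Both derivatives hit the square of \<open>x0\<close>. The resulting 2 equals 4
      * (2 - 0) * (1/4): this bracket of \<open>vir 2\<close> and \<open>vir 0\<close> forces the
      constant 1/4 in \<open>vir 1\<close>.\<close>
    moreover have "(\<Sum>i\<le>m. if n = 0 \<and> i = 1 \<and> m - i = 1 then 2 * f {#} else 0)
        = (if n = 0 \<and> m = 2 then 2 * f {#} else 0)"
    proof (cases "n = 0 \<and> m = 2")
      case True
      then have "(\<Sum>i\<le>m. if n = 0 \<and> i = 1 \<and> m - i = 1 then 2 * f {#} else 0) = (\<Sum>i\<le>m. if i = 1 then 2 * f {#} else 0)"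
        by (intro sum.cong) auto
      then show ?thesis using True by simp
    next
      case False
      then have "(\<Sum>i\<le>m. if n = 0 \<and> i = 1 \<and> m - i = 1 then 2 * f {#} else 0) = 0"
        by (intro sum.neutral) auto
      then show ?thesis using False by auto
    qed
    ultimately show ?thesis unfolding vir_empty[of m] by (simp only:) simp
  qed
  have T: "(\<Sum>i\<le>m. vir n (sh i (sh (m - i) f)) {#}) = (\<Sum>i\<le>m. \<Sum>j\<le>n. sh j (sh (n - j) (sh i (sh (m - i) f))) {#})
      + (if n = 1 then (\<Sum>i\<le>m. G i (m - i)) / 4 else 0)" for m n
    by (simp add: vir_empty sum.distrib G_def sum_divide_distrib)
  have C: "sh j (sh k (sh i (sh l f))) {#} = sh i (sh l (sh j (sh k f))) {#}" for i j k l
    by (cases i; cases j; cases k; cases l) (auto simp: pd_def sh_def add_mset_commute)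
  have D: "(\<Sum>i\<le>m. \<Sum>j\<le>n. sh j (sh (n - j) (sh i (sh (m - i) f))) {#})
      = (\<Sum>i\<le>n. \<Sum>j\<le>m. sh j (sh (m - j) (sh i (sh (n - i) f))) {#})"
    by (subst sum.swap) (simp add: C)
  have E: "vir k f {#} = (\<Sum>i\<le>k. G i (k - i)) + (if k = 1 then f {#} / 4 else 0)" for k
    by (simp add: vir_empty G_def)
  have F: "(\<Sum>i=1..m. of_nat (2 * i - 1) * G (n + i - 1) (m - i))
       = (\<Sum>i=1..n. of_nat (2 * i - 1) * G (m + i - 1) (n - i))
       + (of_nat m - of_nat n) * (\<Sum>k\<le>m + n - 1. G k (m + n - 1 - k))"
    using antisym_sum[of G m n, OF sym assms] by (simp add: algebra_simps)
  consider "m = 1" "n = 1" | "m = 1" "n \<noteq> 1" | "m \<noteq> 1" "n = 1" | "m \<noteq> 1" "n \<noteq> 1" by auto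
  then show ?thesis
  proof cases
    case 4
    then show ?thesis unfolding S T D F E using assms by (auto simp: algebra_simps)
  qed (unfold S T D F E, auto simp: algebra_simps)
qed

text \<open>With \<open>vir m\<close> = 4 L_(m-1) these are the relations [L_i, L_j] = (i - j)
  L_(i+j) for i, j >= -1, and 1/4 is four times the usual constant 1/16. In the induction,
  differentiating both sides by \<open>pd a\<close> leaves only brackets with \<open>sh\<close> and
  \<open>x0\<close>.\<close>

theorem virasoro:
  assumes "m + n \<ge> 1"
  shows "vir m (vir n f) M - vir n (vir m f) M
    = 4 * (of_nat m - of_nat n) * vir (m + n - 1) f M"
proof (induction M arbitrary: f)
  case empty
  show ?case using vir_vir_empty[OF assms] .
next
  case (add a M)
  have e: "vir m (vir n f) (add_mset a M) = pd a (vir m (vir n f)) M"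
    "vir n (vir m f) (add_mset a M) = pd a (vir n (vir m f)) M"
    "vir (m + n - 1) f (add_mset a M) = pd a (vir (m + n - 1) f) M"
    by (simp_all add: pd_def)
  have p: "pd a (vir n f) = (\<lambda>M. (vir n (pd a f) M + 2 * of_nat (2 * a + 1) * sh (n + a) f M)
     + (if n = 0 \<and> a = 0 then 2 else 0) * x0 f M)" for n
    by (auto simp: fun_eq_iff pd_vir)
  have L: "pd a (vir m (vir n f)) M = vir m (vir n (pd a f)) M + 2 * of_nat (2 * a + 1) * vir m (sh (n + a) f) M
      + (if n = 0 \<and> a = 0 then 2 else 0) * vir m (x0 f) M
      + 2 * of_nat (2 * a + 1) * sh (m + a) (vir n f) M + (if m = 0 \<and> a = 0 then 2 * x0 (vir n f) M else 0)" for m n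
    unfolding pd_vir[of a m "vir n f"] p vir_add vir_scale ..
  note IH = add.IH[of "pd a f"]
  \<comment> \<open>The only situation in which \<open>pd a\<close> produces an \<open>x0\<close>.
    The induction hypothesis is made a premise so that the mirrored case, with the roles of
    \<open>m\<close> and \<open>n\<close> exchanged, can use the same argument.\<close>
  have zero: "vir 0 (vir n f) (add_mset a M) - vir n (vir 0 f) (add_mset a M)
      = 4 * (of_nat 0 - of_nat n) * vir (0 + n - 1) f (add_mset a M)"
    if n: "n > 0" and a: "a = 0" and IH: "vir 0 (vir n (pd a f)) M - vir n (vir 0 (pd a f)) M
      = 4 * (of_nat 0 - of_nat n) * vir (0 + n - 1) (pd a f) M" for n
  proof -
    have x: "vir n (x0 f) M = x0 (vir n f) M + 2 * sh (n - 1) f M + (if n = 1 then 2 * x0 f M else 0)"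
      using vir_x0[of n f M] n by (simp add: algebra_simps)
    have s: "sh n (vir 0 f) M = vir 0 (sh n f) M + 2 * of_nat (2 * n - 1) * sh (n - 1) f M
       + (if n = 1 then 2 * x0 f M else 0)"
      using sh_vir[of n 0 f M] n by simp
    have z: "vir 0 (sh 0 f) M = 0" by (simp add: sh_def)
    have q: "of_nat (2 * n - 1) = (2 * of_nat n - 1 :: complex)" using n by (simp add: of_nat_diff)
    have r: "pd 0 (vir (n - 1) f) M = vir (n - 1) (pd 0 f) M + 2 * sh (n - 1) f M + (if n = 1 then 2 * x0 f M else 0)"
      using pd_vir[of 0 "n - 1" f M] n by auto
    have L1: "vir 0 (vir n f) (add_mset a M) = pd a (vir 0 (vir n f)) M" "vir n (vir 0 f) (add_mset a M)
        = pd a (vir n (vir 0 f)) M"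
      "vir (0 + n - 1) f (add_mset a M) = pd a (vir (0 + n - 1) f) M" by (simp_all add: pd_def)
    show ?thesis unfolding L1 L using IH n a r by (auto simp: x s z q algebra_simps)
  qed
  consider "m + a > 0" "n + a > 0" | "m = 0" "a = 0" "n > 0" | "n = 0" "a = 0" "m > 0"
    using assms by linarith
  then show ?case
  proof cases
    case 1
    have "\<not> (n = 0 \<and> m + a = 1)" "\<not> (m = 0 \<and> n + a = 1)" using 1 assms by auto
    then have s: "sh (m + a) (vir n f) M = vir n (sh (m + a) f) M + 2 * of_nat (2 * (m + a) - 1) * sh (n + m + a
        - 1) f M"
      "sh (n + a) (vir m f) M = vir m (sh (n + a) f) M + 2 * of_nat (2 * (n + a) - 1) * sh (n + m + a - 1) f M"
      using sh_vir[of "m + a" n f M] sh_vir[of "n + a" m f M] 1 by (auto simp: ac_simps)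
    have r: "pd a (vir (m + n - 1) f) M = vir (m + n - 1) (pd a f) M + 2 * of_nat (2 * a + 1) * sh (n + m + a - 1) f M"
      using pd_vir[of a "m + n - 1" f M] assms 1 by (auto simp: ac_simps)
    have z: "\<not> (m = 0 \<and> a = 0)" "\<not> (n = 0 \<and> a = 0)" using 1 by auto
    have q: "of_nat (2 * (m + a) - 1) = (2 * of_nat m + 2 * of_nat a - 1 :: complex)"
      "of_nat (2 * (n + a) - 1) = (2 * of_nat n + 2 * of_nat a - 1 :: complex)"
      using 1 by (subst of_nat_diff; auto)+
    show ?thesis using IH unfolding e L r s q if_not_P[OF z(1)] if_not_P[OF z(2)] by (simp add: algebra_simps)
  next
    case 2
    then show ?thesis using zero[of n] IH by simp
  next
    case 3
    then show ?thesis using zero[of m] IH by (simp add: algebra_simps)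
  qed
qed

subsection \<open>The partition function\<close>

text \<open>
  \<open>part k\<close> is the coefficient of \<open>hbar^k\<close> of the partition function. By \<open>part_rec\<close>, the
  choice of the removed element is irrelevant.
\<close>

primrec part :: "nat \<Rightarrow> coeffs" where
  "part 0 M = (if M = {#} then 1 else 0)"
| "part (Suc k) M = (if M = {#} then 0 else
     let a = (SOME a. a \<in># M) in (vir (Suc a) (part k) (M - {#a#}) - vir a (part k) (M - {#a#})) / 2)"

declare part.simps [simp del]

definition vir' :: "nat \<Rightarrow> coeffs \<Rightarrow> coeffs" where
  "vir' a f M = vir (Suc a) f M - vir a f M"

lemma part_empty: "part k {#} = (if k = 0 then 1 else 0)"
  by (cases k) (auto simp: part.simps)

lemma vir'_scale: "vir' a (\<lambda>M. c * f M) M = c * vir' a f M"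
  by (simp add: vir'_def vir_scale algebra_simps)

lemma pd_vir':
  "pd b (vir' a f) M = vir' a (pd b f) M
     + 2 * of_nat (2 * b + 1) * (pd (a + b) f M - sh (a + b) f M)
     - (if a = 0 \<and> b = 0 then 2 * x0 f M else 0)"
proof -
  have "pd b (vir' a f) M = pd b (vir (Suc a) f) M - pd b (vir a f) M"
    by (simp add: pd_def vir'_def)
  then show ?thesis by (simp add: pd_vir vir'_def algebra_simps)
qed

lemma vir_diff: "vir m (\<lambda>M. f M - g M) M = vir m f M - vir m g M"
  using vir_add[of m f "\<lambda>M. - 1 * g M" M] vir_scale[of m "-1" g M] by simp

text \<open>Of the four Virasoro brackets, the two mixed ones have coefficients a - b + 1 and a - b
  - 1; their sum is 2(a - b), which is just what closes the relation on differences.\<close>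

lemma vir'_vir':
  assumes "a + b \<ge> 1"
  shows "vir' a (vir' b f) M - vir' b (vir' a f) M
    = 4 * (of_nat a - of_nat b) * (vir' (a + b) f M - vir' (a + b - 1) f M)"
proof -
  have ad: "vir' a g = (\<lambda>M. vir (Suc a) g M - vir a g M)" for a g
    by (simp add: fun_eq_iff vir'_def)
  have v: "vir m (vir n f) M = vir n (vir m f) M + 4 * (of_nat m - of_nat n) * vir (m + n - 1) f M"
    if "m + n \<ge> 1" for m n
    using virasoro[OF that, of f M] by (simp add: algebra_simps)
  have 1: "vir (Suc a) (vir (Suc b) f) M = vir (Suc b) (vir (Suc a) f) M + 4 * (of_nat a - of_nat b) * vir (a + b
      + 1) f M"
    using v[of "Suc a" "Suc b"] by simp
  have 2: "vir (Suc a) (vir b f) M = vir b (vir (Suc a) f) M + 4 * (of_nat a + 1 - of_nat b) * vir (a + b) f M"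
    using v[of "Suc a" b] by (simp add: algebra_simps)
  have 3: "vir a (vir (Suc b) f) M = vir (Suc b) (vir a f) M + 4 * (of_nat a - of_nat b - 1) * vir (a + b) f M"
    using v[of a "Suc b"] by (simp add: algebra_simps)
  have 4: "vir a (vir b f) M = vir b (vir a f) M + 4 * (of_nat a - of_nat b) * vir (a + b - 1) f M"
    using v[of a b] assms by simp
  have e: "Suc (a + b - 1) = a + b" using assms by simp
  show ?thesis unfolding ad vir_diff 1 2 3 4 e by (simp add: algebra_simps)
qed

text \<open>Integrability of the constraints. Removing first b and then c differs from the opposite
  order by half of the commutator, 2(b - c) times a difference of \<open>vir'\<close> terms, and by
  the contractions with weights 2c + 1 and 2b + 1; these cancel.\<close>

theorem part_rec: "part (Suc k) (add_mset a M) = vir' a (part k) M / 2"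
proof (induction k arbitrary: a M)
  case (0 a M)
  \<comment> \<open>Two ways of removing one element from the same multiset give the same value;
    this is then applied to the element picked by \<open>SOME\<close>.\<close>
  have *: "vir' b (part 0) M = vir' c (part 0) N" if eq: "add_mset b M = add_mset c N" for b c M N
  proof (cases "b = c")
    case True
    then show ?thesis using eq by simp
  next
    case False
    then obtain K where K: "M = add_mset c K" "N = add_mset b K"
      using eq False unfolding add_eq_conv_ex by blast
    have z: "pd d (part 0) = (\<lambda>_. 0)" for d by (simp add: fun_eq_iff pd_def part.simps)
    have s: "sh d (part 0) K = 0" for d by (cases d) (auto simp: z)
    have "vir' b (part 0) M = pd c (vir' b (part 0)) K" by (simp add: K pd_def)
    also have "\<dots> = pd b (vir' c (part 0)) K"
      using False unfolding pd_vir' z s by (auto simp: vir'_def)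
    finally show ?thesis by (simp add: K pd_def)
  qed
  define c where "c = (SOME c. c \<in># add_mset a M)"
  have "c \<in># add_mset a M" unfolding c_def by (rule someI[of _ a]) simp
  then have "add_mset a M = add_mset c (add_mset a M - {#c#})" by simp
  from *[OF this] have "vir' a (part 0) M = vir' c (part 0) (add_mset a M - {#c#})" .
  moreover have "part (Suc 0) (add_mset a M) = vir' c (part 0) (add_mset a M - {#c#}) / 2"
    unfolding part.simps(2)[of 0] Let_def c_def[symmetric] vir'_def by simp
  ultimately show ?case by simp
next
  case (Suc k a M)
  have *: "vir' b (part (Suc k)) M = vir' c (part (Suc k)) N" if eq: "add_mset b M = add_mset c N" for b c M N
  proof (cases "b = c")
    case True
    then show ?thesis using eq by simp
  next
    case False
    then obtain K where K: "M = add_mset c K" "N = add_mset b K"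
      using eq False unfolding add_eq_conv_ex by blast
    let ?h = "part (Suc k)"
    have p: "pd d ?h = (\<lambda>M. 1 / 2 * vir' d (part k) M)" for d
      unfolding fun_eq_iff pd_def Suc.IH by simp
    have bc: "b + c \<ge> 1" "\<not> (b = 0 \<and> c = 0)" using False by auto
    then obtain n where n: "b + c = Suc n" by (cases "b + c") auto
    \<comment> \<open>By induction \<open>pd c\<close> of the current order is again half of
      \<open>vir' c\<close> of the previous order, so the mixed derivative becomes a product of two
      operators plus a contraction.\<close>
    have q: "pd c (vir' b ?h) K = 1 / 2 * vir' b (vir' c (part k)) K
       + of_nat (2 * c + 1) * (vir' (b + c) (part k) K - vir' (b + c - 1) (part k) K)"
      if "b + c = Suc n" "\<not> (b = 0 \<and> c = 0)" for b c
      unfolding pd_vir' if_not_P[OF that(2)] that(1) sh_Suc p vir'_scale by (simp add: algebra_simps)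
    have "vir' b ?h M = pd c (vir' b ?h) K" by (simp add: K pd_def)
    also have "\<dots> = pd b (vir' c ?h) K"
    proof -
      have v: "vir' b (vir' c (part k)) K = vir' c (vir' b (part k)) K
          + 4 * (of_nat b - of_nat c) * (vir' (b + c) (part k) K - vir' (b + c - 1) (part k) K)"
        using vir'_vir'[OF bc(1), of "part k" K] by (simp only: algebra_simps)
      have q': "pd b (vir' c ?h) K = 1 / 2 * vir' c (vir' b (part k)) K
          + of_nat (2 * b + 1) * (vir' (b + c) (part k) K - vir' (b + c - 1) (part k) K)"
      proof -
        have "c + b = Suc n" "\<not> (c = 0 \<and> b = 0)" using n bc by auto
        from q[OF this] show ?thesis by (simp only: add.commute[of c b])
      qed
      show ?thesis unfolding q[OF n bc(2)] q' v by (simp add: field_simps)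
    qed
    finally show ?thesis by (simp add: K pd_def)
  qed
  define c where "c = (SOME c. c \<in># add_mset a M)"
  have "c \<in># add_mset a M" unfolding c_def by (rule someI[of _ a]) simp
  then have "add_mset a M = add_mset c (add_mset a M - {#c#})" by simp
  from *[OF this] have "vir' a (part (Suc k)) M = vir' c (part (Suc k)) (add_mset a M - {#c#})" .
  moreover have "part (Suc (Suc k)) (add_mset a M) = vir' c (part (Suc k)) (add_mset a M - {#c#}) / 2"
    unfolding part.simps(2)[of "Suc k"] Let_def c_def[symmetric] vir'_def by simp
  ultimately show ?case by simp
qed

corollary pd_part: "pd a (part (Suc k)) = (\<lambda>M. 1 / 2 * vir' a (part k) M)"
  unfolding fun_eq_iff pd_def part_rec by simp

section \<open>Support bounds: each order in hbar is a polynomial in the times\<close>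

definition supp :: "coeffs \<Rightarrow> nat \<Rightarrow> nat \<Rightarrow> bool" where
  "supp f s w \<longleftrightarrow> (\<forall>M. f M \<noteq> 0 \<longrightarrow> size M \<le> s \<and> sum_mset M \<le> w)"

lemma supp_zero: "supp f s w \<Longrightarrow> size M > s \<or> sum_mset M > w \<Longrightarrow> f M = 0"
  by (meson supp_def not_less)

lemma supp_vir:
  assumes "supp f s w" "vir m f M \<noteq> 0"
  shows "size M \<le> s + 2" "sum_mset M + m \<le> w + 2"
proof -
  have "size M \<le> s + 2 \<and> sum_mset M + m \<le> w + 2"
  proof (rule ccontr)
    assume c: "\<not> ?thesis"
    have "sh i (sh j f) M = 0" if "i + j = m" for i j
      by (cases i; cases j) (use c that in \<open>auto simp: pd_def intro!: supp_zero[OF assms(1)]\<close>)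
    then have 1: "(\<Sum>i\<le>m. sh i (sh (m - i) f) M) = 0" by (intro sum.neutral) auto
    have "sh (m + d) f (M - {#d#}) = 0" if d: "d \<in># M" for d
    proof -
      obtain N where N: "M = add_mset d N" using d by (meson multi_member_split)
      show ?thesis
        by (cases "m + d") (use c N in \<open>auto simp: pd_def intro!: supp_zero[OF assms(1)]\<close>)
    qed
    then have "image_mset (\<lambda>d. 2 * of_nat (2 * d + 1) * sh (m + d) f (M - {#d#})) M = image_mset (\<lambda>_. 0) M"
      by (intro image_mset_cong) auto
    then have 2: "lin_op m f M = 0" unfolding lin_op_def by simp
    have 3: "x0 (x0 f) M = 0" if m: "m = 0"
    proof (cases "0 \<in># M \<and> 0 \<in># M - {#0#}")
      case True
      then obtain N where N: "M = add_mset 0 (add_mset 0 N)"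
        by (metis add_mset_remove_trivial_If multi_member_split)
      show ?thesis using c m N by (auto simp: x0_def intro!: supp_zero[OF assms(1)])
    next
      case False
      then show ?thesis by (auto simp: x0_def not_in_iff)
    qed
    have 4: "f M = 0" if "m = 1" using c that by (auto intro!: supp_zero[OF assms(1)])
    have "vir m f M = 0" using 1 2 3 4 by (cases "m = 0"; cases "m = 1") (simp_all add: vir_def)
    then show False using assms(2) by simp
  qed
  then show "size M \<le> s + 2" "sum_mset M + m \<le> w + 2" by auto
qed

text \<open>One order in hbar adds at most two elements through \<open>vir'\<close> and one through
  the inserted \<open>a\<close>; the weight bound grows by 2 because \<open>vir a\<close> lowers the
  weight by a - 2 at least, which pays for the inserted \<open>a\<close>.\<close>

lemma supp_part: "supp (part k) (3 * k) (2 * k)"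
proof (induction k)
  case 0
  then show ?case by (auto simp: supp_def part.simps)
next
  case (Suc k)
  show ?case unfolding supp_def
  proof (intro allI impI)
    fix M assume M: "part (Suc k) M \<noteq> 0"
    show "size M \<le> 3 * Suc k \<and> sum_mset M \<le> 2 * Suc k"
    proof (cases M)
      case (add a N)
      then have "vir' a (part k) N \<noteq> 0" using M by (simp add: part_rec)
      then have "vir (Suc a) (part k) N \<noteq> 0 \<or> vir a (part k) N \<noteq> 0" by (auto simp: vir'_def)
      then show ?thesis using supp_vir[OF Suc.IH, of _ N] add by fastforce
    qed (use M in simp)
  qed
qed

lemma supp_pd: "supp f s w \<Longrightarrow> supp (pd a f) s w"
  by (fastforce simp: supp_def pd_def)

lemma supp_sh: "supp f s w \<Longrightarrow> supp (sh a f) s w"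
  by (cases a) (simp_all add: supp_pd, simp add: supp_def)

subsection \<open>Evaluation at given times\<close>

definition dd :: "nat \<Rightarrow> (nat \<Rightarrow> complex) \<Rightarrow> coeffs \<Rightarrow> coeffs" where
  "dd N T f M = (\<Sum>d<N. T d * pd d f M)"

text \<open>Taylor's formula: the exponential of the directional derivative \<open>dd N T\<close>,
  taken at the origin, is the value at the times \<open>T\<close>. One number \<open>N\<close> cuts
  off both the times and the exponential series; by \<open>ev_cong_bound\<close> the value is
  independent of it beyond the support bounds.\<close>

definition ev :: "nat \<Rightarrow> (nat \<Rightarrow> complex) \<Rightarrow> coeffs \<Rightarrow> complex" where
  "ev N T f = (\<Sum>n\<le>N. (dd N T ^^ n) f {#} / fact n)"

lemma dd_add: "dd N T (\<lambda>M. f M + g M) = (\<lambda>M. dd N T f M + dd N T g M)"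
  by (simp add: fun_eq_iff dd_def pd_def sum.distrib ring_distribs)

lemma dd_scale: "dd N T (\<lambda>M. c * f M) = (\<lambda>M. c * dd N T f M)"
  by (simp add: fun_eq_iff dd_def pd_def sum_distrib_left mult_ac)

lemma dd_pow_add: "(dd N T ^^ n) (\<lambda>M. f M + g M) = (\<lambda>M. (dd N T ^^ n) f M + (dd N T ^^ n) g M)"
  by (induction n) (simp_all add: dd_add)

lemma dd_pow_scale: "(dd N T ^^ n) (\<lambda>M. c * f M) = (\<lambda>M. c * (dd N T ^^ n) f M)"
  by (induction n) (simp_all add: dd_scale)

lemma ev_add: "ev N T (\<lambda>M. f M + g M) = ev N T f + ev N T g"
  by (simp add: ev_def dd_pow_add sum.distrib add_divide_distrib)

lemma ev_scale: "ev N T (\<lambda>M. c * f M) = c * ev N T f"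
  by (simp add: ev_def dd_pow_scale sum_distrib_left)

lemma ev_zero [simp]: "ev N T (\<lambda>_. 0) = 0"
  using ev_scale[of N T 0 "\<lambda>_. 0"] by simp

lemma ev_sum: "finite I \<Longrightarrow> ev N T (\<lambda>M. \<Sum>i\<in>I. f i M) = (\<Sum>i\<in>I. ev N T (f i))"
  by (induction rule: finite_induct) (simp_all add: ev_add)

lemma ev_diff: "ev N T (\<lambda>M. f M - g M) = ev N T f - ev N T g"
  using ev_add[of N T f "\<lambda>M. - 1 * g M"] ev_scale[of N T "-1" g] by simp

lemma dd_pd: "dd N T (pd a f) = pd a (dd N T f)"
  by (simp add: fun_eq_iff dd_def pd_def add_mset_commute)

lemma dd_sh: "dd N T (sh a f) = sh a (dd N T f)"
  by (cases a) (simp_all add: dd_pd, simp add: fun_eq_iff dd_def)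

lemma dd_dd: "dd N T (dd N S f) = dd N S (dd N T f)"
proof
  fix M
  have "dd N T (dd N S f) M = (\<Sum>d<N. \<Sum>e<N. T d * (S e * f (add_mset e (add_mset d M))))"
    by (simp add: dd_def pd_def sum_distrib_left)
  also have "\<dots> = (\<Sum>e<N. \<Sum>d<N. T d * (S e * f (add_mset e (add_mset d M))))"
    by (rule sum.swap)
  also have "\<dots> = dd N S (dd N T f) M"
    by (simp add: dd_def pd_def sum_distrib_left add_mset_commute mult.left_commute)
  finally show "dd N T (dd N S f) M = dd N S (dd N T f) M" .
qed

lemma dd_pow_dd: "(dd N T ^^ n) (dd N S f) = dd N S ((dd N T ^^ n) f)"
  by (induction n) (simp_all add: dd_dd)

lemma dd_pow_eq_0:
  assumes "supp f s w" "n + size M > s"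
  shows "(dd N T ^^ n) f M = 0"
  using assms(2)
proof (induction n arbitrary: M)
  case 0
  then show ?case using supp_zero[OF assms(1)] by simp
next
  case (Suc n)
  then show ?case by (simp add: dd_def pd_def)
qed

lemma supp_dd: "supp f s w \<Longrightarrow> supp (dd N T f) s w"
  unfolding supp_def
proof (intro allI impI)
  fix M
  assume f: "\<forall>M. f M \<noteq> 0 \<longrightarrow> size M \<le> s \<and> sum_mset M \<le> w" and "dd N T f M \<noteq> 0"
  then obtain d where "f (add_mset d M) \<noteq> 0"
    unfolding dd_def pd_def by (metis (no_types, lifting) mult_eq_0_iff sum.neutral)
  then show "size M \<le> s \<and> sum_mset M \<le> w" using f by fastforce
qed

lemma supp_dd_pow: "supp f s w \<Longrightarrow> supp ((dd N T ^^ n) f) s w"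
  by (induction n) (simp_all add: supp_dd)

lemma sum_shift_fact:
  fixes g :: "nat \<Rightarrow> complex"
  shows "(\<Sum>n\<le>N. of_nat n * g (n - 1) / fact n) = (\<Sum>n<N. g n / fact n)"
proof (cases N)
  case (Suc m)
  have "(\<Sum>n\<le>N. of_nat n * g (n - 1) / fact n) = (\<Sum>n\<le>m. of_nat (Suc n) * g n / fact (Suc n))"
    unfolding Suc by (subst sum.atMost_Suc_shift) (simp del: fact_Suc of_nat_Suc)
  also have "\<dots> = (\<Sum>n\<le>m. g n / fact n)"
    by (rule sum.cong) (simp_all add: field_simps del: of_nat_Suc)
  finally show ?thesis by (simp add: Suc lessThan_Suc_atMost)
qed simp

lemma ev_shift:
  assumes "supp g s w" "s < N"
  shows "(\<Sum>n\<le>N. of_nat n * (dd N T ^^ (n - 1)) g {#} / fact n) = ev N T g"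
proof -
  have "(dd N T ^^ N) g {#} = 0" using dd_pow_eq_0[OF assms(1), of N "{#}"] assms(2) by simp
  then have "ev N T g = (\<Sum>n<N. (dd N T ^^ n) g {#} / fact n)"
    by (simp add: ev_def flip: lessThan_Suc_atMost)
  then show ?thesis using sum_shift_fact[of "\<lambda>n. (dd N T ^^ n) g {#}" N] by simp
qed

text \<open>If [D, A] = B commutes with D, then exp(D) A = (A + B) exp(D), and \<open>A\<close>
  contributes nothing at the origin. This is how multiplication by x_d turns into multiplication by
  \<open>T d\<close>.\<close>

lemma ev_leibniz:
  assumes D: "\<And>g. dd N T (A g) = (\<lambda>M. A (dd N T g) M + B g M)"
    and B: "\<And>g. dd N T (B g) = B (dd N T g)"
    and A0: "\<And>g. A g {#} = 0" and "supp (B f) s w" "s < N"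
  shows "ev N T (A f) = ev N T (B f)"
proof -
  have Bp: "(dd N T ^^ n) (B f) = B ((dd N T ^^ n) f)" for n
    by (induction n) (simp_all add: B)
  have "(dd N T ^^ n) (A f) = (\<lambda>M. A ((dd N T ^^ n) f) M + of_nat n * (dd N T ^^ (n - 1)) (B f) M)" for n
  proof (induction n)
    case (Suc n)
    have "(dd N T ^^ Suc n) (A f) = dd N T (\<lambda>M. A ((dd N T ^^ n) f) M + of_nat n * (dd N T ^^ (n - 1)) (B f) M)"
      by (simp add: Suc)
    also have "\<dots> = (\<lambda>M. A ((dd N T ^^ Suc n) f) M + (dd N T ^^ n) (B f) M + of_nat n * dd N T ((dd N T ^^ (n
        - 1)) (B f)) M)"
      by (simp add: dd_add dd_scale D Bp)
    also have "\<dots> = (\<lambda>M. A ((dd N T ^^ Suc n) f) M + of_nat (Suc n) * (dd N T ^^ n) (B f) M)"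
      by (cases n) (simp_all add: fun_eq_iff algebra_simps)
    finally show ?case by simp
  qed simp
  then have "ev N T (A f) = (\<Sum>n\<le>N. of_nat n * (dd N T ^^ (n - 1)) (B f) {#} / fact n)"
    by (simp add: ev_def A0)
  then show ?thesis using ev_shift[OF assms(4,5)] by simp
qed

lemma supp_sum: "(\<And>i. i \<in> I \<Longrightarrow> supp (f i) s w) \<Longrightarrow> supp (\<lambda>M. \<Sum>i\<in>I. f i M) s w"
  unfolding supp_def by (metis (no_types, lifting) sum.neutral)

lemma supp_scale: "supp f s w \<Longrightarrow> supp (\<lambda>M. c * f M) s w"
  by (auto simp: supp_def)

lemma ev_x0:
  assumes "supp f s w" "s < N"
  shows "ev N T (x0 f) = T 0 * ev N T f"
proof -
  have "ev N T (x0 f) = ev N T (\<lambda>M. T 0 * f M)"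
  proof (rule ev_leibniz[of N T x0 "\<lambda>f M. T 0 * f M"])
    show "dd N T (x0 g) = (\<lambda>M. x0 (dd N T g) M + T 0 * g M)" for g
    proof
      fix M
      have "dd N T (x0 g) M = (\<Sum>d<N. T d * x0 (pd d g) M) + (\<Sum>d<N. if d = 0 then T d * g M else 0)"
        unfolding dd_def pd_x0 sum.distrib[symmetric] by (rule sum.cong) (auto simp: algebra_simps)
      also have "(\<Sum>d<N. T d * x0 (pd d g) M) = x0 (dd N T g) M"
        by (simp add: x0_def dd_def sum_distrib_left mult_ac)
      finally show "dd N T (x0 g) M = x0 (dd N T g) M + T 0 * g M" using assms(2) by simp
    qed
  qed (use assms in \<open>auto simp: dd_scale x0_def intro: supp_scale\<close>)
  then show ?thesis by (simp add: ev_scale)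
qed

lemma lin_op_zero: "lin_op m (\<lambda>_. 0) M = 0"
  by (simp add: lin_op_def)

lemma lin_op_dd: "lin_op m (dd N T g) M = (\<Sum>d<N. T d * lin_op m (pd d g) M)"
proof -
  have "lin_op m (\<lambda>M. \<Sum>d\<in>I. T d * pd d g M) M = (\<Sum>d\<in>I. T d * lin_op m (pd d g) M)" if "finite I" for I
    using that by (induction rule: finite_induct) (simp_all add: lin_op_add lin_op_scale lin_op_zero)
  from this[of "{..<N}"] show ?thesis by (simp add: dd_def[abs_def])
qed

lemma ev_lin_op:
  assumes "supp f s w" "s < N"
  shows "ev N T (lin_op m f) = (\<Sum>d<N. 2 * of_nat (2 * d + 1) * T d * ev N T (sh (m + d) f))"
proof -
  let ?B = "\<lambda>f M. \<Sum>d<N. 2 * of_nat (2 * d + 1) * T d * sh (m + d) f M"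
  have "ev N T (lin_op m f) = ev N T (?B f)"
  proof (rule ev_leibniz[of N T "lin_op m" ?B])
    show "dd N T (lin_op m g) = (\<lambda>M. lin_op m (dd N T g) M + ?B g M)" for g
      unfolding fun_eq_iff dd_def[of N T "lin_op m g"] pd_lin_op lin_op_dd sum.distrib[symmetric]
      by (auto simp: algebra_simps)
    show "dd N T (?B g) = ?B (dd N T g)" for g
    proof -
      have "dd N T (\<lambda>M. \<Sum>d\<in>I. c d * h d M) = (\<lambda>M. \<Sum>d\<in>I. c d * dd N T (h d) M)" if "finite I" for I c h
        using that by (induction rule: finite_induct) (simp_all add: dd_add dd_scale, simp add: dd_def fun_eq_iff)
      from this[of "{..<N}"] show ?thesis by (simp only: finite_lessThan dd_sh)
    qed
  qed (use assms in \<open>auto simp: lin_op_def intro!: supp_sum supp_scale supp_sh\<close>)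
  then show ?thesis by (simp add: ev_sum ev_scale)
qed

lemma supp_x0: "supp f s w \<Longrightarrow> supp (x0 f) (Suc s) w"
  unfolding supp_def
proof (intro allI impI)
  fix M
  assume f: "\<forall>M. f M \<noteq> 0 \<longrightarrow> size M \<le> s \<and> sum_mset M \<le> w" and M: "x0 f M \<noteq> 0"
  then have "0 \<in># M" by (auto simp: x0_def not_in_iff)
  then obtain K where "M = add_mset 0 K" by (meson multi_member_split)
  then show "size M \<le> Suc s \<and> sum_mset M \<le> w" using f M by (auto simp: x0_def)
qed

lemma ev_vir:
  assumes "supp f s w" "s + 1 < N"
  shows "ev N T (vir m f) = (\<Sum>i\<le>m. ev N T (sh i (sh (m - i) f)))
     + (\<Sum>d<N. 2 * of_nat (2 * d + 1) * T d * ev N T (sh (m + d) f))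
     + (if m = 1 then ev N T f / 4 else 0) + (if m = 0 then T 0 ^ 2 * ev N T f else 0)"
proof -
  have "vir m f = (\<lambda>M. (((\<Sum>i\<le>m. sh i (sh (m - i) f) M) + lin_op m f M)
     + (if m = 1 then 1 / 4 else 0) * f M) + (if m = 0 then 1 else 0) * x0 (x0 f) M)"
    by (auto simp: fun_eq_iff vir_def)
  moreover have "ev N T (x0 (x0 f)) = T 0 ^ 2 * ev N T f"
    using ev_x0[OF supp_x0[OF assms(1)], of N T] ev_x0[OF assms(1), of N T] assms(2)
    by (simp add: power2_eq_square)
  moreover have "ev N T (lin_op m f) = (\<Sum>d<N. 2 * of_nat (2 * d + 1) * T d * ev N T (sh (m + d) f))"
    using ev_lin_op[OF assms(1)] assms(2) by simp
  ultimately show ?thesis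
    by (simp add: ev_add ev_scale ev_sum)
qed

lemma ev_dd: "ev N T (dd N S f) = (\<Sum>d<N. S d * ev N T (pd d f))"
  unfolding dd_def[abs_def] by (simp add: ev_sum ev_scale)

text \<open>Directional derivatives along different vectors commute, so the derivative of the n-th
  power is n times a single term, as for numbers.\<close>

lemma has_field_derivative_dd_pow:
  assumes "\<And>d. d < N \<Longrightarrow> ((\<lambda>p. T p d) has_field_derivative T' d) (at p)"
  shows "((\<lambda>p. (dd N (T p) ^^ n) f M) has_field_derivative
    of_nat n * (dd N (T p) ^^ (n - 1)) (dd N T' f) M) (at p)"
proof (induction n arbitrary: M)
  case (Suc n)
  have "((\<lambda>p. \<Sum>d<N. T p d * (dd N (T p) ^^ n) f (add_mset d M)) has_field_derivative
     (\<Sum>d<N. T' d * (dd N (T p) ^^ n) f (add_mset d M)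
       + of_nat n * (dd N (T p) ^^ (n - 1)) (dd N T' f) (add_mset d M) * T p d)) (at p)"
    by (intro DERIV_sum DERIV_mult) (use assms Suc in auto)
  also have "(\<Sum>d<N. T' d * (dd N (T p) ^^ n) f (add_mset d M)
       + of_nat n * (dd N (T p) ^^ (n - 1)) (dd N T' f) (add_mset d M) * T p d)
     = dd N T' ((dd N (T p) ^^ n) f) M + of_nat n * dd N (T p) ((dd N (T p) ^^ (n - 1)) (dd N T' f)) M"
    by (simp add: dd_def[of N T'] dd_def[of N "T p" "(dd N (T p) ^^ (n - Suc 0)) (dd N T' f)"] pd_def
        sum.distrib sum_distrib_left mult_ac)
  also have "\<dots> = of_nat (Suc n) * (dd N (T p) ^^ n) (dd N T' f) M"
    by (cases n) (simp_all add: dd_pow_dd dd_dd[of N T' "T p"] algebra_simps)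
  finally show ?case by (simp add: dd_def[of N "T _" "(dd N (T _) ^^ n) f"] pd_def)
qed simp

lemma has_field_derivative_ev:
  assumes "\<And>d. d < N \<Longrightarrow> ((\<lambda>p. T p d) has_field_derivative T' d) (at p)"
    and "supp f s w" "s < N"
  shows "((\<lambda>p. ev N (T p) f) has_field_derivative ev N (T p) (dd N T' f)) (at p)"
proof -
  have "((\<lambda>p. ev N (T p) f) has_field_derivative
    (\<Sum>n\<le>N. of_nat n * (dd N (T p) ^^ (n - 1)) (dd N T' f) {#} / fact n)) (at p)"
    unfolding ev_def
    by (intro DERIV_sum DERIV_cdivide has_field_derivative_dd_pow assms(1))
  then show ?thesis using ev_shift[OF supp_dd[OF assms(2)] assms(3)] by simp
qed

lemma dd_cong_bound:
  assumes "supp f s w" "w < N" "w < N'"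
  shows "dd N T f = dd N' T f"
proof -
  have "dd K T f M = (\<Sum>d\<le>w. T d * pd d f M)" if "w < K" for K M
    unfolding dd_def
  proof (rule sum.mono_neutral_right)
    show "\<forall>d\<in>{..<K} - {..w}. T d * pd d f M = 0"
      by (auto simp: pd_def intro!: supp_zero[OF assms(1)])
  qed (use that in auto)
  then show ?thesis using assms by auto
qed

lemma ev_cong_bound:
  assumes "supp f s w" "w < N" "w < N'" "s < N" "s < N'"
  shows "ev N T f = ev N' T f"
proof -
  have p: "(dd N T ^^ n) f = (dd N' T ^^ n) f" for n
    by (induction n) (simp_all add: dd_cong_bound[OF supp_dd_pow[OF assms(1)] assms(2,3)])
  have "ev K T f = (\<Sum>n\<le>s. (dd K T ^^ n) f {#} / fact n)" if "s < K" for K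
    unfolding ev_def
    by (rule sum.mono_neutral_right) (use that dd_pow_eq_0[OF assms(1), of _ "{#}"] in auto)
  then show ?thesis using assms p by simp
qed

lemma ev_times_zero: "ev N (\<lambda>_. 0) f = f {#}"
proof -
  have "dd N (\<lambda>_. 0) g = (\<lambda>_. 0)" for g by (simp add: fun_eq_iff dd_def)
  then have "(dd N (\<lambda>_. 0) ^^ n) f {#} = (if n = 0 then f {#} else 0)" for n
    by (cases n) simp_all
  then have "ev N (\<lambda>_. 0) f = (\<Sum>n\<le>N. if n = 0 then f {#} else 0)"
    unfolding ev_def by (intro sum.cong) auto
  then show ?thesis by simp
qed

subsection \<open>The quantum curve and the dilaton equation\<close>

text \<open>The summand with p is the primitive of z^(-2d-2), vanishing at infinity, at z = 1/p;
  differentiation in p then inserts the generating sum of p^(2d) \<open>pd d\<close>.\<close>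

definition times :: "complex \<Rightarrow> complex \<Rightarrow> nat \<Rightarrow> complex" where
  "times p \<tau> d = - (p ^ (2 * d + 1) + \<tau>) / of_nat (2 * d + 1)"

definition part_val :: "nat \<Rightarrow> complex \<Rightarrow> complex \<Rightarrow> complex" where
  "part_val k p \<tau> = ev (3 * k + 1) (times p \<tau>) (part k)"

lemma part_val_eq: "N > 3 * k \<Longrightarrow> ev N (times p \<tau>) (part k) = part_val k p \<tau>"
  unfolding part_val_def by (rule ev_cong_bound[OF supp_part]) auto

lemma part_val_0: "part_val 0 p \<tau> = 1"
proof -
  have "dd N T (part 0) = (\<lambda>_. 0)" for N T
    by (simp add: fun_eq_iff dd_def pd_def part.simps)
  then show ?thesis by (simp add: part_val_def ev_def part_empty)
qed

lemma times_scale: "2 * of_nat (2 * d + 1) * times p \<tau> d = - 2 * (p ^ (2 * d + 1) + \<tau>)"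
proof -
  have "of_nat (2 * d + 1) \<noteq> (0 :: complex)" by (metis Suc_eq_plus1 of_nat_neq_0)
  then show ?thesis by (simp add: times_def field_simps del: of_nat_add of_nat_mult)
qed

lemma part_val_zero: "part_val k 0 0 = (if k = 0 then 1 else 0)"
proof -
  have "times 0 0 = (\<lambda>_. 0)" by (simp add: fun_eq_iff times_def)
  then show ?thesis by (simp add: part_val_def ev_times_zero part_empty)
qed

text \<open>At p = 1 the extra point merges with the tau points. This converts the contiguity in p
  into a relation between consecutive values of tau.\<close>

lemma part_val_one: "part_val k 1 \<tau> = part_val k 0 (\<tau> + 1)"
proof -
  have "times 1 \<tau> = times 0 (\<tau> + 1)" by (simp add: fun_eq_iff times_def add.commute)
  then show ?thesis by (simp add: part_val_def)
qed

lemma times_deriv: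
  "((\<lambda>p. times p \<tau> d) has_field_derivative - (p ^ (2 * d))) (at p)"
proof -
  have nz: "of_nat (2 * d + 1) \<noteq> (0 :: complex)" by (metis Suc_eq_plus1 of_nat_neq_0)
  have "((\<lambda>p. times p \<tau> d) has_field_derivative - (of_nat (2 * d + 1) * p ^ (2 * d)) / of_nat (2 * d + 1)) (at p)"
  proof -
    have "((\<lambda>p. p ^ (2 * d + 1)) has_field_derivative of_nat (2 * d + 1) * p ^ (2 * d)) (at p)"
      using DERIV_power[OF DERIV_ident, of "2 * d + 1" p UNIV] by simp
    then have "((\<lambda>p. - (p ^ (2 * d + 1) + \<tau>) / of_nat (2 * d + 1)) has_field_derivative
        - (of_nat (2 * d + 1) * p ^ (2 * d) + 0) / of_nat (2 * d + 1)) (at p)"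
      by (intro DERIV_cdivide DERIV_minus DERIV_add DERIV_const)
    then show ?thesis unfolding times_def by simp
  qed
  then show ?thesis using nz by (simp del: of_nat_add of_nat_mult of_nat_Suc)
qed

lemma part_val_deriv:
  assumes "N > 3 * k"
  shows "((\<lambda>p. part_val k p \<tau>) has_field_derivative
    - (\<Sum>d<N. p ^ (2 * d) * ev N (times p \<tau>) (pd d (part k)))) (at p)"
proof -
  have "((\<lambda>p. ev N (times p \<tau>) (part k)) has_field_derivative ev N (times p \<tau>) (dd N (\<lambda>d. - (p ^ (2
      * d))) (part k))) (at p)"
    by (rule has_field_derivative_ev[OF _ supp_part]) (use assms times_deriv in auto)
  then show ?thesis by (simp add: part_val_eq[OF assms] ev_dd sum_negf)
qed

lemma part_val_deriv2:
  assumes "N > 3 * k"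
  shows "((\<lambda>p. - (\<Sum>d<N. p ^ (2 * d) * ev N (times p \<tau>) (pd d (part k)))) has_field_derivative
    (\<Sum>i<N. \<Sum>j<N. p ^ (2 * i) * p ^ (2 * j) * ev N (times p \<tau>) (pd i (pd j (part k))))
    - (\<Sum>d<N. of_nat (2 * d) * p ^ (2 * d - 1) * ev N (times p \<tau>) (pd d (part k)))) (at p)"
proof -
  have d: "((\<lambda>p. ev N (times p \<tau>) (pd d (part k))) has_field_derivative
     - (\<Sum>i<N. p ^ (2 * i) * ev N (times p \<tau>) (pd i (pd d (part k))))) (at p)" for d
  proof -
    have "((\<lambda>p. ev N (times p \<tau>) (pd d (part k))) has_field_derivative ev N (times p \<tau>) (dd N (\<lambda>d. - (p ^ (2
        * d))) (pd d (part k)))) (at p)"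
      by (rule has_field_derivative_ev[OF _ supp_pd[OF supp_part]]) (use assms times_deriv in auto)
    then show ?thesis by (simp add: ev_dd sum_negf)
  qed
  have pw: "((\<lambda>p. p ^ (2 * d)) has_field_derivative of_nat (2 * d) * p ^ (2 * d - 1)) (at p)" for d
    by (auto intro!: derivative_eq_intros)
  have "((\<lambda>p. - (\<Sum>d<N. p ^ (2 * d) * ev N (times p \<tau>) (pd d (part k)))) has_field_derivative
     - (\<Sum>d<N. of_nat (2 * d) * p ^ (2 * d - 1) * ev N (times p \<tau>) (pd d (part k))
       + - (\<Sum>i<N. p ^ (2 * i) * ev N (times p \<tau>) (pd i (pd d (part k)))) * p ^ (2 * d))) (at p)"
    by (intro DERIV_minus DERIV_sum DERIV_mult pw d)
  moreover have "- (\<Sum>d<N. of_nat (2 * d) * p ^ (2 * d - 1) * ev N (times p \<tau>) (pd d (part k))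
       + - (\<Sum>i<N. p ^ (2 * i) * ev N (times p \<tau>) (pd i (pd d (part k)))) * p ^ (2 * d))
     = (\<Sum>i<N. \<Sum>j<N. p ^ (2 * i) * p ^ (2 * j) * ev N (times p \<tau>) (pd i (pd j (part k))))
    - (\<Sum>d<N. of_nat (2 * d) * p ^ (2 * d - 1) * ev N (times p \<tau>) (pd d (part k)))"
    unfolding sum.distrib by (subst sum.swap) (simp add: sum_negf sum_distrib_left sum_distrib_right mult_ac)
  ultimately show ?thesis by simp
qed

lemma box_to_triangle:
  fixes g :: "nat \<Rightarrow> nat \<Rightarrow> complex"
  assumes "\<And>i j. i + j \<ge> N \<Longrightarrow> g i j = 0"
  shows "(\<Sum>i<N. \<Sum>j<N. g i j) = (\<Sum>k<N. \<Sum>i\<le>k. g i (k - i))"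
proof -
  have "(\<Sum>i<N. \<Sum>j<N. g i j) = (\<Sum>(i, j)\<in>{..<N} \<times> {..<N}. g i j)"
    by (simp add: sum.cartesian_product)
  also have "\<dots> = (\<Sum>(i, j)\<in>{(i, j). i + j < N}. g i j)"
  proof (rule sum.mono_neutral_right)
    have "i + j < N" if "g i j \<noteq> 0" for i j
      using assms[of i j] that by (meson not_le)
    then show "\<forall>i\<in>{..<N} \<times> {..<N} - {(i, j). i + j < N}. (case i of (i, j) \<Rightarrow> g i j) = 0"
      by auto
  qed auto
  finally show ?thesis by (simp add: sum.triangle_reindex)
qed

lemma vir_part_eq_0: "m > 2 * k + 2 \<Longrightarrow> vir m (part k) = (\<lambda>_. 0)"
  using supp_vir(2)[OF supp_part, of m k] by (fastforce simp: fun_eq_iff)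

lemma ev_pd_part_eq_0: "d > 2 * k \<Longrightarrow> ev N T (pd d (part k)) = 0"
proof -
  assume "d > 2 * k"
  then have "pd d (part k) = (\<lambda>_. 0)"
    using supp_zero[OF supp_part] by (auto simp: fun_eq_iff pd_def)
  then show ?thesis by simp
qed

lemma ev_pd_pd_part_eq_0: "i + j > 2 * k \<Longrightarrow> ev N T (pd i (pd j (part k))) = 0"
proof -
  assume "i + j > 2 * k"
  then have "pd i (pd j (part k)) = (\<lambda>_. 0)"
    using supp_zero[OF supp_part] by (auto simp: fun_eq_iff pd_def)
  then show ?thesis by simp
qed

lemma ev_vir_part:
  assumes "N > 3 * k + 5"
  shows "ev N (times p \<tau>) (vir (Suc m) (part k)) =
     (\<Sum>i<m. ev N (times p \<tau>) (pd i (pd (m - 1 - i) (part k))))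
     + (\<Sum>d<N. - 2 * (p ^ (2 * d + 1) + \<tau>) * ev N (times p \<tau>) (pd (m + d) (part k)))
     + (if m = 0 then part_val k p \<tau> / 4 else 0)" (is ?A)
    and "ev N (times p \<tau>) (vir 0 (part k)) =
     (\<Sum>d<N. - 2 * (p ^ (2 * d + 3) + \<tau>) * ev N (times p \<tau>) (pd d (part k))) + (p + \<tau>) ^ 2 * part_val k p \<tau>" (is ?B)
proof -
  have eq: "ev N (times p \<tau>) (part k) = part_val k p \<tau>" using part_val_eq assms by simp
  have 1: "(\<Sum>i\<le>Suc m. ev N (times p \<tau>) (sh i (sh (Suc m - i) (part k))))
     = (\<Sum>i<m. ev N (times p \<tau>) (pd i (pd (m - 1 - i) (part k))))"
  proof -
    have "(\<lambda>M. part k (add_mset i (add_mset j M))) = pd i (pd j (part k))" for i j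
      by (simp add: fun_eq_iff pd_def add_mset_commute)
    then show ?thesis
      unfolding ev_sum[symmetric, OF finite_atMost] sum_sh_sh ev_sum[OF finite_lessThan] by simp
  qed
  show ?A
    using assms by (subst ev_vir[OF supp_part]) (simp_all only: 1 times_scale eq add_Suc sh_Suc, auto)
  \<comment> \<open>For \<open>vir 0\<close> the derivative is shifted down by one: the term d = 0
    drops out, and the term added at the upper end lies outside the support.\<close>
  have 2: "(\<Sum>d<N. - 2 * (p ^ (2 * d + 1) + \<tau>) * ev N (times p \<tau>) (sh (0 + d) (part k)))
     = (\<Sum>d<N. - 2 * (p ^ (2 * d + 3) + \<tau>) * ev N (times p \<tau>) (pd d (part k)))"
  proof -
    obtain n where n: "N = Suc n" "n > 2 * k" using assms by (cases N) auto
    have e: "2 * Suc d + 1 = 2 * d + 3" for d :: nat by simp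
    have "(\<Sum>d<Suc n. - 2 * (p ^ (2 * d + 1) + \<tau>) * ev N (times p \<tau>) (sh (0 + d) (part k)))
      = (\<Sum>d<n. - 2 * (p ^ (2 * d + 3) + \<tau>) * ev N (times p \<tau>) (pd d (part k)))"
      unfolding sum.lessThan_Suc_shift e by simp
    moreover have "ev N (times p \<tau>) (pd n (part k)) = 0" using n(2) by (simp add: ev_pd_part_eq_0)
    ultimately show ?thesis using n(1) by simp
  qed
  have "times p \<tau> 0 = - (p + \<tau>)" by (simp add: times_def)
  then have t0: "times p \<tau> 0 ^ 2 = (p + \<tau>) ^ 2" by (simp only: power2_minus)
  show ?B
    using assms by (subst ev_vir[OF supp_part]) (simp_all only: 2 times_scale eq t0, auto)
qed

text \<open>The derivative in p is minus the sum of p^(2a) \<open>pd a\<close>, which the recursion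
  turns into half the sum of p^(2a) (v (a+1) - v a) = (1 - p^2) P - v 0. The factor 1 - p^2 makes
  the geometric sums next to tau telescope. The sum \<open>S0\<close>, which is no derivative of
  \<open>f\<close> at p, cancels against \<open>v 0\<close>.\<close>

theorem part_val_ode:
  fixes p \<tau> :: complex and k :: nat
  defines "f \<equiv> \<lambda>p. part_val k p \<tau>"
  shows "((\<lambda>p. part_val (Suc k) p \<tau>) has_field_derivative
    - (1 / 2) * (p\<^sup>2 * (1 - p\<^sup>2) * deriv (deriv f) p + (2 * p - 4 * p ^ 3 - 2 * \<tau> * p\<^sup>2) * deriv f p
       + ((1 - p\<^sup>2) / 4 - (p + \<tau>)\<^sup>2) * f p)) (at p)"
proof -
  define N where "N = 3 * k + 10"
  have N: "N > 3 * k" "N > 3 * Suc k" "N > 3 * k + 5" "N > 2 * k + 2" by (auto simp: N_def)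
  define u where "u d = ev N (times p \<tau>) (pd d (part k))" for d
  define u2 where "u2 i j = ev N (times p \<tau>) (pd i (pd j (part k)))" for i j
  define v where "v m = ev N (times p \<tau>) (vir m (part k))" for m
  define S1 where "S1 = (\<Sum>d<N. p ^ (2 * d) * u d)"
  define S2 where "S2 = (\<Sum>i<N. \<Sum>j<N. p ^ (2 * i) * p ^ (2 * j) * u2 i j)"
  define S3 where "S3 = (\<Sum>d<N. of_nat d * p ^ (2 * d) * u d)"
  define S0 where "S0 = (\<Sum>d<N. u d)"
  define P where "P = (\<Sum>a<N. p ^ (2 * a) * v (Suc a))"
  have u0: "u d = 0" if "d > 2 * k" for d using that by (simp add: u_def ev_pd_part_eq_0)
  have u20: "u2 i j = 0" if "i + j > 2 * k" for i j using that by (simp add: u2_def ev_pd_pd_part_eq_0)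
  have d1: "deriv f = (\<lambda>p. - (\<Sum>d<N. p ^ (2 * d) * ev N (times p \<tau>) (pd d (part k))))"
    unfolding f_def by (intro ext DERIV_imp_deriv part_val_deriv N)
  have d2: "p\<^sup>2 * deriv (deriv f) p = p\<^sup>2 * S2 - 2 * p * S3"
  proof -
    have "deriv (deriv f) p = S2 - (\<Sum>d<N. of_nat (2 * d) * p ^ (2 * d - 1) * u d)"
      unfolding d1 by (intro DERIV_imp_deriv) (unfold S2_def u2_def u_def, intro part_val_deriv2 N)
    moreover have "p\<^sup>2 * (\<Sum>d<N. of_nat (2 * d) * p ^ (2 * d - 1) * u d) = 2 * p * S3"
      unfolding S3_def sum_distrib_left
    proof (rule sum.cong)
      fix d
      show "p\<^sup>2 * (of_nat (2 * d) * p ^ (2 * d - 1) * u d) = 2 * p * (of_nat d * p ^ (2 * d) * u d)"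
        by (cases d) (simp_all add: power2_eq_square)
    qed simp
    ultimately show ?thesis by (simp only: right_diff_distrib)
  qed
  have d1': "deriv f p = - S1" by (simp add: d1 S1_def u_def)
  have vN: "v N = 0" using N by (simp add: v_def vir_part_eq_0)
  have v0: "v 0 = - 2 * (p ^ 3 * S1 + \<tau> * S0) + (p + \<tau>)\<^sup>2 * f p"
    unfolding v_def ev_vir_part(2)[OF N(3)] u_def[symmetric] f_def S1_def S0_def
    by (simp add: sum_distrib_left sum.distrib[symmetric] power_add algebra_simps flip: sum_negf)
  \<comment> \<open>The quadratic part of \<open>vir\<close> is a convolution, so its generating sum
    factors into two insertions at p.\<close>
  have Pa: "(\<Sum>a<N. p ^ (2 * a) * (\<Sum>i<a. u2 i (a - 1 - i))) = p\<^sup>2 * S2"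
  proof -
    obtain n where n: "N = Suc n" using N by (cases N) auto
    have "S2 = (\<Sum>b<N. \<Sum>i\<le>b. p ^ (2 * i) * p ^ (2 * (b - i)) * u2 i (b - i))"
      unfolding S2_def by (rule box_to_triangle) (use u20 N in auto)
    also have "\<dots> = (\<Sum>b<N. p ^ (2 * b) * (\<Sum>i\<le>b. u2 i (b - i)))"
      unfolding sum_distrib_left by (intro sum.cong refl) (auto simp flip: power_add distrib_left)
    also have "\<dots> = (\<Sum>b<n. p ^ (2 * b) * (\<Sum>i\<le>b. u2 i (b - i)))"
      unfolding n using u20 N n by simp
    finally have S: "S2 = (\<Sum>b<n. p ^ (2 * b) * (\<Sum>i\<le>b. u2 i (b - i)))" .
    show ?thesis unfolding n S sum_distrib_left[of "p\<^sup>2"]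
      by (subst sum.lessThan_Suc_shift) (simp add: power_add power2_eq_square lessThan_Suc_atMost mult_ac)
  qed
  \<comment> \<open>Sorted by e = a + d, the power p^(2e+1) occurs e + 1 times, which gives
    \<open>S3\<close> + \<open>S1\<close>, while tau collects a geometric sum in p^2.\<close>
  have Pb: "(1 - p\<^sup>2) * (\<Sum>a<N. p ^ (2 * a) * (\<Sum>d<N. - 2 * (p ^ (2 * d + 1) + \<tau>) * u (a + d)))
     = - 2 * (1 - p\<^sup>2) * p * (S3 + S1) - 2 * \<tau> * (S0 - p\<^sup>2 * S1)"
  proof -
    have "(\<Sum>a<N. p ^ (2 * a) * (\<Sum>d<N. - 2 * (p ^ (2 * d + 1) + \<tau>) * u (a + d)))
       = (\<Sum>a<N. \<Sum>d<N. p ^ (2 * a) * (- 2 * (p ^ (2 * d + 1) + \<tau>) * u (a + d)))"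
      by (simp only: sum_distrib_left)
    also have "\<dots> = (\<Sum>e<N. \<Sum>a\<le>e. p ^ (2 * a) * (- 2 * (p ^ (2 * (e - a) + 1) + \<tau>) * u (a + (e - a))))"
      by (rule box_to_triangle) (use u0 N in auto)
    also have "\<dots> = (\<Sum>e<N. - 2 * u e * (of_nat (e + 1) * p ^ (2 * e + 1) + \<tau> * (\<Sum>a\<le>e. p ^ (2 * a))))"
    proof (rule sum.cong)
      fix e
      have "p ^ (2 * a) * (- 2 * (p ^ (2 * (e - a) + 1) + \<tau>) * u (a + (e - a)))
         = - 2 * u e * (p ^ (2 * e + 1) + \<tau> * p ^ (2 * a))" if "a \<le> e" for a
      proof -
        have "p ^ (2 * e + 1) = p ^ (2 * a) * p ^ (2 * (e - a) + 1)"
          using that by (simp flip: power_add) (simp add: algebra_simps)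
        moreover have "A * (- 2 * (Q + \<tau>) * U) = - 2 * U * (A * Q + \<tau> * A)" for A Q U :: complex
          by (simp add: algebra_simps)
        ultimately show ?thesis using that by (simp only: le_add_diff_inverse)
      qed
      then have "(\<Sum>a\<le>e. p ^ (2 * a) * (- 2 * (p ^ (2 * (e - a) + 1) + \<tau>) * u (a + (e - a))))
         = (\<Sum>a\<le>e. - 2 * u e * (p ^ (2 * e + 1) + \<tau> * p ^ (2 * a)))" by (intro sum.cong) auto
      also have "\<dots> = - 2 * u e * (\<Sum>a\<le>e. p ^ (2 * e + 1) + \<tau> * p ^ (2 * a))"
        by (simp only: sum_distrib_left)
      also have "(\<Sum>a\<le>e. p ^ (2 * e + 1) + \<tau> * p ^ (2 * a)) = of_nat (e + 1) * p ^ (2 * e + 1) + \<tau> * (\<Sum>a\<le>e. p ^ (2 * a))"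
        by (simp add: sum.distrib sum_distrib_left)
      finally show "(\<Sum>a\<le>e. p ^ (2 * a) * (- 2 * (p ^ (2 * (e - a) + 1) + \<tau>) * u (a + (e - a))))
         = - 2 * u e * (of_nat (e + 1) * p ^ (2 * e + 1) + \<tau> * (\<Sum>a\<le>e. p ^ (2 * a)))" .
    qed simp
    finally have "(1 - p\<^sup>2) * (\<Sum>a<N. p ^ (2 * a) * (\<Sum>d<N. - 2 * (p ^ (2 * d + 1) + \<tau>) * u (a + d)))
       = (\<Sum>e<N. (1 - p\<^sup>2) * (- 2 * u e * (of_nat (e + 1) * p ^ (2 * e + 1) + \<tau> * (\<Sum>a\<le>e. p ^ (2 * a)))))"
      by (simp only: sum_distrib_left)
    also have "\<dots> = (\<Sum>e<N. - 2 * (1 - p\<^sup>2) * p * (of_nat e * p ^ (2 * e) * u e + p ^ (2 * e) * u e)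
        - 2 * \<tau> * (u e - p\<^sup>2 * (p ^ (2 * e) * u e)))"
    proof (rule sum.cong)
      fix e
      have "(1 - p\<^sup>2) * (\<Sum>a\<le>e. p ^ (2 * a)) = 1 - p ^ (2 * e) * p\<^sup>2"
        using sum_gp_basic[of "p\<^sup>2" e] by (simp add: power_mult mult.commute[of "p\<^sup>2"])
      then have g: "(1 - p\<^sup>2) * (X * (Y + \<tau> * (\<Sum>a\<le>e. p ^ (2 * a))))
          = X * ((1 - p\<^sup>2) * Y) + X * \<tau> * (1 - p ^ (2 * e) * p\<^sup>2)" for X Y :: complex
        by (metis (no_types, lifting) distrib_left mult.assoc mult.left_commute)
      show "(1 - p\<^sup>2) * (- 2 * u e * (of_nat (e + 1) * p ^ (2 * e + 1) + \<tau> * (\<Sum>a\<le>e. p ^ (2 * a))))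
        = - 2 * (1 - p\<^sup>2) * p * (of_nat e * p ^ (2 * e) * u e + p ^ (2 * e) * u e) - 2 * \<tau> * (u e - p\<^sup>2 * (p ^ (2 * e)
            * u e))"
        unfolding g by (simp add: algebra_simps)
    qed simp
    also have "\<dots> = - 2 * (1 - p\<^sup>2) * p * (S3 + S1) - 2 * \<tau> * (S0 - p\<^sup>2 * S1)"
      unfolding S3_def S1_def S0_def
      by (simp only: sum_distrib_left sum.distrib[symmetric] sum_subtractf[symmetric])
    finally show ?thesis .
  qed
  have P: "(1 - p\<^sup>2) * P = (1 - p\<^sup>2) * (p\<^sup>2 * S2) - 2 * (1 - p\<^sup>2) * p * (S3 + S1) - 2 * \<tau> * (S0 - p\<^sup>2 * S1)
      + (1 - p\<^sup>2) * (f p / 4)"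
  proof -
    have "P = (\<Sum>a<N. p ^ (2 * a) * (\<Sum>i<a. u2 i (a - 1 - i)))
      + (\<Sum>a<N. p ^ (2 * a) * (\<Sum>d<N. - 2 * (p ^ (2 * d + 1) + \<tau>) * u (a + d)))
      + (\<Sum>a<N. if a = 0 then f p / 4 else 0)"
      unfolding P_def v_def ev_vir_part(1)[OF N(3)] u_def u2_def f_def sum.distrib[symmetric]
      by (rule sum.cong) (simp_all add: algebra_simps)
    also have "(\<Sum>a<N. if a = 0 then f p / 4 else 0) = f p / 4" using N by simp
    finally have PP: "P = p\<^sup>2 * S2 + (\<Sum>a<N. p ^ (2 * a) * (\<Sum>d<N. - 2 * (p ^ (2 * d + 1) + \<tau>) * u (a + d))) + f p / 4"
      unfolding Pa .
    show ?thesis unfolding PP distrib_left[of "1 - p\<^sup>2"] Pb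
      by (simp only: add_diff_eq diff_conv_add_uminus add.assoc mult_minus_left)
  qed
  have "((\<lambda>p. part_val (Suc k) p \<tau>) has_field_derivative
    - (\<Sum>a<N. p ^ (2 * a) * ev N (times p \<tau>) (pd a (part (Suc k))))) (at p)"
    by (rule part_val_deriv) (rule N)
  also have "(\<Sum>a<N. p ^ (2 * a) * ev N (times p \<tau>) (pd a (part (Suc k)))) = (\<Sum>a<N. 1 / 2 * (p ^ (2 * a) * (v (Suc a)
      - v a)))"
    unfolding pd_part ev_scale vir'_def[abs_def] ev_diff v_def by (simp add: algebra_simps)
  also have "\<dots> = 1 / 2 * (P - (\<Sum>a<N. p ^ (2 * a) * v a))"
    unfolding sum_distrib_left[symmetric] P_def sum_subtractf[symmetric] by (simp add: algebra_simps)
  \<comment> \<open>Shifting the index by one loses nothing at the upper end because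
    \<open>v N\<close> = 0.\<close>
  also have "(\<Sum>a<N. p ^ (2 * a) * v a) = v 0 + p\<^sup>2 * P"
  proof -
    obtain n where n: "N = Suc n" using N by (cases N) auto
    have "P = (\<Sum>a<n. p ^ (2 * a) * v (Suc a))" using vN unfolding P_def n by simp
    then show ?thesis unfolding n sum.lessThan_Suc_shift
      by (simp add: sum_distrib_left power_add power2_eq_square mult_ac)
  qed
  also have "- (1 / 2 * (P - (v 0 + p\<^sup>2 * P))) = - (1 / 2) * ((1 - p\<^sup>2) * P - v 0)"
    by (simp add: algebra_simps)
  also have "(1 - p\<^sup>2) * P - v 0 = (1 - p\<^sup>2) * (p\<^sup>2 * deriv (deriv f) p) + (2 * p - 4 * p ^ 3 - 2 * \<tau> * p\<^sup>2) * deriv f p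
       + ((1 - p\<^sup>2) / 4 - (p + \<tau>)\<^sup>2) * f p"
    unfolding P v0 d1' d2 by (simp add: algebra_simps power2_eq_square power3_eq_cube)
  finally show ?thesis by (simp add: mult_ac)
qed

section \<open>The dilaton equation\<close>

text \<open>For theta = 1 these are the coefficients of z^(2d+1) in the primitive of
  \<open>Y dX\<close>; the one for d = 0 is zero because \<open>Y dX\<close> starts with
  z^2.\<close>

definition dil_time :: "nat \<Rightarrow> complex" where
  "dil_time d = (if d = 0 then 0 else - 1 / of_nat (2 * d + 1))"

text \<open>For k = 2g - 1 and theta = 1 this is the residue that defines the free energy, before
  division by 2 - 2g. The range is finite by the weight bound of \<open>part\<close>.\<close>

definition dil_coeff :: "nat \<Rightarrow> complex" where
  "dil_coeff k = (\<Sum>d\<in>{1..2 * k}. - 1 / of_nat (2 * d + 1) * part k {#d#})"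

lemma dil_coeff_eq: "N > 2 * k \<Longrightarrow> dd N dil_time (part k) {#} = dil_coeff k"
  unfolding dd_def dil_coeff_def pd_def
  by (rule sum.mono_neutral_cong_right)
     (auto simp: dil_time_def intro!: supp_zero[OF supp_part])

lemma vir_dd: "vir m (dd N T f) M = (\<Sum>d<N. T d * vir m (pd d f) M)"
proof -
  have "vir m (\<lambda>M. \<Sum>d\<in>I. T d * pd d f M) M = (\<Sum>d\<in>I. T d * vir m (pd d f) M)" if "finite I" for I
    using that by (induction rule: finite_induct) (simp_all add: vir_add vir_scale)
  from this[of "{..<N}"] show ?thesis by (simp add: dd_def[abs_def])
qed

text \<open>The weights -1/(2d+1) cancel the factors 2d + 1 of the commutator, and the remaining sum
  over d telescopes to its lower end.\<close>

lemma dd_vir':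
  assumes "supp f s w" "w + 1 < N"
  shows "dd N dil_time (vir' a f) M = vir' a (dd N dil_time f) M + 2 * pd a f M"
proof -
  have z: "dil_time d * (2 * of_nat (2 * d + 1) * X) = (if d = 0 then 0 else - 2 * X)" for d X
  proof -
    have "of_nat (2 * d + 1) \<noteq> (0 :: complex)" by (metis Suc_eq_plus1 of_nat_neq_0)
    then show ?thesis by (simp add: dil_time_def del: of_nat_add of_nat_mult of_nat_Suc)
  qed
  have "dd N dil_time (vir' a f) M = (\<Sum>d<N. dil_time d * vir' a (pd d f) M
     + (if d = 0 then 0 else - 2 * (pd (a + d) f M - sh (a + d) f M)))"
    unfolding dd_def
  proof (rule sum.cong)
    fix d
    have "dil_time d * (if a = 0 \<and> d = 0 then 2 * x0 f M else 0) = 0" by (simp add: dil_time_def)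
    then show "dil_time d * pd d (vir' a f) M = dil_time d * vir' a (pd d f) M
       + (if d = 0 then 0 else - 2 * (pd (a + d) f M - sh (a + d) f M))"
      unfolding pd_vir' right_diff_distrib[of "dil_time d"] distrib_left[of "dil_time d"] z by simp
  qed simp
  also have "\<dots> = vir' a (dd N dil_time f) M + (\<Sum>d<N. if d = 0 then 0 else - 2 * (pd (a + d) f M - sh (a + d) f M))"
    by (simp add: sum.distrib vir'_def vir_dd right_diff_distrib sum_subtractf)
  also have "(\<Sum>d<N. if d = 0 then 0 else - 2 * (pd (a + d) f M - sh (a + d) f M)) = 2 * pd a f M"
  proof -
    obtain n where n: "N = Suc n" using assms by (cases N) auto
    have "(\<Sum>d<N. if d = 0 then 0 else - 2 * (pd (a + d) f M - sh (a + d) f M))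
       = (\<Sum>d<n. - 2 * (pd (a + Suc d) f M - pd (a + d) f M))"
      unfolding n sum.lessThan_Suc_shift by simp
    also have "\<dots> = - 2 * (pd (a + n) f M - pd (a + 0) f M)"
      unfolding sum_distrib_left[symmetric] by (rule arg_cong[where f = "(*) (- 2)"], rule sum_lessThan_telescope)
    also have "pd (a + n) f M = 0" unfolding pd_def
      using supp_zero[OF assms(1), of "add_mset (a + n) M"] assms n by auto
    finally show ?thesis by simp
  qed
  finally show ?thesis .
qed

text \<open>By induction on the order: moving the dilaton field past half of \<open>vir' a\<close>
  adds \<open>pd a (part k)\<close>, which raises the coefficient k - 1 to k. The values at the
  empty multiset act as integration constants and are the numbers \<open>dil_coeff\<close>.\<close>

theorem dilaton:
  assumes "N > 2 * k + 2"
  shows "dd N dil_time (part k) M = of_nat (k - 1) * part (k - 1) M + (\<Sum>j\<le>k. dil_coeff j * part (k - j) M)"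
  using assms
proof (induction k arbitrary: M)
  case 0
  then show ?case by (simp add: dd_def pd_def part.simps dil_coeff_def)
next
  case (Suc k)
  show ?case
  proof (cases M)
    case empty
    have "(\<Sum>j\<le>Suc k. dil_coeff j * part (Suc k - j) {#}) = (\<Sum>j\<le>Suc k. if j = Suc k then dil_coeff j else 0)"
      by (rule sum.cong) (auto simp: part_empty)
    then show ?thesis using dil_coeff_eq[of "Suc k" N] Suc.prems by (simp add: empty part_empty)
  next
    case (add a K)
    have IH: "dd N dil_time (part k) = (\<lambda>M. of_nat (k - 1) * part (k - 1) M + (\<Sum>j\<le>k. dil_coeff j * part (k - j) M))"
      using Suc by (simp add: fun_eq_iff)
    have vs: "vir' a (\<lambda>M. \<Sum>j\<in>I. c j * h j M) K = (\<Sum>j\<in>I. c j * vir' a (h j) K)" if "finite I" for I and c ::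
        "nat \<Rightarrow> complex" and h
      using that by (induction rule: finite_induct) (simp_all add: vir'_def vir_add vir_scale algebra_simps)
    have va: "vir' a (\<lambda>M. f M + g M) K = vir' a f K + vir' a g K" for f g
      by (simp add: vir'_def vir_add)
    have "dd N dil_time (part (Suc k)) M = dd N dil_time (pd a (part (Suc k))) K"
      by (simp add: add dd_pd) (simp add: pd_def)
    also have "\<dots> = 1 / 2 * dd N dil_time (vir' a (part k)) K"
      unfolding pd_part dd_scale ..
    also have "\<dots> = 1 / 2 * vir' a (dd N dil_time (part k)) K + pd a (part k) K"
      using dd_vir'[OF supp_part, of k N a K] Suc.prems by simp
    also have "\<dots> = of_nat (k - 1) * (vir' a (part (k - 1)) K / 2) + (\<Sum>j\<le>k. dil_coeff j * (vir' a (part (k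
        - j)) K / 2)) + pd a (part k) K"
      unfolding IH va vir'_scale vs[OF finite_atMost] by (simp add: sum_divide_distrib add_divide_distrib)
    also have "of_nat (k - 1) * (vir' a (part (k - 1)) K / 2) = of_nat (k - 1) * part k M"
      by (cases k) (simp_all add: add part_rec)
    also have "(\<Sum>j\<le>k. dil_coeff j * (vir' a (part (k - j)) K / 2)) = (\<Sum>j\<le>Suc k. dil_coeff j * part (Suc k - j) M)"
      by (simp add: add Suc_diff_le part_rec part.simps(1))
    also have "of_nat (k - 1) * part k M + (\<Sum>j\<le>Suc k. dil_coeff j * part (Suc k - j) M) + pd a (part k) K
       = of_nat k * part k M + (\<Sum>j\<le>Suc k. dil_coeff j * part (Suc k - j) M)"
    proof (cases k)
      case 0
      then show ?thesis by (simp add: pd_def part.simps)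
    next
      case (Suc n)
      then show ?thesis by (simp add: add pd_def algebra_simps)
    qed
    finally show ?thesis by simp
  qed
qed

text \<open>The direction of tau is \<open>dil_time\<close> minus the unit vector at d = 0. The
  constraint replaces \<open>pd 0\<close> by half of \<open>vir' 0\<close>; at p = 0 the
  first-derivative sums of \<open>vir 1\<close> and \<open>vir 0\<close> coincide and cancel,
  leaving the factor 1/4 - tau^2.\<close>

theorem part_val_tau:
  "((\<lambda>\<tau>. part_val (Suc k) 0 \<tau>) has_field_derivative
     of_nat k * part_val k 0 \<tau> + (\<Sum>j\<le>Suc k. dil_coeff j * part_val (Suc k - j) 0 \<tau>) + (\<tau>\<^sup>2 / 2 - 1 / 8)
         * part_val k 0 \<tau>) (at \<tau>)"
proof -
  define N where "N = 3 * k + 10"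
  have N: "N > 3 * k" "N > 3 * Suc k" "N > 3 * k + 5" "N > 2 * Suc k + 2" by (auto simp: N_def)
  define T' :: "nat \<Rightarrow> complex" where "T' d = - 1 / of_nat (2 * d + 1)" for d
  have t: "times 0 \<tau> d = \<tau> * T' d" for \<tau> d by (simp add: times_def T'_def)
  have F: "((\<lambda>\<tau>. ev N (times 0 \<tau>) (part (Suc k))) has_field_derivative ev N (times 0 \<tau>) (dd N T' (part (Suc k))))
      (at \<tau>)"
    by (rule has_field_derivative_ev[OF _ supp_part]) (use N in \<open>auto simp: t intro!: derivative_eq_intros\<close>)
  have D: "dd N T' (part (Suc k)) = (\<lambda>M. ((of_nat k * part k M + (\<Sum>j\<le>Suc k. dil_coeff j * part (Suc k - j) M)))
     - 1 / 2 * vir' 0 (part k) M)"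
  proof
    fix M
    have "dd N T' (part (Suc k)) M = (\<Sum>d<N. dil_time d * pd d (part (Suc k)) M + (if d = 0 then
        - pd d (part (Suc k)) M else 0))"
      unfolding dd_def by (rule sum.cong) (auto simp: T'_def dil_time_def)
    also have "\<dots> = dd N dil_time (part (Suc k)) M - pd 0 (part (Suc k)) M"
      using N by (simp add: dd_def sum.distrib)
    finally show "dd N T' (part (Suc k)) M = ((of_nat k * part k M + (\<Sum>j\<le>Suc k. dil_coeff j * part (Suc k - j) M)))
     - 1 / 2 * vir' 0 (part k) M" unfolding dilaton[OF N(4)] pd_part by simp
  qed
  have V: "ev N (times 0 \<tau>) (vir' 0 (part k)) = (1 / 4 - \<tau>\<^sup>2) * part_val k 0 \<tau>"
    unfolding vir'_def[abs_def] ev_diff ev_vir_part[OF N(3)] by (simp add: algebra_simps power_0_left)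
  have E: "ev N (times 0 \<tau>) (part (Suc k - j)) = part_val (Suc k - j) 0 \<tau>" for j
    by (rule part_val_eq) (use N in auto)
  have "ev N (times 0 \<tau>) (dd N T' (part (Suc k))) = (of_nat k * part_val k 0 \<tau> + (\<Sum>j\<le>Suc k. dil_coeff j
      * part_val (Suc k - j) 0 \<tau>))
      - 1 / 2 * ((1 / 4 - \<tau>\<^sup>2) * part_val k 0 \<tau>)"
    unfolding D ev_diff ev_add ev_scale ev_sum[OF finite_atMost] V E part_val_eq[OF N(1)] ..
  with F show ?thesis unfolding part_val_eq[OF N(2)]
    by (simp add: algebra_simps del: sum.atMost_Suc)
qed

subsection \<open>Contiguity and Bernoulli numbers\<close>

text \<open>Differentiation in the parameter is taken coefficient by coefficient, so no convergence
  in hbar is involved.\<close>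

definition fder :: "(complex \<Rightarrow> complex fps) \<Rightarrow> complex fps \<Rightarrow> complex \<Rightarrow> bool" where
  "fder F G x \<longleftrightarrow> (\<forall>k. ((\<lambda>p. fps_nth (F p) k) has_field_derivative fps_nth G k) (at x))"

lemma fder_add: "fder F F' x \<Longrightarrow> fder G G' x \<Longrightarrow> fder (\<lambda>p. F p + G p) (F' + G') x"
  by (auto simp: fder_def intro!: DERIV_add)

lemma fder_diff: "fder F F' x \<Longrightarrow> fder G G' x \<Longrightarrow> fder (\<lambda>p. F p - G p) (F' - G') x"
  by (auto simp: fder_def intro!: DERIV_diff)

lemma fder_const: "fder (\<lambda>p. C) 0 x"
  by (simp add: fder_def)

lemma fder_var: "fder fps_const 1 x"
  by (auto simp: fder_def)

lemma fder_mult: 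
  assumes "fder F F' x" "fder G G' x"
  shows "fder (\<lambda>p. F p * G p) (F' * G x + F x * G') x"
  unfolding fder_def fps_mult_nth fps_add_nth sum.distrib[symmetric]
proof
  fix k
  have "((\<lambda>p. \<Sum>i=0..k. fps_nth (F p) i * fps_nth (G p) (k - i)) has_field_derivative
    (\<Sum>i=0..k. fps_nth F' i * fps_nth (G x) (k - i) + fps_nth G' (k - i) * fps_nth (F x) i)) (at x)"
    by (intro DERIV_sum DERIV_mult) (use assms in \<open>auto simp: fder_def\<close>)
  then show "((\<lambda>p. \<Sum>i=0..k. fps_nth (F p) i * fps_nth (G p) (k - i)) has_field_derivative
    (\<Sum>i=0..k. fps_nth F' i * fps_nth (G x) (k - i) + fps_nth (F x) i * fps_nth G' (k - i))) (at x)"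
    by (simp add: mult.commute)
qed

lemma fder_cmult: "fder F F' x \<Longrightarrow> fder (\<lambda>p. C * F p) (C * F') x"
  using fder_mult[OF fder_const[of C x]] by simp

lemma fder_fps_deriv: "fder F F' x \<Longrightarrow> fder (\<lambda>p. fps_deriv (F p)) (fps_deriv F') x"
  by (auto simp: fder_def intro!: DERIV_cmult)

lemma fder_cong: "fder F F' x \<Longrightarrow> F' = G' \<Longrightarrow> fder F G' x"
  by simp

lemma fder_unique: "fder F G x \<Longrightarrow> fder F H x \<Longrightarrow> G = H"
  by (auto simp: fder_def fps_eq_iff intro: DERIV_unique)


text \<open>Uniqueness for linear equations graded by hbar: once the lower orders vanish, order k
  has zero derivative everywhere, hence is constant, and it vanishes at 0.\<close>

lemma fder_zero:
  assumes F: "\<And>p. fder F (F' p) p" and F0: "F 0 = 0"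
    and step: "\<And>k p. (\<And>j q. j < k \<Longrightarrow> fps_nth (F q) j = 0) \<Longrightarrow> fps_nth (F' p) k = 0"
  shows "F p = 0"
proof -
  have "\<forall>p. fps_nth (F p) k = 0" for k
  proof (induction k rule: less_induct)
    case (less k)
    have "((\<lambda>p. fps_nth (F p) k) has_field_derivative 0) (at p within UNIV)" for p
      using F[of p] step[of k p] less unfolding fder_def by metis
    then obtain c where "\<And>p. p \<in> UNIV \<Longrightarrow> fps_nth (F p) k = c"
      using has_field_derivative_zero_constant[of UNIV "\<lambda>p. fps_nth (F p) k"] by auto
    then show ?case using F0 by (metis UNIV_I fps_zero_nth)
  qed
  then show ?thesis by (simp add: fps_eq_iff)
qed

definition part_fps :: "complex \<Rightarrow> complex \<Rightarrow> complex fps" where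
  "part_fps \<tau> p = Abs_fps (\<lambda>k. part_val k p \<tau>)"

definition part_fps_der :: "nat \<Rightarrow> complex \<Rightarrow> complex \<Rightarrow> complex fps" where
  "part_fps_der n \<tau> p = Abs_fps (\<lambda>k. (deriv ^^ n) (\<lambda>p. part_val k p \<tau>) p)"

lemma part_fps_der_0: "part_fps_der 0 = part_fps"
  by (simp add: fun_eq_iff part_fps_der_def part_fps_def)

lemma fder_part_fps_der: "fder (part_fps_der n \<tau>) (part_fps_der (Suc n) \<tau> p) p"
proof -
  have h: "(\<lambda>p. part_val k p \<tau>) holomorphic_on UNIV" for k
    unfolding holomorphic_on_def
    using part_val_deriv[of k "Suc (3 * k)" \<tau>] field_differentiable_def by blast
  have "(deriv ^^ n) (\<lambda>p. part_val k p \<tau>) holomorphic_on UNIV" for k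
    by (induction n) (auto intro!: holomorphic_deriv h)
  then show ?thesis
    by (auto simp: fder_def part_fps_der_def intro!: holomorphic_derivI[of _ UNIV])
qed

lemma part_fps_der_Suc0_zero: "fps_nth (part_fps_der (Suc 0) \<tau> p) 0 = 0"
  by (simp add: part_fps_der_def part_val_0)

lemma part_fps_ode:
  fixes \<tau> p :: complex
  defines "c \<equiv> fps_const p" and "t \<equiv> fps_const \<tau>"
  shows "8 * part_fps_der 1 \<tau> p + fps_X * (4 * c\<^sup>2 * (1 - c\<^sup>2) * part_fps_der 2 \<tau> p
      + 4 * (2 * c - 4 * c ^ 3 - 2 * t * c\<^sup>2) * part_fps_der 1 \<tau> p + ((1 - c\<^sup>2) - 4 * (c + t)\<^sup>2) * part_fps_der 0 \<tau> p)
          = 0"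
proof (rule fps_ext)
  fix k
  have n: "numeral w = fps_const (numeral w :: complex)" for w
    by (rule numeral_fps_const)
  have a: "4 * c\<^sup>2 * (1 - c\<^sup>2) = fps_const (4 * p\<^sup>2 * (1 - p\<^sup>2))"
    "4 * (2 * c - 4 * c ^ 3 - 2 * t * c\<^sup>2) = fps_const (4 * (2 * p - 4 * p ^ 3 - 2 * \<tau> * p\<^sup>2))"
    "(1 - c\<^sup>2) - 4 * (c + t)\<^sup>2 = fps_const ((1 - p\<^sup>2) - 4 * (p + \<tau>)\<^sup>2)"
    "8 = fps_const (8 :: complex)"
    unfolding c_def t_def by (simp_all add: n fps_const_power flip: fps_const_1_eq_1)
  show "fps_nth (8 * part_fps_der 1 \<tau> p + fps_X * (4 * c\<^sup>2 * (1 - c\<^sup>2) * part_fps_der 2 \<tau> p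
      + 4 * (2 * c - 4 * c ^ 3 - 2 * t * c\<^sup>2) * part_fps_der 1 \<tau> p + ((1 - c\<^sup>2) - 4 * (c + t)\<^sup>2)
          * part_fps_der 0 \<tau> p)) k = fps_nth 0 k"
  proof (cases k)
    case 0
    then show ?thesis unfolding a by (simp add: part_fps_der_Suc0_zero)
  next
    case (Suc j)
    have "fps_nth (part_fps_der 1 \<tau> p) (Suc j) = - (1 / 2) * (p\<^sup>2 * (1 - p\<^sup>2) * fps_nth (part_fps_der 2 \<tau> p) j
      + (2 * p - 4 * p ^ 3 - 2 * \<tau> * p\<^sup>2) * fps_nth (part_fps_der 1 \<tau> p) j
       + ((1 - p\<^sup>2) / 4 - (p + \<tau>)\<^sup>2) * fps_nth (part_fps_der 0 \<tau> p) j)"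
      using DERIV_imp_deriv[OF part_val_ode[of j \<tau> p]] by (simp add: part_fps_der_def numeral_2_eq_2)
    then show ?thesis unfolding a Suc by (simp add: field_simps)
  qed
qed

text \<open>
  Both sides satisfy the differential equation \<open>part_fps_ode\<close> for \<open>\<tau> = 1\<close> and agree at \<open>p = 0\<close>. For the right-hand
  side this is a combination of the equation for \<open>\<tau> = 0\<close> and its derivative.
\<close>

lemma contiguity:
  "2 * part_fps 1 p = part_fps 1 0 * (2 * part_fps 0 p + fps_X * (fps_const p + (fps_const p)\<^sup>2) * part_fps 0 p
     + 2 * fps_X * ((fps_const p)\<^sup>2 + fps_const p ^ 3) * part_fps_der 1 0 p)"
proof -
  let ?h = "fps_X :: complex fps"
  define c where "c = (fps_const :: complex \<Rightarrow> complex fps)"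
  have fder_c: "fder c 1 x" for x unfolding c_def by (rule fder_var)
  define U where "U n p = part_fps_der n 0 p" for n p
  define T where "T n p = part_fps_der n 1 p" for n p
  \<comment> \<open>With hbar = 1 / nu, \<open>U 0\<close> is the sum of (-1)^k u_k(p) hbar^k with
    Debye polynomials u_k. If V denotes the analogous series for the derivative of K_nu, then (1 -
    p) W / 2 = V - p U; this is K_(nu-1)(x) = - K_nu'(x) - (nu / x) K_nu(x) without elementary
    factors.\<close>
  define W where "W p = 2 * U 0 p + ?h * (c p + c p * c p) * U 0 p
     + 2 * ?h * (c p * c p + c p * c p * c p) * U 1 p" for p
  define W1 where "W1 p = 2 * U 1 p + ?h * (1 + 2 * c p) * U 0 p + ?h * (c p + c p * c p) * U 1 p
     + 2 * ?h * (2 * c p + 3 * c p * c p) * U 1 p + 2 * ?h * (c p * c p + c p * c p * c p) * U 2 p" for p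
  define W2 where "W2 p = 2 * U 2 p + ?h * 2 * U 0 p + 2 * (?h * (1 + 2 * c p) * U 1 p) + ?h * (c p + c p * c p) * U 2 p
     + 2 * ?h * (2 + 6 * c p) * U 1 p + 4 * ?h * (2 * c p + 3 * c p * c p) * U 2 p
     + 2 * ?h * (c p * c p + c p * c p * c p) * U 3 p" for p
  have dU: "fder (U 0) (U 1 p) p" "fder (U 1) (U 2 p) p" "fder (U 2) (U 3 p) p" for p
    unfolding U_def using fder_part_fps_der[of 0 0 p] fder_part_fps_der[of 1 0 p] fder_part_fps_der[of 2 0 p]
    by (simp_all add: numeral_2_eq_2 numeral_3_eq_3)
  have dT: "fder (T 0) (T 1 p) p" "fder (T 1) (T 2 p) p" for p
    unfolding T_def using fder_part_fps_der[of 0 1 p] fder_part_fps_der[of 1 1 p]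
    by (simp_all add: numeral_2_eq_2)
  note fd = fder_add fder_diff fder_mult fder_const fder_c dU dT
  have dW: "fder W (W1 p) p" for p
    unfolding W_def by (rule fder_cong, (rule fd)+) (simp add: W1_def algebra_simps)
  have dW1: "fder W1 (W2 p) p" for p
    unfolding W1_def by (rule fder_cong, (rule fd)+) (simp add: W2_def algebra_simps)
  define O1 where "O1 p = 8 * U 1 p + ?h * (4 * (c p * c p) * (1 - c p * c p) * U 2 p
      + 4 * (2 * c p - 4 * (c p * c p * c p)) * U 1 p + ((1 - c p * c p) - 4 * (c p * c p)) * U 0 p)" for p
  define O2 where "O2 p = 8 * U 2 p + ?h * (4 * (c p * c p) * (1 - c p * c p) * U 3 p
      + 4 * (2 * c p - 4 * (c p * c p * c p)) * U 2 p
      + 4 * (2 * c p - 4 * (c p * c p * c p)) * U 2 p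
      + 4 * (2 - 12 * (c p * c p)) * U 1 p + ((1 - c p * c p) - 4 * (c p * c p)) * U 1 p - 10 * c p * U 0 p)" for p
  have O1: "O1 p = 0" for p
    using part_fps_ode[of 0 p] by (simp add: O1_def U_def c_def power2_eq_square power3_eq_cube)
  have "fder O1 (O2 p) p" for p
    unfolding O1_def by (rule fder_cong, (rule fd)+) (simp add: O2_def algebra_simps)
  moreover have "O1 = (\<lambda>p. 0)" using O1 by auto
  ultimately have O2: "O2 p = 0" for p
    using fder_unique[of O1 "O2 p" p 0] fder_const[of 0 p] by simp
  define L where "L p y2 y1 y0 = 8 * y1 + ?h * (4 * (c p * c p) * (1 - c p * c p) * y2
      + 4 * (2 * c p - 4 * (c p * c p * c p) - 2 * (c p * c p)) * y1 + ((1 - c p * c p) - 4 * ((c p + 1) * (c p + 1)))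
          * y0)" for p y2 y1 y0
  have LT: "L p (T 2 p) (T 1 p) (T 0 p) = 0" for p
    using part_fps_ode[of 1 p] by (simp add: L_def T_def c_def power2_eq_square power3_eq_cube)
  have LW: "L p (W2 p) (W1 p) (W p) = 0" for p
  proof -
    \<comment> \<open>Comparing the coefficients of \<open>U 3\<close> determines the multiplier of
      \<open>O2\<close>, and then those of \<open>U 2\<close> the multiplier of \<open>O1\<close>;
      the remaining coefficients agree.\<close>
    have "L p (W2 p) (W1 p) (W p)
      = (2 + ?h * (c p + c p * c p) + 4 * ?h * (2 * c p + 3 * (c p * c p)) - 4 * ?h * (c p * (1 + 2 * c p))) * O1 p
        + 2 * ?h * (c p * c p + c p * c p * c p) * O2 p"
      unfolding L_def W_def W1_def W2_def O1_def O2_def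
      by (simp add: algebra_simps)
    then show ?thesis by (simp add: O1 O2)
  qed
  define Z where "Z = T 0 0"
  define D where "D p = 2 * T 0 p - Z * W p" for p
  define D1 where "D1 p = 2 * T 1 p - Z * W1 p" for p
  define D2 where "D2 p = 2 * T 2 p - Z * W2 p" for p
  have dD: "fder D (D1 p) p" for p
    unfolding D_def D1_def by (intro fder_diff fder_cmult dT dW)
  have dD1: "fder D1 (D2 p) p" for p
    unfolding D1_def D2_def by (intro fder_diff fder_cmult dT dW1)
  have "L p (D2 p) (D1 p) (D p) = 2 * L p (T 2 p) (T 1 p) (T 0 p) - Z * L p (W2 p) (W1 p) (W p)" for p
    unfolding L_def D_def D1_def D2_def by (simp add: algebra_simps)
  then have LD: "L p (D2 p) (D1 p) (D p) = 0" for p by (simp only: LT LW mult_zero_right diff_self)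
  have "D p = 0"
  proof (rule fder_zero[of D D1])
    show "fder D (D1 p) p" for p by (rule dD)
    have "U 0 0 = 1" "W 0 = 2 * U 0 0" by (auto simp: U_def W_def c_def part_fps_der_0 part_fps_def part_val_zero
        fps_eq_iff)
    then show "D 0 = 0" by (simp add: D_def Z_def)
    show "fps_nth (D1 p) k = 0" if k: "\<And>j q. j < k \<Longrightarrow> fps_nth (D q) j = 0" for k p
    proof -
      have 1: "fps_nth (D1 q) j = 0" if "j < k" for j q
      proof -
        have "((\<lambda>p. fps_nth (D p) j) has_field_derivative fps_nth (D1 q) j) (at q)"
          using dD[of q] by (simp add: fder_def)
        moreover have "(\<lambda>p. fps_nth (D p) j) = (\<lambda>p. 0)" using k that by auto
        ultimately show ?thesis using DERIV_unique[of "\<lambda>p. 0" "fps_nth (D1 q) j" q 0] by simp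
      qed
      have 2: "fps_nth (D2 q) j = 0" if "j < k" for j q
      proof -
        have "((\<lambda>p. fps_nth (D1 p) j) has_field_derivative fps_nth (D2 q) j) (at q)"
          using dD1[of q] by (simp add: fder_def)
        moreover have "(\<lambda>p. fps_nth (D1 p) j) = (\<lambda>p. 0)" using 1 that by auto
        ultimately show ?thesis using DERIV_unique[of "\<lambda>p. 0" "fps_nth (D2 q) j" q 0] by simp
      qed
      have m: "fps_nth (A * B) j = 0" if "j < k" "\<And>i. i < k \<Longrightarrow> fps_nth B i = 0" for A B :: "complex fps" and j
        using that by (auto simp: fps_mult_nth intro!: sum.neutral)
      have "fps_nth (8 * D1 p) k = 0"
      proof -
        \<comment> \<open>All terms other than 8 \<open>D1\<close> carry a factor hbar, so order k
          of \<open>D1\<close> is expressed through lower orders of \<open>D\<close>,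
          \<open>D1\<close> and \<open>D2\<close>.\<close>
        have "8 * D1 p = - (?h * (4 * (c p * c p) * (1 - c p * c p) * D2 p
            + 4 * (2 * c p - 4 * (c p * c p * c p) - 2 * (c p * c p)) * D1 p + ((1 - c p * c p) - 4 * ((c p + 1)
                * (c p + 1))) * D p))"
          using LD[of p] unfolding L_def by (simp only: eq_neg_iff_add_eq_0)
        then show ?thesis
          by (cases k) (simp_all add: m 1 2 k del: distrib_left distrib_right)
      qed
      then show ?thesis by (simp add: numeral_fps_const)
    qed
  qed
  then show ?thesis
    by (simp add: D_def Z_def W_def T_def U_def c_def part_fps_der_0 power2_eq_square power3_eq_cube mult.assoc)
qed

lemma fps_X2_mult_nth: "fps_nth (fps_X\<^sup>2 * f) (Suc (Suc n)) = fps_nth f n"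
  by (simp add: fps_X_power_mult_nth)

definition part_tau :: "complex \<Rightarrow> complex fps" where "part_tau \<tau> = part_fps \<tau> 0"

text \<open>At p = 1 the leading coefficient p^2 (1 - p^2) of the equation vanishes, so the equation
  itself gives the first derivative V in terms of the value; inserting it into
  \<open>contiguity\<close> leaves only values.\<close>

lemma part_tau_2: "(1 - fps_X) * part_tau 2 = part_tau 1 * part_tau 1"
proof -
  have T: "part_fps \<tau> 1 = part_tau (\<tau> + 1)" for \<tau> by (simp add: part_fps_def part_tau_def part_val_one)
  define V where "V = part_fps_der 1 0 1"
  have a: "2 * part_tau 2 = part_tau 1 * (2 * part_tau 1 + 2 * fps_X * part_tau 1 + 4 * fps_X * V)"
    using contiguity[of 1] T[of 1] T[of 0] by (simp add: V_def part_tau_def algebra_simps)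
  have "8 * V + fps_X * (- 8 * V - 4 * part_tau 1) = 0"
    using part_fps_ode[of 0 1] T[of 0] by (simp add: V_def part_fps_der_0 algebra_simps)
  then have "4 * (2 * (1 - fps_X) * V) = 4 * (fps_X * part_tau 1)" by (simp add: algebra_simps)
  then have b: "2 * (1 - fps_X) * V = fps_X * part_tau 1" by (simp only: mult_cancel_left) simp
  have "2 * ((1 - fps_X) * part_tau 2) = (1 - fps_X) * (2 * part_tau 2)" by simp
  also have "\<dots> = part_tau 1 * (2 * (1 - fps_X * fps_X) * part_tau 1 + 2 * fps_X * (2 * (1 - fps_X) * V))"
    unfolding a by (simp add: algebra_simps)
  also have "\<dots> = 2 * (part_tau 1 * part_tau 1)"
    unfolding b by (simp add: algebra_simps)
  finally show ?thesis by (simp only: mult_cancel_left) simp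
qed

text \<open>The subtraction absorbs the constant -1/8 of \<open>part_val_tau\<close> and changes
  only the coefficient of hbar.\<close>

definition dil_fps :: "complex fps" where
  "dil_fps = Abs_fps dil_coeff - fps_const (1 / 8) * fps_X"

lemma dil_coeff_0: "dil_coeff 0 = 0"
  by (simp add: dil_coeff_def)

lemma part_tau_pde: "fder part_tau ((dil_fps + fps_const (\<tau>\<^sup>2 / 2) * fps_X) * part_tau \<tau> + fps_X\<^sup>2
    * fps_deriv (part_tau \<tau>)) \<tau>"
  unfolding fder_def
proof
  fix k
  show "((\<lambda>p. fps_nth (part_tau p) k) has_field_derivative
     fps_nth ((dil_fps + fps_const (\<tau>\<^sup>2 / 2) * fps_X) * part_tau \<tau> + fps_X\<^sup>2 * fps_deriv (part_tau \<tau>)) k) (at \<tau>)"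
  proof (cases k)
    case 0
    then show ?thesis by (simp add: part_tau_def part_fps_def part_val_0 dil_fps_def dil_coeff_0)
  next
    case (Suc j)
    have 1: "fps_nth (fps_X\<^sup>2 * fps_deriv (part_tau \<tau>)) (Suc j) = of_nat j * part_val j 0 \<tau>"
      by (cases j) (simp_all add: part_tau_def part_fps_def fps_X_power_mult_nth)
    have 2: "fps_nth (Abs_fps dil_coeff * part_tau \<tau>) (Suc j) = (\<Sum>i\<le>Suc j. dil_coeff i * part_val (Suc j - i) 0 \<tau>)"
      by (simp add: fps_mult_nth part_tau_def part_fps_def atMost_atLeast0 del: sum.atMost_Suc sum.atLeast0_atMost_Suc)
    have e: "(dil_fps + fps_const (\<tau>\<^sup>2 / 2) * fps_X) * part_tau \<tau> + fps_X\<^sup>2 * fps_deriv (part_tau \<tau>)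
       = fps_X\<^sup>2 * fps_deriv (part_tau \<tau>) + Abs_fps dil_coeff * part_tau \<tau> + fps_const (\<tau>\<^sup>2 / 2 - 1 / 8) * (fps_X
           * part_tau \<tau>)"
      by (simp add: dil_fps_def algebra_simps flip: fps_const_sub)
    have "fps_nth ((dil_fps + fps_const (\<tau>\<^sup>2 / 2) * fps_X) * part_tau \<tau> + fps_X\<^sup>2 * fps_deriv (part_tau \<tau>)) (Suc j)
      = of_nat j * part_val j 0 \<tau> + (\<Sum>i\<le>Suc j. dil_coeff i * part_val (Suc j - i) 0 \<tau>) + (\<tau>\<^sup>2 / 2 - 1 / 8)
          * part_val j 0 \<tau>"
      unfolding e fps_add_nth 1 2 by (simp add: part_tau_def part_fps_def)
    then show ?thesis using part_val_tau[of j \<tau>] unfolding Suc by (simp add: part_tau_def part_fps_def)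
  qed
qed

section \<open>Borel transform and Bernoulli numbers\<close>

text \<open>Under this transform hbar^2 d/dhbar becomes multiplication by the variable u, so the
  equation in tau can be solved by exponentials.\<close>

definition dil_borel :: "complex fps" where
  "dil_borel = Abs_fps (\<lambda>k. fps_nth dil_fps (Suc k) / fact k)"

text \<open>
  The explicit solution of the equation for the logarithmic derivative of \<open>part_tau \<tau>\<close>, written with the Borel
  transform \<open>dil_borel\<close> of \<open>dil_fps\<close>.
\<close>

definition part_tau_log :: "complex \<Rightarrow> complex fps" where
  "part_tau_log \<tau> = Abs_fps (\<lambda>k. fact (Suc k) * (fps_nth (dil_borel * (fps_exp \<tau> - 1)) (Suc k) + \<tau> ^ (k + 3) / fact (k
      + 3)))"

lemma fder_exp: "fder fps_exp (fps_X * fps_exp \<tau>) \<tau>"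
  unfolding fder_def
proof
  fix k
  show "((\<lambda>p. fps_nth (fps_exp p) k) has_field_derivative fps_nth (fps_X * fps_exp \<tau>) k) (at \<tau>)"
  proof (cases k)
    case (Suc j)
    have "((\<lambda>p::complex. p ^ Suc j / fact (Suc j)) has_field_derivative of_nat (Suc j) * \<tau> ^ j / fact (Suc j)) (at \<tau>)"
      using DERIV_cdivide[OF DERIV_power[OF DERIV_ident, of "Suc j" \<tau> UNIV], of "fact (Suc j)"] by simp
    moreover have "of_nat (Suc j) * \<tau> ^ j / fact (Suc j) = \<tau> ^ j / fact j"
      by (simp add: field_simps del: of_nat_Suc)
    ultimately show ?thesis by (simp add: Suc del: fact_Suc)
  qed simp
qed

text \<open>For the Borel transform b of log Z(tau) the equation reads db/dtau = H + tau^2 / 2 + u b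
  with H = \<open>dil_borel\<close>. The solution vanishing at tau = 0 is H (exp(tau u) - 1) / u
  plus the sum of tau^(k+3) u^k / (k+3)!. The factor \<open>fact (Suc k)\<close> undoes the
  transform and differentiates in hbar.\<close>

lemma part_tau_log_pde: "fder part_tau_log (fps_deriv (dil_fps + fps_const (\<tau>\<^sup>2 / 2) * fps_X + fps_X\<^sup>2
    * part_tau_log \<tau>)) \<tau>"
  unfolding fder_def
proof
  fix k
  have "fder (\<lambda>\<tau>. dil_borel * (fps_exp \<tau> - 1)) (dil_borel * (fps_X * fps_exp \<tau> - 0)) \<tau>"
    by (intro fder_cmult fder_diff fder_exp fder_const)
  then have d1: "((\<lambda>\<tau>. fps_nth (dil_borel * (fps_exp \<tau> - 1)) (Suc k)) has_field_derivative fps_nth (dil_borel * (fps_X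
      * fps_exp \<tau> - 0)) (Suc k)) (at \<tau>)"
    unfolding fder_def by blast
  have c1: "fps_nth (dil_borel * (fps_X * fps_exp \<tau> - 0)) (Suc k) = fps_nth (dil_borel * (fps_exp \<tau> - 1)) k
      + fps_nth dil_borel k"
    by (simp add: mult.left_commute[of dil_borel] algebra_simps)
  have d2: "((\<lambda>\<tau>::complex. \<tau> ^ (k + 3) / fact (k + 3)) has_field_derivative \<tau> ^ (k + 2) / fact (k + 2)) (at \<tau>)"
  proof -
    have e: "k + 3 = Suc (k + 2)" by simp
    have E: "fps_nth (fps_X * fps_exp \<tau>) (k + 3) = \<tau> ^ (k + 2) / fact (k + 2)"
      unfolding e by (simp del: fact_Suc power_Suc)
    show ?thesis using spec[OF fder_exp[of \<tau>, unfolded fder_def], of "k + 3"]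
      unfolding E fps_exp_nth of_nat_fact .
  qed
  have "((\<lambda>\<tau>. fps_nth (part_tau_log \<tau>) k) has_field_derivative
     fact (Suc k) * (fps_nth (dil_borel * (fps_exp \<tau> - 1)) k + fps_nth dil_borel k + \<tau> ^ (k + 2) / fact (k
         + 2))) (at \<tau>)"
    unfolding part_tau_log_def fps_nth_Abs_fps
    by (intro DERIV_cmult DERIV_add d1[unfolded c1] d2)
  moreover have "fact (Suc k) * (fps_nth (dil_borel * (fps_exp \<tau> - 1)) k + fps_nth dil_borel k + \<tau> ^ (k + 2) / fact (k
      + 2))
     = fps_nth (fps_deriv (dil_fps + fps_const (\<tau>\<^sup>2 / 2) * fps_X + fps_X\<^sup>2 * part_tau_log \<tau>)) k"
  proof (cases k)
    case 0
    then show ?thesis unfolding fps_deriv_nth fps_add_nth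
      by (simp add: dil_borel_def fps_X_power_mult_nth power2_eq_square)
  next
    case (Suc j)
    have f: "fact (Suc k) = (of_nat (Suc k) * fact k :: complex)" by simp
    have X: "fps_nth (fps_X\<^sup>2 * part_tau_log \<tau>) (k + 1) = fact k * (fps_nth (dil_borel * (fps_exp \<tau> - 1)) k + \<tau> ^ (k
        + 2) / fact (k + 2))"
    proof -
      have e: "k + 1 = Suc (Suc j)" "k + 2 = j + 3" using Suc by simp_all
      show ?thesis unfolding e fps_X2_mult_nth unfolding part_tau_log_def Suc by simp
    qed
    have H: "fps_nth dil_fps (k + 1) = fact k * fps_nth dil_borel k" by (simp add: dil_borel_def)
    have Y: "fps_nth (fps_const (\<tau>\<^sup>2 / 2) * fps_X) (k + 1) = 0" using Suc by (simp add: fps_X_def)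
    show ?thesis unfolding fps_deriv_nth fps_add_nth X H Y f
      by (simp add: algebra_simps del: of_nat_Suc fact_Suc)
  qed
  ultimately show "((\<lambda>\<tau>. fps_nth (part_tau_log \<tau>) k) has_field_derivative
     fps_nth (fps_deriv (dil_fps + fps_const (\<tau>\<^sup>2 / 2) * fps_X + fps_X\<^sup>2 * part_tau_log \<tau>)) k) (at \<tau>)" by simp
qed

text \<open>No logarithm of a series is formed. The defect \<open>D\<close> of the claimed identity
  satisfies a homogeneous linear equation whose order k involves only lower orders of
  \<open>D\<close>, since \<open>A\<close> has no constant term and the derivative of hbar^2 D still
  raises the order by one.\<close>

lemma part_tau_log_deriv: "fps_deriv (part_tau \<tau>) = part_tau_log \<tau> * part_tau \<tau>"
proof -
  define A where "A \<tau> = dil_fps + fps_const (\<tau>\<^sup>2 / 2) * fps_X" for \<tau>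
  define D where "D \<tau> = fps_deriv (part_tau \<tau>) - part_tau_log \<tau> * part_tau \<tau>" for \<tau>
  have A0: "fps_nth (A \<tau>) 0 = 0" for \<tau> by (simp add: A_def dil_fps_def dil_coeff_0)
  have "D \<tau> = 0"
  proof (rule fder_zero[of D "\<lambda>\<tau>. A \<tau> * D \<tau> + fps_deriv (fps_X\<^sup>2 * D \<tau>)"])
    fix \<tau>
    have "fder D (fps_deriv (A \<tau> * part_tau \<tau> + fps_X\<^sup>2 * fps_deriv (part_tau \<tau>))
        - (fps_deriv (A \<tau> + fps_X\<^sup>2 * part_tau_log \<tau>) * part_tau \<tau> + part_tau_log \<tau> * (A \<tau> * part_tau \<tau> + fps_X\<^sup>2
            * fps_deriv (part_tau \<tau>)))) \<tau>"
      unfolding D_def A_def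
      by (intro fder_diff fder_mult fder_fps_deriv part_tau_pde part_tau_log_pde)
    then show "fder D (A \<tau> * D \<tau> + fps_deriv (fps_X\<^sup>2 * D \<tau>)) \<tau>"
      by (rule fder_cong) (simp add: D_def algebra_simps)
  next
    have "part_tau 0 = 1" by (simp add: part_tau_def part_fps_def part_val_zero fps_eq_iff)
    moreover have "part_tau_log 0 = 0" by (simp add: part_tau_log_def fps_eq_iff)
    ultimately show "D 0 = 0" by (simp add: D_def)
  next
    fix k \<tau>
    assume k: "\<And>j q. j < k \<Longrightarrow> fps_nth (D q) j = 0"
    have "fps_nth (A \<tau> * D \<tau>) k = 0"
      unfolding fps_mult_nth
    proof (rule sum.neutral, rule ballI)
      fix i assume "i \<in> {0..k}"
      then show "fps_nth (A \<tau>) i * fps_nth (D \<tau>) (k - i) = 0" using A0 k by (cases i) auto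
    qed
    moreover have "fps_nth (fps_deriv (fps_X\<^sup>2 * D \<tau>)) k = 0"
      unfolding fps_deriv_nth using k by (simp add: fps_X_power_mult_nth)
    ultimately show "fps_nth (A \<tau> * D \<tau> + fps_deriv (fps_X\<^sup>2 * D \<tau>)) k = 0" by simp
  qed
  then show ?thesis by (simp add: D_def)
qed

text \<open>Logarithmic derivative of \<open>part_tau_2\<close>: the factor 1 - hbar contributes 1 /
  (1 - hbar), all of whose coefficients are 1.\<close>

lemma part_tau_log_diff: "fps_nth (part_tau_log 2) k - 2 * fps_nth (part_tau_log 1) k = 1"
proof -
  define G where "G = part_tau_log 2 - 2 * part_tau_log 1"
  have "fps_deriv ((1 - fps_X) * part_tau 2) = fps_deriv (part_tau 1 * part_tau 1)" by (simp add: part_tau_2)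
  then have "- part_tau 2 + (1 - fps_X) * (part_tau_log 2 * part_tau 2) = 2 * part_tau_log 1 * (part_tau 1
      * part_tau 1)"
    by (simp add: part_tau_log_deriv algebra_simps)
  then have "((1 - fps_X) * G - 1) * part_tau 2 = 0"
    unfolding part_tau_2[symmetric] G_def by (simp add: algebra_simps)
  moreover have "fps_nth (part_tau 2) 0 \<noteq> 0" by (simp add: part_tau_def part_fps_def part_val_0)
  ultimately have G: "(1 - fps_X) * G = 1" by auto
  have "fps_nth G k = 1"
  proof (induction k)
    case 0
    have "fps_nth ((1 - fps_X) * G) 0 = 1" using G by simp
    then show ?case by simp
  next
    case (Suc k)
    have "fps_nth ((1 - fps_X) * G) (Suc k) = 0" using G by simp
    then show ?case using Suc by (simp add: algebra_simps)
  qed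
  then show ?thesis by (simp add: G_def numeral_fps_const)
qed

text \<open>The combination E^2 - 1 - 2 (E - 1) = (E - 1)^2 arises twice, as the factor of
  \<open>dil_borel\<close> and from the terms tau^(k+3) / (k+3)!.\<close>

lemma dil_borel_eq:
  fixes E :: "complex fps"
  defines "E \<equiv> fps_exp 1"
  shows "fps_X\<^sup>2 * dil_borel * (E - 1)\<^sup>2 = fps_X\<^sup>2 * (E - 1) - (E - 1)\<^sup>2 + fps_X\<^sup>2"
proof -
  have E2: "fps_exp 2 = E * E" unfolding E_def by (simp flip: fps_exp_add_mult)
  \<comment> \<open>\<open>part_tau_log_diff\<close> supplies the orders from 3 on. Lower orders are
    checked directly; subtracting u^2 removes the coefficient 2^2 / 2! - 2 / 2! = 1 at order
    2.\<close>
  have "fps_X\<^sup>2 * (dil_borel * (fps_exp 2 - 1) - 2 * (dil_borel * (E - 1))) + (fps_exp 2 - 1) - 2 * (E - 1) - fps_X\<^sup>2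
      = fps_X\<^sup>2 * (E - 1)"
  proof (rule fps_ext)
    fix n :: nat
    have "n = 0 \<or> n = 1 \<or> n = 2 \<or> n = (n - 3) + 3" by linarith
    then consider "n = 0" | "n = 1" | "n = 2" | k where "n = k + 3" by blast
    then show "fps_nth (fps_X\<^sup>2 * (dil_borel * (fps_exp 2 - 1) - 2 * (dil_borel * (E - 1))) + (fps_exp 2 - 1) - 2 * (E
        - 1) - fps_X\<^sup>2) n = fps_nth (fps_X\<^sup>2 * (E - 1)) n"
    proof cases
      case 4
      have "fact (Suc k) * (fps_nth (dil_borel * (fps_exp 2 - 1)) (Suc k) - 2 * fps_nth (dil_borel * (E - 1)) (Suc k)
          + 2 ^ (k + 3) / fact (k + 3) - 2 / fact (k + 3)) = 1"
        using part_tau_log_diff[of k] by (simp add: part_tau_log_def E_def algebra_simps del: fact_Suc)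
      then have "fps_nth (dil_borel * (fps_exp 2 - 1)) (Suc k) - 2 * fps_nth (dil_borel * (E - 1)) (Suc k)
          + 2 ^ (k + 3) / fact (k + 3) - 2 / fact (k + 3) = 1 / fact (Suc k)"
        by (simp add: field_simps del: fact_Suc)
      then have k: "fps_nth (dil_borel * (fps_exp 2 - 1) - 2 * (dil_borel * (E - 1))) (Suc k)
          + 2 ^ (k + 3) / fact (k + 3) - 2 / fact (k + 3) = 1 / fact (Suc k)"
        by (simp add: numeral_fps_const del: fact_Suc)
      have e: "k + 3 = Suc (Suc (Suc k))" by simp
      have c: "fps_nth (fps_exp 2 - 1) (k + 3) = (2 :: complex) ^ (k + 3) / fact (k + 3)" "fps_nth (2 * (E - 1)) (k
          + 3) = 2 / fact (k + 3)"
        "fps_nth (fps_X\<^sup>2) (k + 3) = 0" "fps_nth (E - 1) (Suc k) = 1 / fact (Suc k)"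
        by (simp_all add: numeral_fps_const E_def fps_X_power_nth del: fact_Suc)
      show ?thesis unfolding 4 fps_sub_nth[of _ "fps_X\<^sup>2"] fps_sub_nth[of _ "2 * (E - 1)"] fps_add_nth c
        unfolding e fps_X2_mult_nth c using k unfolding e by simp
    qed (simp_all add: fps_X_power_mult_nth numeral_fps_const E_def fps_X_power_nth)
  qed
  then show ?thesis unfolding E2 by (simp add: algebra_simps power2_eq_square)
qed

text \<open>By \<open>dil_borel_eq\<close>, H = E / (E - 1)^2 - 1 / u^2, and E / (E - 1)^2 is minus
  the derivative of 1 / (E - 1). With b = u / (E - 1) this reads u^2 H = b - u b' - 1, and 1 - u
  d/du multiplies the coefficient of u^(n+1) by -n. From n = 2 on, the -1/8 in
  \<open>dil_fps\<close> is not seen.\<close>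

theorem dil_coeff_bernoulli:
  assumes "n \<ge> 2"
  shows "dil_coeff n = - bernoulli (n + 1) / of_nat (n + 1)"
proof -
  define E :: "complex fps" where "E = fps_exp 1"
  define b where "b = fps_X / (E - 1)"
  have b: "b * (E - 1) = fps_X" unfolding b_def E_def by (rule bernoulli_gen_fun)
  have nz: "E - 1 \<noteq> 0" using b by auto
  have "fps_deriv (b * (E - 1)) = 1" unfolding b by simp
  then have b': "fps_deriv b * (E - 1) = 1 - b * E" by (simp add: E_def algebra_simps)
  have "fps_X * fps_deriv b * (E - 1)\<^sup>2 = fps_X * (fps_deriv b * (E - 1)) * (E - 1)"
    by (simp add: power2_eq_square mult_ac)
  also have "\<dots> = fps_X * (E - 1) - fps_X * E * (b * (E - 1))" unfolding b' by (simp add: algebra_simps)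
  also have "\<dots> = fps_X * (E - 1) - fps_X * E * fps_X" unfolding b ..
  finally have x: "fps_X * fps_deriv b * (E - 1)\<^sup>2 = fps_X * (E - 1) - fps_X * E * fps_X" .
  have y: "b * (E - 1)\<^sup>2 = fps_X * (E - 1)" using b by (simp add: power2_eq_square flip: mult.assoc)
  have "(b - fps_X * fps_deriv b - 1) * (E - 1)\<^sup>2 = b * (E - 1)\<^sup>2 - fps_X * fps_deriv b * (E - 1)\<^sup>2 - (E - 1)\<^sup>2"
    by (simp add: algebra_simps)
  also have "\<dots> = fps_X\<^sup>2 * dil_borel * (E - 1)\<^sup>2"
    unfolding x y dil_borel_eq[folded E_def] by (simp add: algebra_simps power2_eq_square)
  finally have "fps_X\<^sup>2 * dil_borel = b - fps_X * fps_deriv b - 1" using nz by simp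
  then have "fps_nth (fps_X\<^sup>2 * dil_borel) (n + 1) = fps_nth (b - fps_X * fps_deriv b - 1) (n + 1)" by simp
  moreover obtain m where m: "n = Suc m" using assms by (cases n) auto
  ultimately have "fps_nth dil_borel m = fps_nth (b - fps_X * fps_deriv b - 1) (n + 1)"
    using fps_X2_mult_nth[of dil_borel m] by simp
  then have "fps_nth dil_borel m = - of_nat n * fps_nth b (n + 1)"
    by (simp add: m algebra_simps)
  moreover have "fps_nth dil_fps n = dil_coeff n" using assms by (simp add: dil_fps_def fps_X_def)
  ultimately have "dil_coeff n = - fact m * of_nat n * fps_nth b (n + 1)"
    by (simp add: dil_borel_def m field_simps del: of_nat_Suc)
  also have "fact m * of_nat n = (fact n :: complex)" by (simp add: m del: of_nat_Suc)
  then have "- fact m * of_nat n * fps_nth b (n + 1) = - fact n * fps_nth b (n + 1)" by simp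
  finally show ?thesis
    by (simp add: bernoulli_def b_def E_def field_simps del: of_nat_Suc)
qed

subsection \<open>Connected coefficients\<close>

text \<open>The product of exponential generating functions: every entry goes to one of the two
  factors. Lists are used because the same operation is applied to indices and to points, and
  because the recursion for \<open>conn\<close> is not visibly symmetric.\<close>

primrec shuffle :: "'a list \<Rightarrow> ('a list \<Rightarrow> 'b) \<Rightarrow> ('a list \<Rightarrow> 'b) \<Rightarrow> 'b :: comm_ring_1" where
  "shuffle [] f g = f [] * g []"
| "shuffle (a # xs) f g = shuffle xs (\<lambda>x. f (a # x)) g + shuffle xs f (\<lambda>x. g (a # x))"

text \<open>As a congruence rule it tells the function package that arguments occurring under
  \<open>shuffle\<close> are no longer than the given list; the termination of
  \<open>part_list\<close> rests on this.\<close>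

lemma shuffle_cong [fundef_cong]:
  assumes "xs = ys" "\<And>x. length x \<le> length ys \<Longrightarrow> f x = f' x" "\<And>x. length x \<le> length ys \<Longrightarrow> g x = g' x"
  shows "shuffle xs f g = shuffle ys f' g'"
  unfolding assms(1) using assms(2,3)
  by (induction ys arbitrary: f g f' g') (simp, fastforce intro!: arg_cong2[where f = "(+)"])

lemma shuffle_comm: "shuffle xs f g = shuffle xs g f"
  by (induction xs arbitrary: f g) (simp_all add: mult.commute add.commute)

lemma shuffle_add: "shuffle xs (\<lambda>x. f x + f' x) g = shuffle xs f g + shuffle xs f' g"
  by (induction xs arbitrary: f f' g) (simp_all add: algebra_simps)

lemma shuffle_scale: "shuffle xs (\<lambda>x. c * f x) g = c * shuffle xs f g"
  by (induction xs arbitrary: f g) (simp_all add: algebra_simps)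

lemma shuffle_zero: "shuffle xs (\<lambda>_. 0) g = 0"
  using shuffle_scale[of xs 0 "\<lambda>_. 0" g] by simp

lemma shuffle_diff: "shuffle xs (\<lambda>x. f x - f' x) g = shuffle xs f g - shuffle xs f' g"
  using shuffle_add[of xs f "\<lambda>x. (- 1) * f' x" g] shuffle_scale[of xs "- 1" f' g] by simp

lemma shuffle_sum: "finite I \<Longrightarrow> shuffle xs (\<lambda>x. \<Sum>i\<in>I. f i x) g = (\<Sum>i\<in>I. shuffle xs (f i) g)"
  by (induction rule: finite_induct) (simp_all add: shuffle_zero shuffle_add)

lemma shuffle_add_right: "shuffle xs f (\<lambda>x. g x + g' x) = shuffle xs f g + shuffle xs f g'"
  using shuffle_add[of xs g g' f] by (simp add: shuffle_comm[of xs f])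

lemma shuffle_assoc: "shuffle xs (\<lambda>x. shuffle x f g) h = shuffle xs f (\<lambda>x. shuffle x g h)"
  by (induction xs arbitrary: f g h) (simp_all add: shuffle_add shuffle_add_right algebra_simps)

lemma shuffle_unit: "shuffle xs (\<lambda>x. if x = [] then c else 0) g = c * g xs"
  by (induction xs arbitrary: g) (simp_all add: shuffle_zero)

lemma nths_insert_0: "nths (a # xs) (insert 0 (Suc ` J)) = a # nths xs J"
  and nths_Suc_image: "nths (a # xs) (Suc ` J) = nths xs J"
  by (simp_all add: nths_Cons image_iff)

text \<open>Identifies the shuffle with the sum over index sets in the definition of
  \<open>tr_omega\<close>: a subset of positions contains 0 or not, according to which factor
  receives the head.\<close>

lemma shuffle_Pow:
  "shuffle xs f g = (\<Sum>I\<in>Pow {..<length xs}. f (nths xs I) * g (nths xs ({..<length xs} - I)))"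
proof (induction xs arbitrary: f g)
  case (Cons a xs)
  let ?n = "length xs"
  let ?S = "\<lambda>J. Suc ` J" and ?T = "\<lambda>J. insert 0 (Suc ` J)"
  have P: "Pow {..<Suc ?n} = ?S ` Pow {..<?n} \<union> ?T ` Pow {..<?n}"
    unfolding lessThan_Suc_eq_insert_0 Pow_insert image_Pow_surj[OF refl, symmetric]
    by (simp add: image_image)
  have d: "?S ` Pow {..<?n} \<inter> ?T ` Pow {..<?n} = {}" by auto
  have iS: "inj_on ?S A" for A by (auto simp: inj_on_def inj_image_eq_iff)
  have iT: "inj_on ?T A" for A
  proof (rule inj_onI)
    fix x y :: "nat set" assume "insert 0 (Suc ` x) = insert 0 (Suc ` y)"
    then have "Suc ` x = Suc ` y" by (subst (asm) insert_ident) auto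
    then show "x = y" by (simp add: inj_image_eq_iff)
  qed
  have cS: "{..<Suc ?n} - Suc ` J = ?T ({..<?n} - J)" for J
    unfolding lessThan_Suc_eq_insert_0 by (auto simp: image_iff)
  have cT: "{..<Suc ?n} - insert 0 (Suc ` J) = ?S ({..<?n} - J)" for J
    unfolding lessThan_Suc_eq_insert_0 by (auto simp: image_iff)
  have "(\<Sum>I\<in>Pow {..<Suc ?n}. f (nths (a # xs) I) * g (nths (a # xs) ({..<Suc ?n} - I)))
     = (\<Sum>J\<in>Pow {..<?n}. f (nths xs J) * g (a # nths xs ({..<?n} - J)))
     + (\<Sum>J\<in>Pow {..<?n}. f (a # nths xs J) * g (nths xs ({..<?n} - J)))"
    unfolding P by (subst sum.union_disjoint) (use d in \<open>simp_all add: sum.reindex[OF iS] sum.reindex[OF iT] cS cT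
        nths_insert_0 nths_Suc_image\<close>)
  then show ?case by (simp add: Cons.IH add.commute)
qed simp

primrec lin_op_list :: "nat list \<Rightarrow> nat \<Rightarrow> (nat \<Rightarrow> nat list \<Rightarrow> 'b) \<Rightarrow> 'b :: comm_ring_1" where
  "lin_op_list [] m \<psi> = 0"
| "lin_op_list (b # xs) m \<psi> = (if m + b = 0 then 0 else 2 * of_nat (2 * b + 1) * \<psi> (m + b - 1) xs)
     + lin_op_list xs m (\<lambda>e x. \<psi> e (b # x))"

lemma lin_op_list_add: "lin_op_list xs m (\<lambda>e x. \<psi> e x + \<psi>' e x) = lin_op_list xs m \<psi> + lin_op_list xs m \<psi>'"
  by (induction xs arbitrary: \<psi> \<psi>') (simp_all add: algebra_simps)

text \<open>A first-order operator whose derivative acts on the first factor multiplies by a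
  variable only, and this passes the factor \<open>g\<close> freely.\<close>

lemma lin_op_list_shuffle: "lin_op_list xs m (\<lambda>e x. shuffle x (\<psi> e) g) = shuffle xs (\<lambda>x. lin_op_list x m \<psi>) g"
proof (induction xs arbitrary: \<psi> g)
  case (Cons b xs)
  have "shuffle xs (\<lambda>x. (if m + b = 0 then 0 else 2 * of_nat (2 * b + 1) * \<psi> (m + b - 1) x)) g
    = (if m + b = 0 then 0 else 2 * of_nat (2 * b + 1) * shuffle xs (\<psi> (m + b - 1)) g)"
  proof (cases "m + b = 0")
    case True
    then show ?thesis by (simp add: shuffle_zero)
  next
    case False
    then show ?thesis by (simp only: if_False shuffle_scale)
  qed
  then show ?case
    by (simp only: lin_op_list.simps shuffle.simps lin_op_list_add shuffle_add Cons.IH add.assoc)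
qed simp

text \<open>
  \<open>conn (2 * g - 2 + n) [d\<^sub>1, \<dots>, d\<^sub>n]\<close> is the coefficient of \<open>\<Prod>i. z\<^sub>i ^ (- 2 * d\<^sub>i - 2)\<close> in the stable
  correlator of genus \<open>g\<close> for \<open>\<theta> = 1\<close>.
\<close>

function conn :: "nat \<Rightarrow> nat list \<Rightarrow> complex" where
  "conn 0 ds = 0"
| "conn (Suc k) [] = 0"
| "conn (Suc k) (a # xs) =
     ((\<Sum>i<a. conn k (i # (a - 1 - i) # xs)
         + (\<Sum>l\<in>{..k}. shuffle xs (\<lambda>x. conn l (i # x)) (\<lambda>x. conn (k - l) ((a - 1 - i) # x))))
      + lin_op_list xs (Suc a) (\<lambda>e x. conn k (e # x)) + (if k = 0 \<and> a = 0 \<and> xs = [] then 1 / 4 else 0)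
      - ((\<Sum>i<a - 1. conn k (i # (a - 2 - i) # xs)
         + (\<Sum>l\<in>{..k}. shuffle xs (\<lambda>x. conn l (i # x)) (\<lambda>x. conn (k - l) ((a - 2 - i) # x))))
      + lin_op_list xs a (\<lambda>e x. conn k (e # x)) + (if k = 0 \<and> a = 1 \<and> xs = [] then 1 / 4 else 0)
      + (if k = 0 \<and> a = 0 \<and> xs = [0, 0] then 2 else 0))) / 2"
  by pat_completeness auto
termination by (relation "Wellfounded.measure fst") auto

declare conn.simps(3) [simp del]

section \<open>Connected coefficients and their exponential\<close>

text \<open>The coefficients of (\<open>vir m\<close> Z) / Z written through F = log Z, with second
  derivatives giving F_ij + F_i F_j. The value 2 at [0, 0] is the second derivative of
  x_0^2.\<close>

definition conn_src :: "nat \<Rightarrow> nat \<Rightarrow> nat list \<Rightarrow> complex" where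
  "conn_src k m xs = (\<Sum>i<m - 1. conn k (i # (m - 2 - i) # xs)
         + (\<Sum>l\<le>k. shuffle xs (\<lambda>x. conn l (i # x)) (\<lambda>x. conn (k - l) ((m - 2 - i) # x))))
      + lin_op_list xs m (\<lambda>e x. conn k (e # x)) + (if k = 0 \<and> m = 1 \<and> xs = [] then 1 / 4 else 0)
      + (if k = 0 \<and> m = 0 \<and> xs = [0, 0] then 2 else 0)"

lemma conn_Suc: "conn (Suc k) (a # xs) = (conn_src k (Suc a) xs - conn_src k a xs) / 2"
proof -
  have "a - 1 - i = Suc a - 2 - i" for i by simp
  then show ?thesis by (simp add: conn.simps(3) conn_src_def)
qed

definition conn_fps :: "nat list \<Rightarrow> complex fps" where
  "conn_fps xs = Abs_fps (\<lambda>k. conn k xs)"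

lemma fps_nth_shuffle:
  "fps_nth (shuffle xs F G) k = (\<Sum>l\<le>k. shuffle xs (\<lambda>x. fps_nth (F x) l) (\<lambda>x. fps_nth (G x) (k - l)))"
  by (induction xs arbitrary: F G) (simp_all add: fps_mult_nth sum.distrib atMost_atLeast0)

lemma fps_nth_lin_op_list:
  fixes \<psi> :: "nat \<Rightarrow> nat list \<Rightarrow> complex fps"
  shows "fps_nth (lin_op_list xs m \<psi>) k = lin_op_list xs m (\<lambda>e x. fps_nth (\<psi> e x) k)"
proof (induction xs arbitrary: \<psi>)
  case (Cons b xs)
  have "fps_nth (2 * of_nat (2 * b + 1) * F) k = 2 * of_nat (2 * b + 1) * fps_nth F k" for F :: "complex fps"
    by (simp add: numeral_fps_const fps_of_nat[symmetric] mult.assoc del: of_nat_add of_nat_mult of_nat_Suc)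
  then show ?case by (simp add: Cons.IH del: of_nat_add of_nat_mult of_nat_Suc)
qed simp

definition conn_src_fps :: "nat \<Rightarrow> nat list \<Rightarrow> complex fps" where
  "conn_src_fps m xs = (\<Sum>i<m - 1. conn_fps (i # (m - 2 - i) # xs)
      + shuffle xs (\<lambda>x. conn_fps (i # x)) (\<lambda>x. conn_fps ((m - 2 - i) # x)))
      + lin_op_list xs m (\<lambda>e x. conn_fps (e # x)) + (if m = 1 then 1 else 0) * (if xs
          = [] then fps_const (1 / 4) else 0)
      + (if m = 0 then 1 else 0) * (if xs = [0, 0] then fps_const 2 else 0)"

lemma fps_nth_conn_src_fps: "fps_nth (conn_src_fps m xs) k = conn_src k m xs"
proof -
  have 1: "fps_nth ((if m = 1 then 1 else 0) * (if xs = [] then fps_const (1 / 4) else 0)) k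
    = (if k = 0 \<and> m = 1 \<and> xs = [] then 1 / 4 else (0 :: complex))" by auto
  have 2: "fps_nth ((if m = 0 then 1 else 0) * (if xs = [0, 0] then fps_const 2 else 0)) k
    = (if k = 0 \<and> m = 0 \<and> xs = [0, 0] then 2 else (0 :: complex))" by auto
  show ?thesis unfolding conn_src_fps_def conn_src_def fps_add_nth 1 2
    by (simp add: fps_sum_nth fps_nth_shuffle fps_nth_lin_op_list conn_fps_def)
qed

lemma conn_fps_Cons: "conn_fps (a # xs) = fps_const (1 / 2) * fps_X * (conn_src_fps (Suc a) xs - conn_src_fps a xs)"
proof (rule fps_ext)
  fix k show "fps_nth (conn_fps (a # xs)) k = fps_nth (fps_const (1 / 2) * fps_X * (conn_src_fps (Suc a) xs
      - conn_src_fps a xs)) k"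
    by (cases k) (simp_all add: conn_fps_def conn_Suc mult.assoc fps_nth_conn_src_fps)
qed

text \<open>The exponential of the generating function of \<open>conn\<close>, defined by the rule
  that the derivative of exp F is F' exp F.\<close>

function part_list :: "nat list \<Rightarrow> complex fps" where
  "part_list [] = 1"
| "part_list (a # xs) = shuffle xs (\<lambda>x. conn_fps (a # x)) part_list"
  by pat_completeness auto
termination by (relation "Wellfounded.measure length") auto

declare part_list.simps(2) [simp del]

definition vir_list :: "nat \<Rightarrow> (nat list \<Rightarrow> complex fps) \<Rightarrow> nat list \<Rightarrow> complex fps" where
  "vir_list m f xs = (\<Sum>i<m - 1. f (i # (m - 2 - i) # xs)) + lin_op_list xs m (\<lambda>e x. f (e # x))
     + (if m = 1 then 1 else 0) * (fps_const (1 / 4) * f xs)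
     + (if m = 0 then 1 else 0) * shuffle xs (\<lambda>x. if x = [0, 0] then fps_const 2 else 0) f"

text \<open>Multiplication by exp F linearizes the source: (F_ij + F_i F_j) exp F is a second
  derivative of exp F, and the other terms are of first or zeroth order.\<close>

lemma shuffle_conn_src_fps: "shuffle xs (conn_src_fps m) part_list = vir_list m part_list xs"
proof -
  have 1: "part_list (i # j # xs) = shuffle xs (\<lambda>x. conn_fps (i # j # x)) part_list
      + shuffle xs (\<lambda>x. shuffle x (\<lambda>x. conn_fps (i # x)) (\<lambda>x. conn_fps (j # x))) part_list" for i j
  proof -
    have "part_list (i # j # xs) = shuffle xs (\<lambda>x. conn_fps (i # j # x)) part_list
        + shuffle xs (\<lambda>x. conn_fps (i # x)) (\<lambda>x. shuffle x (\<lambda>x. conn_fps (j # x)) part_list)"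
      by (simp add: part_list.simps(2))
    then show ?thesis by (simp only: shuffle_assoc)
  qed
  have 2: "shuffle xs (\<lambda>x. lin_op_list x m (\<lambda>e x. conn_fps (e # x))) part_list
      = lin_op_list xs m (\<lambda>e x. part_list (e # x))"
    unfolding lin_op_list_shuffle[symmetric] by (simp only: part_list.simps(2))
  have "conn_src_fps m = (\<lambda>xs. (\<Sum>i<m - 1. conn_fps (i # (m - 2 - i) # xs)
      + shuffle xs (\<lambda>x. conn_fps (i # x)) (\<lambda>x. conn_fps ((m - 2 - i) # x)))
      + lin_op_list xs m (\<lambda>e x. conn_fps (e # x)) + (if m = 1 then 1 else 0) * (if xs
          = [] then fps_const (1 / 4) else 0)
      + (if m = 0 then 1 else 0) * (if xs = [0, 0] then fps_const 2 else 0))"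
    by (rule ext) (simp only: conn_src_fps_def)
  then show ?thesis
    by (simp only: vir_list_def shuffle_add shuffle_scale shuffle_unit shuffle_sum[OF finite_lessThan] 1 2)
qed

lemma part_list_Cons: "part_list (a # xs) = fps_const (1 / 2) * fps_X * (vir_list (Suc a) part_list xs
    - vir_list a part_list xs)"
proof -
  have "part_list (a # xs) = shuffle xs (\<lambda>x. conn_fps (a # x)) part_list" by (simp add: part_list.simps(2))
  then show ?thesis by (simp only: conn_fps_Cons shuffle_scale shuffle_diff shuffle_conn_src_fps)
qed

lemma lin_op_list_mset: "lin_op_list xs m (\<lambda>e x. f (add_mset e (mset x))) = lin_op m f (mset xs)"
proof (induction xs arbitrary: f)
  case Nil
  then show ?case by (simp add: lin_op_def)
next
  case (Cons b xs)
  have "lin_op m f (mset (b # xs)) = pd b (lin_op m f) (mset xs)" by (simp add: pd_def)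
  also have "\<dots> = lin_op m (pd b f) (mset xs) + 2 * of_nat (2 * b + 1) * sh (m + b) f (mset xs)"
    by (rule pd_lin_op)
  also have "lin_op m (pd b f) (mset xs) = lin_op_list xs m (\<lambda>e x. f (add_mset e (mset (b # x))))"
  proof -
    have "(\<lambda>e x. f (add_mset e (mset (b # x)))) = (\<lambda>e x. pd b f (add_mset e (mset x)))"
      by (simp add: fun_eq_iff pd_def add_mset_commute)
    then show ?thesis by (simp only: Cons.IH)
  qed
  finally show ?case by (simp add: sh_def pd_def)
qed

lemma shuffle_x0: "shuffle xs (\<lambda>x. if x = [0] then c else 0) (\<lambda>x. f (mset x)) = c * x0 f (mset xs)"
proof (induction xs arbitrary: f)
  case Nil
  then show ?case by (simp add: x0_def)
next
  case (Cons a xs)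
  have 1: "shuffle xs (\<lambda>x. if a # x = [0] then c else 0) (\<lambda>x. f (mset x)) = (if a = 0 then c else 0) * f (mset xs)"
    using shuffle_unit[of xs c "\<lambda>x. f (mset x)"] by (cases "a = 0") (simp_all add: shuffle_zero)
  have 2: "shuffle xs (\<lambda>x. if x = [0] then c else 0) (\<lambda>x. f (mset (a # x))) = c * x0 (pd a f) (mset xs)"
  proof -
    have "(\<lambda>x. f (mset (a # x))) = (\<lambda>x. pd a f (mset x))" by (simp add: fun_eq_iff pd_def)
    then show ?thesis by (simp only: Cons.IH)
  qed
  have "x0 f (mset (a # xs)) = pd a (x0 f) (mset xs)" by (simp add: pd_def)
  then show ?case unfolding shuffle.simps 1 2 by (simp add: pd_x0 algebra_simps)
qed

lemma shuffle_x0_x0: "shuffle xs (\<lambda>x. if x = [0, 0] then 2 else 0) (\<lambda>x. f (mset x)) = x0 (x0 f) (mset xs)"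
proof (induction xs arbitrary: f)
  case Nil
  then show ?case by (simp add: x0_def)
next
  case (Cons a xs)
  have 1: "shuffle xs (\<lambda>x. if a # x = [0, 0] then 2 else 0) (\<lambda>x. f (mset x)) = (if a = 0 then 2 else 0)
      * x0 f (mset xs)"
    using shuffle_x0[of xs 2 f] by (cases "a = 0") (simp_all add: shuffle_zero)
  have 2: "shuffle xs (\<lambda>x. if x = [0, 0] then 2 else 0) (\<lambda>x. f (mset (a # x))) = x0 (x0 (pd a f)) (mset xs)"
  proof -
    have "(\<lambda>x. f (mset (a # x))) = (\<lambda>x. pd a f (mset x))" by (simp add: fun_eq_iff pd_def)
    then show ?thesis by (simp only: Cons.IH)
  qed
  have p: "pd a (x0 f) = (\<lambda>M. x0 (pd a f) M + (if a = 0 then 1 else 0) * f M)"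
    by (auto simp: fun_eq_iff pd_x0)
  have "x0 (x0 f) (mset (a # xs)) = pd a (x0 (x0 f)) (mset xs)" by (simp add: pd_def)
  then show ?case unfolding shuffle.simps 1 2 by (simp add: pd_x0 p x0_add x0_scale)
qed

lemma fps_nth_shuffle_const:
  "fps_nth (shuffle xs (\<lambda>x. fps_const (c x)) F) k = shuffle xs c (\<lambda>x. fps_nth (F x) k)"
  by (induction xs arbitrary: c F) simp_all

text \<open>Both sides obey the same recursion; the list prescribes which element is removed, and
  \<open>part_rec\<close> allows any choice.\<close>

lemma part_list_eq_part: "fps_nth (part_list xs) k = part k (mset xs)"
proof (induction k arbitrary: xs)
  case 0
  then show ?case by (cases xs) (simp_all add: part_empty part_list_Cons part.simps(1) mult.assoc)
next
  case (Suc k)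
  show ?case
  proof (cases xs)
    case Nil
    then show ?thesis by (simp add: part_empty)
  next
    case (Cons a ys)
    have V: "fps_nth (vir_list m part_list ys) k = vir m (part k) (mset ys)" for m
    proof -
      have 1: "fps_nth (lin_op_list ys m (\<lambda>e x. part_list (e # x))) k = lin_op m (part k) (mset ys)"
        unfolding fps_nth_lin_op_list lin_op_list_mset[symmetric] by (simp add: Suc)
      have "fps_nth (shuffle ys (\<lambda>x. fps_const (if x = [0, 0] then 2 else 0)) part_list) k = x0 (x0 (part k)) (mset ys)"
        unfolding fps_nth_shuffle_const shuffle_x0_x0[symmetric] by (simp add: Suc)
      moreover have "(\<lambda>x :: nat list. fps_const (if x = [0, 0] then 2 else (0::complex))) = (\<lambda>x. if x
          = [0, 0] then fps_const 2 else 0)"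
        by auto
      ultimately have 2: "fps_nth (shuffle ys (\<lambda>x. if x = [0, 0] then fps_const 2 else 0) part_list) k
          = x0 (x0 (part k)) (mset ys)"
        by simp
      show ?thesis unfolding vir_list_def vir_def sum_sh_sh fps_add_nth 1
        by (auto simp: fps_sum_nth Suc 2)
    qed
    show ?thesis unfolding Cons part_list_Cons mset.simps part_rec vir'_def
      by (simp add: mult.assoc V)
  qed
qed

theorem conn_eq_part: "conn k [d] = part k {#d#}"
  using part_list_eq_part[of "[d]" k] by (simp add: part_list.simps(2) conn_fps_def)

subsection \<open>Correlators and residues\<close>

lemma shuffle_nonzero:
  assumes "shuffle xs f g \<noteq> 0"
  shows "\<exists>ys zs. f ys \<noteq> 0 \<and> g zs \<noteq> 0 \<and> mset ys + mset zs = mset xs"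
  using assms
proof (induction xs arbitrary: f g)
  case Nil
  then show ?case by (intro exI[of _ "[]"]) auto
next
  case (Cons a xs)
  then consider "shuffle xs (\<lambda>x. f (a # x)) g \<noteq> 0" | "shuffle xs f (\<lambda>x. g (a # x)) \<noteq> 0" by fastforce
  then show ?case
  proof cases
    case 1
    then obtain ys zs where "f (a # ys) \<noteq> 0" "g zs \<noteq> 0" "mset ys + mset zs = mset xs"
      using Cons.IH by blast
    then show ?thesis by (intro exI[of _ "a # ys"] exI[of _ zs]) auto
  next
    case 2
    then obtain ys zs where "f ys \<noteq> 0" "g (a # zs) \<noteq> 0" "mset ys + mset zs = mset xs"
      using Cons.IH by blast
    then show ?thesis by (intro exI[of _ ys] exI[of _ "a # zs"]) auto
  qed
qed

lemma lin_op_list_nonzero: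
  assumes "lin_op_list xs m \<psi> \<noteq> 0"
  shows "\<exists>b ys. m + b \<ge> 1 \<and> \<psi> (m + b - 1) ys \<noteq> 0 \<and> mset xs = add_mset b (mset ys)"
  using assms
proof (induction xs arbitrary: \<psi>)
  case (Cons b xs)
  then consider "m + b \<noteq> 0" "\<psi> (m + b - 1) xs \<noteq> 0" | "lin_op_list xs m (\<lambda>e x. \<psi> e (b # x)) \<noteq> 0"
    by (fastforce split: if_splits)
  then show ?case
  proof cases
    case 1
    then show ?thesis by (intro exI[of _ b] exI[of _ xs]) auto
  next
    case 2
    then obtain c ys where "m + c \<ge> 1" "\<psi> (m + c - 1) (b # ys) \<noteq> 0" "mset xs = add_mset c (mset ys)"
      using Cons.IH by blast
    then show ?thesis by (intro exI[of _ c] exI[of _ "b # ys"]) auto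
  qed
qed simp

lemma conn_src_nonzero:
  assumes IH: "\<And>l ds. l \<le> k \<Longrightarrow> conn l ds \<noteq> 0 \<Longrightarrow> sum_list ds \<le> 2 * l \<and> (\<exists>h. l + 2 = 2 * h + length ds)"
    and "conn_src k m xs \<noteq> 0"
  shows "m + sum_list xs \<le> 2 * k + 2 \<and> (\<exists>h. k + 2 = 2 * h + length xs)"
proof -
  let ?q = "\<lambda>i. conn k (i # (m - 2 - i) # xs)
         + (\<Sum>l\<le>k. shuffle xs (\<lambda>x. conn l (i # x)) (\<lambda>x. conn (k - l) ((m - 2 - i) # x)))"
  consider "(\<Sum>i<m - 1. ?q i) \<noteq> 0" | "lin_op_list xs m (\<lambda>e x. conn k (e # x)) \<noteq> 0" | "k = 0" "m = 1" "xs = []"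
    | "k = 0" "m = 0" "xs = [0, 0]"
    using assms(2) by (fastforce simp: conn_src_def split: if_splits)
  then show ?thesis
  proof cases
    case 1
    then obtain i where i: "i < m - 1" "?q i \<noteq> 0" by (metis (no_types, lifting) lessThan_iff sum.neutral)
    show ?thesis
    proof (cases "conn k (i # (m - 2 - i) # xs) = 0")
      case False
      then have "sum_list (i # (m - 2 - i) # xs) \<le> 2 * k" "\<exists>h. k + 2 = 2 * h + length (i # (m - 2 - i) # xs)"
        using IH by blast+
      then obtain h where "i + (m - 2 - i) + sum_list xs \<le> 2 * k" "k + 2 = 2 * h + length xs + 2" by auto
      then have "m + sum_list xs \<le> 2 * k + 2" "k + 2 = 2 * (h + 1) + length xs" using i by auto
      then show ?thesis by blast
    next
      case True
      then obtain l where l: "l \<le> k" "shuffle xs (\<lambda>x. conn l (i # x)) (\<lambda>x. conn (k - l) ((m - 2 - i) # x)) \<noteq> 0"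
        using i(2) by (metis (no_types, lifting) add.left_neutral atMost_iff sum.neutral)
      then obtain ys zs where yz: "conn l (i # ys) \<noteq> 0" "conn (k - l) ((m - 2 - i) # zs) \<noteq> 0" "mset ys + mset zs
          = mset xs"
        using shuffle_nonzero by blast
      have s: "sum_list xs = sum_list ys + sum_list zs" "length xs = length ys + length zs"
        using arg_cong[OF yz(3), of sum_mset] arg_cong[OF yz(3), of size] by (simp_all add: sum_mset_sum_list)
      have 1: "sum_list (i # ys) \<le> 2 * l" "\<exists>h. l + 2 = 2 * h + length (i # ys)"
        using IH[OF l(1) yz(1)] by auto
      have 2: "sum_list ((m - 2 - i) # zs) \<le> 2 * (k - l)" "\<exists>h. (k - l) + 2 = 2 * h + length ((m - 2 - i) # zs)"
        using IH[OF _ yz(2)] by auto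
      obtain h h' where "l + 2 = 2 * h + length ys + 1" "(k - l) + 2 = 2 * h' + length zs + 1" using 1 2 by auto
      then have "k + 2 = 2 * (h + h') + length xs" using l s by auto
      moreover have "m + sum_list xs \<le> 2 * k + 2" using 1(1) 2(1) s(1) i(1) l(1) by simp
      ultimately show ?thesis by blast
    qed
  next
    case 2
    then obtain b ys where b: "m + b \<ge> 1" "conn k ((m + b - 1) # ys) \<noteq> 0" "mset xs = add_mset b (mset ys)"
      using lin_op_list_nonzero by blast
    have s: "sum_list xs = b + sum_list ys" "length xs = length ys + 1"
      using arg_cong[OF b(3), of sum_mset] arg_cong[OF b(3), of size] by (simp_all add: sum_mset_sum_list)
    obtain h where "sum_list ((m + b - 1) # ys) \<le> 2 * k" "k + 2 = 2 * h + length ((m + b - 1) # ys)"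
      using IH[OF _ b(2)] by auto
    then show ?thesis using s b by auto
  next
    case 3
    then show ?thesis by (auto intro: exI[of _ 1])
  next
    case 4
    then show ?thesis by auto
  qed
qed

text \<open>The witness h is the genus: k = 2h - 2 + n for n arguments. Thus the single index k can
  replace the genus, with vanishing coefficients wherever no genus fits; the weight bound justifies
  all truncations at \<open>N\<close>.\<close>

lemma conn_nonzero:
  "conn k ds \<noteq> 0 \<Longrightarrow> sum_list ds \<le> 2 * k \<and> (\<exists>h. k + 2 = 2 * h + length ds)"
proof (induction k arbitrary: ds rule: less_induct)
  case (less k)
  obtain j where j: "k = Suc j" using less.prems by (cases k) auto
  obtain a xs where ds: "ds = a # xs" using less.prems j by (cases ds) auto
  have IH: "sum_list ds \<le> 2 * l \<and> (\<exists>h. l + 2 = 2 * h + length ds)" if "l \<le> j" "conn l ds \<noteq> 0" for l ds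
    using less.IH that j by auto
  have "conn_src j (Suc a) xs \<noteq> 0 \<or> conn_src j a xs \<noteq> 0"
    using less.prems by (auto simp: j ds conn_Suc)
  then have "a + sum_list xs \<le> 2 * j + 2 \<and> (\<exists>h. j + 2 = 2 * h + length xs)"
    using conn_src_nonzero[of j, OF IH, of "Suc a" xs] conn_src_nonzero[of j, OF IH, of a xs] by auto
  then show ?case by (auto simp: j ds)
qed

lemma conn_src_eq_0: "m > 2 * k + 2 \<Longrightarrow> conn_src k m xs = 0"
  using conn_src_nonzero[OF conn_nonzero, of k m xs] by auto

lemma conn_eq_0: "k + 2 < length ds \<Longrightarrow> conn k ds = 0"
  using conn_nonzero[of k ds] by auto

section \<open>Evaluation at points\<close>

primrec evl :: "nat \<Rightarrow> complex list \<Rightarrow> (nat list \<Rightarrow> complex) \<Rightarrow> complex" where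
  "evl N [] f = f []"
| "evl N (z # zs) f = (\<Sum>d<N. (1 / z) ^ (2 * d + 2) * evl N zs (\<lambda>x. f (d # x)))"

lemma evl_cong: "(\<And>x. length x = length zs \<Longrightarrow> f x = g x) \<Longrightarrow> evl N zs f = evl N zs g"
proof (induction zs arbitrary: f g)
  case (Cons z zs)
  have "evl N zs (\<lambda>x. f (d # x)) = evl N zs (\<lambda>x. g (d # x))" for d
    by (rule Cons.IH) (use Cons.prems in auto)
  then show ?case by simp
qed simp

lemma evl_add: "evl N zs (\<lambda>x. f x + g x) = evl N zs f + evl N zs g"
  by (induction zs arbitrary: f g) (simp_all add: algebra_simps sum.distrib)

lemma evl_scale: "evl N zs (\<lambda>x. c * f x) = c * evl N zs f"
  by (induction zs arbitrary: f) (simp_all add: sum_distrib_left mult_ac)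

lemma evl_zero: "evl N zs (\<lambda>_. 0) = 0"
  using evl_scale[of N zs 0 "\<lambda>_. 0"] by simp

lemma evl_sum: "finite I \<Longrightarrow> evl N zs (\<lambda>x. \<Sum>i\<in>I. f i x) = (\<Sum>i\<in>I. evl N zs (f i))"
  by (induction rule: finite_induct) (simp_all add: evl_zero evl_add)

lemma evl_diff: "evl N zs (\<lambda>x. f x - g x) = evl N zs f - evl N zs g"
  using evl_add[of N zs f "\<lambda>x. (- 1) * g x"] evl_scale[of N zs "- 1" g] by simp

lemma shuffle_sum_scale_right:
  fixes c :: "'i \<Rightarrow> 'b :: comm_ring_1"
  shows "finite I \<Longrightarrow> shuffle xs f (\<lambda>x. \<Sum>i\<in>I. c i * g i x) = (\<Sum>i\<in>I. c i * shuffle xs f (g i))"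
  and "finite I \<Longrightarrow> shuffle xs (\<lambda>x. \<Sum>i\<in>I. c i * g i x) f = (\<Sum>i\<in>I. c i * shuffle xs (g i) f)"
  by (simp_all add: shuffle_comm[of xs f] shuffle_sum shuffle_scale)

lemma evl_shuffle: "evl N zs (\<lambda>x. shuffle x f g) = shuffle zs (\<lambda>u. evl N u f) (\<lambda>u. evl N u g)"
proof (induction zs arbitrary: f g)
  case (Cons z zs)
  show ?case
    by (simp only: evl.simps shuffle.simps evl_add Cons.IH shuffle_sum_scale_right[OF finite_lessThan] sum.distrib
        distrib_left)
qed simp

text \<open>Written as a function of a list of points so that singling out one argument w and
  multiplying by w^(-2b-2) becomes a shuffle product.\<close>

definition pole :: "nat \<Rightarrow> complex list \<Rightarrow> complex" where
  "pole b u = (case u of [w] \<Rightarrow> (1 / w) ^ (2 * b + 2) | _ \<Rightarrow> 0)"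

lemma pole_Cons: "pole b (w # x) = (if x = [] then (1 / w) ^ (2 * b + 2) else 0)" and pole_Nil: "pole b [] = 0"
  by (auto simp: pole_def split: list.split)

lemma evl_lin_op_list:
  "evl N zs (\<lambda>x. lin_op_list x m \<psi>) = (\<Sum>b<N. if m + b = 0 then 0 else
     2 * of_nat (2 * b + 1) * shuffle zs (pole b) (\<lambda>u. evl N u (\<psi> (m + b - 1))))"
proof (induction zs arbitrary: \<psi>)
  case Nil
  show ?case by (simp, intro sum.neutral) (auto simp: pole_Nil)
next
  case (Cons w zs)
  define c :: "nat \<Rightarrow> complex" where "c b = (if m + b = 0 then 0 else 2 * of_nat (2 * b + 1))" for b
  have c: "(if m + b = 0 then 0 else 2 * of_nat (2 * b + 1) * X) = c b * X" for b X
    by (simp add: c_def)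
  have IH: "evl N zs (\<lambda>x. lin_op_list x m \<psi>) = (\<Sum>b<N. c b * shuffle zs (pole b) (\<lambda>u. evl N u (\<psi> (m + b - 1))))" for \<psi>
    using Cons.IH[of \<psi>] unfolding c .
  have "evl N (w # zs) (\<lambda>x. lin_op_list x m \<psi>)
     = (\<Sum>d<N. (1 / w) ^ (2 * d + 2) * (c d * evl N zs (\<psi> (m + d - 1))
        + (\<Sum>b<N. c b * shuffle zs (pole b) (\<lambda>u. evl N u (\<lambda>x. \<psi> (m + b - 1) (d # x))))))"
    unfolding evl.simps lin_op_list.simps c evl_add evl_scale IH ..
  also have "\<dots> = (\<Sum>d<N. c d * ((1 / w) ^ (2 * d + 2) * evl N zs (\<psi> (m + d - 1))))
      + (\<Sum>d<N. \<Sum>b<N. c b * ((1 / w) ^ (2 * d + 2) * shuffle zs (pole b) (\<lambda>u. evl N u (\<lambda>x. \<psi> (m + b - 1) (d # x)))))"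
    by (simp only: distrib_left sum.distrib sum_distrib_left mult.left_commute)
  also have "(\<Sum>d<N. \<Sum>b<N. c b * ((1 / w) ^ (2 * d + 2) * shuffle zs (pole b) (\<lambda>u. evl N u (\<lambda>x. \<psi> (m + b - 1) (d # x)))))
     = (\<Sum>b<N. c b * shuffle zs (pole b) (\<lambda>u. evl N (w # u) (\<psi> (m + b - 1))))"
    by (subst sum.swap) (simp only: evl.simps shuffle_sum_scale_right[OF finite_lessThan] sum_distrib_left)
  also have "(\<Sum>d<N. c d * ((1 / w) ^ (2 * d + 2) * evl N zs (\<psi> (m + d - 1))))
     = (\<Sum>b<N. c b * shuffle zs (\<lambda>x. pole b (w # x)) (\<lambda>u. evl N u (\<psi> (m + b - 1))))"
    unfolding pole_Cons shuffle_unit ..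
  finally show ?case unfolding c by (simp only: shuffle.simps distrib_left sum.distrib)
qed

section \<open>Residues from power series expansions\<close>

text \<open>Carries the expansion that proves the residue, so that sums and multiples can be treated
  without separate analyticity conditions.\<close>

definition has_res :: "(complex \<Rightarrow> complex) \<Rightarrow> complex \<Rightarrow> bool" where
  "has_res f c \<longleftrightarrow> (\<exists>A P n. A has_fps_expansion P \<and> eventually (\<lambda>z. f z = A z / z ^ Suc n) (at 0) \<and> c = fps_nth P n)"

lemma has_res_residue: "has_res f c \<Longrightarrow> residue f 0 = c"
proof -
  assume "has_res f c"
  then obtain A P n where A: "A has_fps_expansion P" "eventually (\<lambda>z. f z = A z / z ^ Suc n) (at 0)" "c = fps_nth P n"
    unfolding has_res_def by blast
  have "residue f 0 = residue (\<lambda>z. A z / z ^ Suc n) 0"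
    by (rule residue_cong) (use A in auto)
  then show ?thesis using residue_fps_expansion_over_power_at_0[OF A(1), of n] A(3) by simp
qed

lemma has_res_I: "A has_fps_expansion P \<Longrightarrow> has_res (\<lambda>z. A z * (1 / z) ^ Suc n) (fps_nth P n)"
  unfolding has_res_def by (intro exI[of _ A] exI[of _ P] exI[of _ n])
      (simp only: power_one_over mult_1_right times_divide_eq_right, simp)

lemma has_res_cong: "has_res f c \<Longrightarrow> eventually (\<lambda>z. g z = f z) (at 0) \<Longrightarrow> has_res g c"
  unfolding has_res_def by (elim exE conjE, intro exI conjI) (auto elim: eventually_elim2)

lemma has_res_scale: "has_res f c \<Longrightarrow> has_res (\<lambda>z. a * f z) (a * c)"
  unfolding has_res_def
proof (elim exE conjE)
  fix A P n
  assume "A has_fps_expansion P" "eventually (\<lambda>z. f z = A z / z ^ Suc n) (at 0)" "c = fps_nth P n"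
  then show "\<exists>A P n. A has_fps_expansion P \<and> eventually (\<lambda>z. a * f z = A z / z ^ Suc n) (at 0) \<and> a * c = fps_nth P n"
    by (intro exI[of _ "\<lambda>z. a * A z"] exI[of _ "fps_const a * P"] exI[of _ n])
       (auto intro!: has_fps_expansion_mult elim!: eventually_mono)
qed

lemma has_res_add: "has_res f c \<Longrightarrow> has_res g d \<Longrightarrow> has_res (\<lambda>z. f z + g z) (c + d)"
  unfolding has_res_def
proof (elim exE conjE)
  fix A P n B Q m
  assume A: "A has_fps_expansion P" "eventually (\<lambda>z. f z = A z / z ^ Suc n) (at 0)" "c = fps_nth P n"
    and B: "B has_fps_expansion Q" "eventually (\<lambda>z. g z = B z / z ^ Suc m) (at 0)" "d = fps_nth Q m"
  have e: "eventually (\<lambda>z. z \<noteq> (0 :: complex)) (at 0)" by (simp add: eventually_at_filter)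
  have "eventually (\<lambda>z. f z + g z = (z ^ m * A z + z ^ n * B z) / z ^ Suc (n + m)) (at 0)"
    using A(2) B(2) e
  proof eventually_elim
    case (elim z)
    have "A z / z ^ Suc n = z ^ m * A z / z ^ Suc (n + m)" "B z / z ^ Suc m = z ^ n * B z / z ^ Suc (n + m)"
      using elim(3) by (simp_all add: power_add)
    then show ?case unfolding elim(1,2) by (simp only: add_divide_distrib)
  qed
  moreover have "(\<lambda>z. z ^ m * A z + z ^ n * B z) has_fps_expansion (fps_X ^ m * P + fps_X ^ n * Q)"
    by (intro fps_expansion_intros A B)
  moreover have "c + d = fps_nth (fps_X ^ m * P + fps_X ^ n * Q) (n + m)"
    by (simp add: A B fps_X_power_mult_nth)
  ultimately show "\<exists>A P k. A has_fps_expansion P \<and> eventually (\<lambda>z. f z + g z = A z / z ^ Suc k) (at 0) \<and> c + d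
      = fps_nth P k"
    by blast
qed

lemma has_res_zero: "has_res (\<lambda>_. 0) 0"
  unfolding has_res_def by (intro exI[of _ "\<lambda>_. 0"] exI[of _ 0] exI[of _ 0]) auto

lemma has_res_sum: "finite I \<Longrightarrow> (\<And>i. i \<in> I \<Longrightarrow> has_res (f i) (c i)) \<Longrightarrow> has_res (\<lambda>z. \<Sum>i\<in>I. f i z) (\<Sum>i\<in>I. c i)"
  by (induction rule: finite_induct) (simp_all add: has_res_zero has_res_add)

lemma fps_expansion_geometric:
  fixes w :: complex
  assumes "w \<noteq> 0"
  shows "(\<lambda>z. 1 / (w - z)) has_fps_expansion Abs_fps (\<lambda>n. (1 / w) ^ Suc n)"
proof -
  have "(\<lambda>z. inverse (w - z)) has_fps_expansion inverse (fps_const w - fps_X)"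
    by (intro fps_expansion_intros) (use assms in auto)
  moreover have "inverse (fps_const w - fps_X) = Abs_fps (\<lambda>n. (1 / w) ^ Suc n)"
  proof (rule fps_inverse_unique, rule fps_ext)
    fix n
    show "fps_nth ((fps_const w - fps_X) * Abs_fps (\<lambda>n. (1 / w) ^ Suc n)) n = fps_nth 1 n"
      using assms by (cases n) (simp_all add: algebra_simps)
  qed
  ultimately show ?thesis by (simp add: divide_inverse)
qed

lemma fps_expansion_geometric2:
  fixes w :: complex
  assumes "w \<noteq> 0"
  shows "(\<lambda>z. 1 / (w - z)\<^sup>2) has_fps_expansion Abs_fps (\<lambda>n. of_nat (Suc n) * (1 / w) ^ (n + 2))"
proof -
  have "(\<lambda>z. 1 / (w - z) * (1 / (w - z))) has_fps_expansion Abs_fps (\<lambda>n. (1 / w) ^ Suc n)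
      * Abs_fps (\<lambda>n. (1 / w) ^ Suc n)"
    by (intro has_fps_expansion_mult fps_expansion_geometric assms)
  moreover have "Abs_fps (\<lambda>n. (1 / w) ^ Suc n) * Abs_fps (\<lambda>n. (1 / w) ^ Suc n) = Abs_fps (\<lambda>n. of_nat (Suc n)
      * (1 / w) ^ (n + 2))"
  proof (rule fps_ext)
    fix n
    have "(\<Sum>i=0..n. (1 / w) ^ Suc i * (1 / w) ^ Suc (n - i)) = (\<Sum>i=0..n. (1 / w) ^ (n + 2))"
      by (rule sum.cong) (simp_all flip: power_add power_Suc)
    then show "fps_nth (Abs_fps (\<lambda>n. (1 / w) ^ Suc n) * Abs_fps (\<lambda>n. (1 / w) ^ Suc n)) n
      = fps_nth (Abs_fps (\<lambda>n. of_nat (Suc n) * (1 / w) ^ (n + 2))) n"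
      by (simp add: fps_mult_nth)
  qed
  ultimately show ?thesis by (simp add: power2_eq_square)
qed

text \<open>The value 0 at w = 0 makes the expansion in z exist for every list, as
  \<open>has_fps_expansion_shuffle\<close> requires.\<close>

definition w02 :: "complex \<Rightarrow> complex list \<Rightarrow> complex" where
  "w02 z u = (case u of [w] \<Rightarrow> if w = 0 then 0 else 1 / (z - w)\<^sup>2 | _ \<Rightarrow> 0)"

definition w02f :: "complex \<Rightarrow> complex list \<Rightarrow> complex fps" where
  "w02f s u = (case u of [w] \<Rightarrow> if w = 0 then 0 else Abs_fps (\<lambda>n. of_nat (Suc n) * (1 / (s * w)) ^ (n + 2)) | _ \<Rightarrow> 0)"

lemma w02_expansion: "(\<lambda>z. w02 z u) has_fps_expansion w02f 1 u"
  and w02_expansion_neg: "(\<lambda>z. w02 (- z) u) has_fps_expansion w02f (- 1) u"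
proof -
  have "(\<lambda>z. w02 z u) has_fps_expansion w02f 1 u \<and> (\<lambda>z. w02 (- z) u) has_fps_expansion w02f (- 1) u"
  proof (cases "\<exists>w. u = [w] \<and> w \<noteq> 0")
    case True
    then obtain w where w: "u = [w]" "w \<noteq> 0" by blast
    have "(- z - w)\<^sup>2 = (- w - z)\<^sup>2" for z by (simp add: power2_eq_square algebra_simps)
    then show ?thesis using fps_expansion_geometric2[of w] fps_expansion_geometric2[of "- w"] w
      by (simp add: w02_def w02f_def power2_commute)
  next
    case False
    then show ?thesis by (auto simp: w02_def w02f_def split: list.split)
  qed
  then show "(\<lambda>z. w02 z u) has_fps_expansion w02f 1 u" "(\<lambda>z. w02 (- z) u) has_fps_expansion w02f (- 1) u"
    by auto
qed

text \<open>Adding the expansions at z and -z leaves the even powers. Their coefficients 2(2b + 1)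
  w^(-2b-2) are the origin of the weights in \<open>lin_op\<close>.\<close>

lemma w02f_sum_nth:
  assumes "0 \<notin> set u"
  shows "fps_nth (w02f 1 u + w02f (- 1) u) n = (if even n then 2 * of_nat (n + 1) * pole (n div 2) u else 0)"
proof (cases "\<exists>w. u = [w]")
  case True
  then obtain w where u: "u = [w]" by blast
  then have w: "u = [w]" "w \<noteq> 0" using assms by simp_all
  show ?thesis
  proof (cases "even n")
    case True
    have 1: "(- (1 / w)) ^ (n + 2) = (1 / w) ^ (n + 2)" by (rule power_minus_even) (use True in simp)
    have 2: "2 * (n div 2) + 2 = n + 2" using True by simp
    have "fps_nth (w02f 1 u + w02f (- 1) u) n = of_nat (Suc n) * (1 / w) ^ (n + 2) + of_nat (Suc n) * (- (1 / w)) ^ (n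
        + 2)"
      using w by (simp add: w02f_def)
    then show ?thesis unfolding 1 using w True by (simp add: pole_def 2 del: power_Suc)
  next
    case False
    have 1: "(- (1 / w)) ^ (n + 2) = - ((1 / w) ^ (n + 2))" by (rule power_minus_odd) (use False in simp)
    have "fps_nth (w02f 1 u + w02f (- 1) u) n = of_nat (Suc n) * (1 / w) ^ (n + 2) + of_nat (Suc n) * (- (1 / w)) ^ (n
        + 2)"
      using w by (simp add: w02f_def)
    then show ?thesis unfolding 1 using False by simp
  qed
next
  case False
  then show ?thesis by (auto simp: w02f_def pole_def split: list.split)
qed

lemma w02f_nth_0:
  assumes "0 \<notin> set u" "s * s = 1"
  shows "fps_nth (w02f s u) 0 = pole 0 u"
proof -
  have "s\<^sup>2 = 1" using assms(2) by (simp add: power2_eq_square)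
  then show ?thesis using assms
    by (auto simp: w02f_def pole_def power_divide power_mult_distrib split: list.split)
qed

lemma has_fps_expansion_shuffle:
  assumes "\<And>u. (\<lambda>z. f z u) has_fps_expansion F u" "\<And>u. (\<lambda>z. g z u) has_fps_expansion G u"
  shows "(\<lambda>z. shuffle xs (f z) (g z)) has_fps_expansion shuffle xs F G"
  using assms by (induction xs arbitrary: f g F G) (auto intro!: fps_expansion_intros)

subsection \<open>The recursion kernel of the Bessel curve\<close>

text \<open>The substitution l = 2h + p - 1 passes from genera to the index of \<open>conn\<close>;
  by parity every nonzero term on the right is hit exactly once.\<close>

lemma genus_sum:
  fixes e f :: "nat \<Rightarrow> complex"
  assumes e0: "e 0 = 0" and f0: "f 0 = 0"
    and e: "\<And>l. e l \<noteq> 0 \<Longrightarrow> \<exists>h. l + 1 = 2 * h + p" and f: "\<And>l. f l \<noteq> 0 \<Longrightarrow> \<exists>h. l + 1 = 2 * h + q"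
    and k: "k + 2 = 2 * g + p + q"
  shows "(\<Sum>h\<in>{0..g}. e (2 * h + p - 1) * f (2 * (g - h) + q - 1)) = (\<Sum>l\<le>k. e l * f (k - l))"
proof -
  let ?S = "{h\<in>{0..g}. e (2 * h + p - 1) * f (2 * (g - h) + q - 1) = 0}" and ?T = "{l\<in>{..k}. e l * f (k - l) = 0}"
  show ?thesis
  proof (rule sum.reindex_bij_witness_not_neutral[of "?S" "?T"
      _ "\<lambda>l. (l + 1 - p) div 2" "\<lambda>h. 2 * h + p - 1"])
    have eq: "e (2 * h + p - 1) * f (k - (2 * h + p - 1)) = e (2 * h + p - 1) * f (2 * (g - h) + q
        - 1)" if "h \<le> g" for h
    proof -
      \<comment> \<open>In the first two cases the truncated subtraction turns -1 into 0, and the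
        term still vanishes by \<open>e0\<close> or \<open>f0\<close>.\<close>
      consider "2 * h + p = 0" | "2 * (g - h) + q = 0" | "2 * h + p > 0" "2 * (g - h) + q > 0" by linarith
      then show ?thesis
      proof cases
        case 1
        then show ?thesis using e0 by simp
      next
        case 2
        then have "k - (2 * h + p - 1) = 0" "2 * (g - h) + q - 1 = 0" using k that by auto
        then show ?thesis using f0 by simp
      next
        case 3
        then have "k - (2 * h + p - 1) = 2 * (g - h) + q - 1" using k that by auto
        then show ?thesis by simp
      qed
    qed
    show "e (2 * h + p - 1) * f (k - (2 * h + p - 1)) = e (2 * h + p - 1) * f (2 * (g - h) + q
        - 1)" if "h \<in> {0..g}" for h
      using eq that by simp
    have S: "2 * h + p > 0 \<and> 2 * (g - h) + q > 0"
      if "h \<in> {0..g} - ?S" for h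
      using that e0 f0 by (auto intro!: gr0I)
    show "(2 * h + p - 1 + 1 - p) div 2 = h"
      if "h \<in> {0..g} - ?S" for h
      using S[OF that] by auto
    show "2 * h + p - 1 \<in> {..k} - ?T"
      if "h \<in> {0..g} - ?S" for h
    proof -
      have "2 * h + p - 1 \<le> k" using S[OF that] that k by auto
      then show ?thesis using that eq[of h] by auto
    qed
    have T: "\<exists>h. l + 1 = 2 * h + p \<and> h \<le> g" if "l \<in> {..k} - ?T" for l
    proof -
      have l: "l \<le> k" "e l \<noteq> 0" "f (k - l) \<noteq> 0" using that by auto
      obtain h h' where "l + 1 = 2 * h + p" "k - l + 1 = 2 * h' + q" using e[OF l(2)] f[OF l(3)] by auto
      then show ?thesis using l(1) k by (intro exI[of _ h]) auto
    qed
    show "2 * ((l + 1 - p) div 2) + p - 1 = l" if "l \<in> {..k} - ?T" for l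
      using T[OF that] by auto
    show "(l + 1 - p) div 2 \<in> {0..g} - ?S"
      if l: "l \<in> {..k} - ?T" for l
    proof -
      obtain h where h: "l + 1 = 2 * h + p" "h \<le> g" using T[OF l] by auto
      then have "(l + 1 - p) div 2 = h" "2 * h + p - 1 = l" by auto
      then show ?thesis using h l eq[of h] by auto
    qed
  qed auto
qed

lemma shuffle_cong_set:
  assumes "\<And>u. set u \<subseteq> set xs \<Longrightarrow> f u = f' u"
  shows "shuffle xs f g = shuffle xs f' g"
  using assms
proof (induction xs arbitrary: f f' g)
  case (Cons a xs)
  have "shuffle xs (\<lambda>x. f (a # x)) g = shuffle xs (\<lambda>x. f' (a # x)) g"
    by (rule Cons.IH, rule Cons.prems) auto
  moreover have "shuffle xs f (\<lambda>x. g (a # x)) = shuffle xs f' (\<lambda>x. g (a # x))"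
    by (rule Cons.IH, rule Cons.prems) auto
  ultimately show ?case by simp
qed simp

lemma sum_even:
  fixes g :: "nat \<Rightarrow> complex"
  assumes "\<And>i. odd i \<Longrightarrow> g i = 0"
  shows "(\<Sum>i=0..2 * m. g i) = (\<Sum>b\<le>m. g (2 * b))"
  using assms by (induction m) simp_all

text \<open>The recursion kernel near 0 without its simple pole 1/z.\<close>

definition bker :: "complex \<Rightarrow> complex \<Rightarrow> complex \<Rightarrow> complex" where
  "bker \<theta> z0 z = 1 / (2 * \<theta>) * ((1 - z\<^sup>2) * (1 / (z0\<^sup>2 - z\<^sup>2)))"

definition bkerf :: "complex \<Rightarrow> complex \<Rightarrow> complex fps" where
  "bkerf \<theta> z0 = fps_const (1 / (2 * \<theta>)) * ((1 - fps_X\<^sup>2) * Abs_fps (\<lambda>n. if even n then (1 / z0) ^ (n + 2) else 0))"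

lemma bker_expansion:
  assumes "z0 \<noteq> 0"
  shows "bker \<theta> z0 has_fps_expansion bkerf \<theta> z0"
proof -
  have "(\<lambda>z. inverse (z0\<^sup>2 - z ^ 2)) has_fps_expansion inverse (fps_const (z0\<^sup>2) - fps_X ^ 2)"
    by (intro fps_expansion_intros) (use assms in auto)
  moreover have "inverse (fps_const (z0\<^sup>2) - fps_X ^ 2) = Abs_fps (\<lambda>n. if even n then (1 / z0) ^ (n + 2) else 0)"
  proof (rule fps_inverse_unique, rule fps_ext)
    fix n
    consider "n = 0" | "n = 1" | m where "n = Suc (Suc m)"
      by (metis One_nat_def not0_implies_Suc)
    then show "fps_nth ((fps_const (z0\<^sup>2) - fps_X ^ 2) * Abs_fps (\<lambda>n. if even n then (1 / z0) ^ (n + 2) else 0)) n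
        = fps_nth 1 n"
      using assms by cases (auto simp: left_diff_distrib fps_X_power_mult_nth power2_eq_square[of z0])
  qed
  ultimately have "(\<lambda>z. 1 / (z0\<^sup>2 - z ^ 2)) has_fps_expansion Abs_fps (\<lambda>n. if even n then (1 / z0) ^ (n + 2) else 0)"
    by (simp add: divide_inverse)
  then show ?thesis unfolding bker_def[abs_def] bkerf_def
    by (intro fps_expansion_intros)
qed

text \<open>The two powers come from the factor 1 - z^2; summation by parts converts them into the
  difference of neighbouring sources in \<open>conn_Suc\<close>.\<close>

lemma bkerf_nth:
  "fps_nth (bkerf \<theta> z0) (2 * m) = 1 / (2 * \<theta>) * ((1 / z0) ^ (2 * m + 2) - (if m = 0 then 0 else (1 / z0) ^ (2 * m)))"
  "odd n \<Longrightarrow> fps_nth (bkerf \<theta> z0) n = 0"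
proof -
  define G where "G = Abs_fps (\<lambda>n. if even n then (1 / z0) ^ (n + 2) else 0)"
  have n: "fps_nth (bkerf \<theta> z0) n = 1 / (2 * \<theta>) * (fps_nth G n - (if n < 2 then 0 else fps_nth G (n - 2)))" for n
    by (simp add: bkerf_def G_def left_diff_distrib fps_X_power_mult_nth)
  show "odd n \<Longrightarrow> fps_nth (bkerf \<theta> z0) n = 0" unfolding n by (auto simp: G_def)
  show "fps_nth (bkerf \<theta> z0) (2 * m) = 1 / (2 * \<theta>) * ((1 / z0) ^ (2 * m + 2) - (if m = 0 then 0 else (1 / z0) ^ (2
      * m)))"
    unfolding n by (cases m) (simp_all add: G_def)
qed

lemma deriv_bessel_X: "deriv (bessel_X \<theta>) z = 2 * \<theta>\<^sup>2 * z"
  unfolding bessel_X_def by (rule DERIV_imp_deriv) (auto intro!: derivative_eq_intros)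

lemma tr_kernel_bessel:
  assumes "\<theta> \<noteq> 0" "z \<noteq> 0" "cmod z < cmod z0" "cmod z < 1"
  shows "tr_kernel (bessel_X \<theta>) (bessel_Y \<theta>) uminus z0 z = bker \<theta> z0 z * (1 / z)"
proof -
  have ne: "w \<noteq> z0" if "w \<in> ball 0 (cmod z0)" for w using that by auto
  have "((\<lambda>w. 1 / (w - z0)\<^sup>2) has_contour_integral
     (- 1 / (pathfinish (linepath z (- z)) - z0)) - (- 1 / (pathstart (linepath z (- z)) - z0))) (linepath z (- z))"
  \<comment> \<open>The ball of radius |z0| is convex, contains the segment from z to -z and avoids
    z0, so one primitive serves along the whole segment.\<close>
  proof (rule contour_integral_primitive[of "ball 0 (cmod z0)" "\<lambda>w. - 1 / (w - z0)"])
    show "((\<lambda>w. - 1 / (w - z0)) has_field_derivative 1 / (x - z0)\<^sup>2) (at x within ball 0 (cmod z0))"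
      if "x \<in> ball 0 (cmod z0)" for x
      using ne[OF that] by (auto intro!: derivative_eq_intros simp: power2_eq_square)
    show "path_image (linepath z (- z)) \<subseteq> ball 0 (cmod z0)"
      unfolding path_image_linepath using assms by (intro closed_segment_subset) auto
  qed auto
  then have I: "contour_integral (linepath z (- z)) (\<lambda>w. 1 / (w - z0)\<^sup>2) = (- 1 / (- z - z0)) - (- 1 / (z - z0))"
    by (simp add: contour_integral_unique)
  have "z \<noteq> z0" "- z \<noteq> z0" using assms by auto
  then have nz: "z - z0 \<noteq> 0" "z + z0 \<noteq> 0" by (auto simp: add_eq_0_iff2)
  have z1: "z\<^sup>2 \<noteq> 1"
  proof
    assume "z\<^sup>2 = 1"
    then have "cmod z ^ 2 = 1" by (metis norm_one norm_power)
    then show False using assms(4) norm_ge_zero[of z] by (auto simp: power2_eq_1_iff)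
  qed
  have z01: "z0\<^sup>2 - z\<^sup>2 \<noteq> 0"
  proof -
    have "z0\<^sup>2 - z\<^sup>2 = - ((z - z0) * (z + z0))" by (simp add: power2_eq_square algebra_simps)
    then show ?thesis using nz by simp
  qed
  have I2: "(- 1 / (- z - z0)) - (- 1 / (z - z0)) = - (2 * z) / (z0\<^sup>2 - z\<^sup>2)"
  proof -
    have D: "z0\<^sup>2 - z\<^sup>2 = - ((z - z0) * (z + z0))" by (simp add: power2_eq_square algebra_simps)
    have "- z - z0 = - (z + z0)" by simp
    then have M: "- 1 / (- z - z0) = 1 / (z + z0)" by (simp only: minus_divide_divide)
    show ?thesis unfolding D M minus_divide_divide using nz by (simp add: field_simps)
  qed
  have Y: "(bessel_Y \<theta> z - bessel_Y \<theta> (- z)) * deriv (bessel_X \<theta>) z = 2 * \<theta> * z\<^sup>2 / (z\<^sup>2 - 1)"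
  proof -
    have "bessel_Y \<theta> z - bessel_Y \<theta> (- z) = 2 * (z / (2 * \<theta> * (z\<^sup>2 - 1)))" by (simp add: bessel_Y_def)
    then have "bessel_Y \<theta> z - bessel_Y \<theta> (- z) = z / (\<theta> * (z\<^sup>2 - 1))" by simp
    then show ?thesis using assms(1) by (simp add: deriv_bessel_X power2_eq_square)
  qed
  show ?thesis unfolding tr_kernel_def I I2 Y bker_def
    using assms z1 z01 by (simp add: field_simps power2_eq_square)
qed

text \<open>
  For \<open>(h, u)\<close> unstable the truncated subtraction gives \<open>conn 0 = 0\<close>.
\<close>

definition stable_part :: "complex \<Rightarrow> nat \<Rightarrow> nat \<Rightarrow> complex \<Rightarrow> complex list \<Rightarrow> complex" where
  "stable_part \<theta> N h z u = evl N (z # u) (conn (2 * h + length u - 1)) / \<theta> ^ (2 * h + length u - 1)"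

lemma evl_minus: "evl N (- z # u) f = evl N (z # u) f"
proof -
  have "(1 / (- z)) ^ (2 * d + 2) = (1 / z) ^ (2 * d + 2)" for d
  proof -
    have "(- (1 / z)) ^ (2 * d + 2) = (1 / z) ^ (2 * d + 2)" by (rule power_minus_even) simp
    then show ?thesis by simp
  qed
  then show ?thesis by (simp only: evl.simps)
qed

lemma stable_part_minus: "stable_part \<theta> N h (- z) u = stable_part \<theta> N h z u"
  unfolding stable_part_def evl_minus ..

lemma evl_conn_0: "evl N zs (conn 0) = 0"
  using evl_zero[of N zs] by (simp add: evl_cong[of zs "conn 0" "\<lambda>_. 0"])

section \<open>The integrand of the recursion\<close>

abbreviation "bessel_omega \<theta> \<equiv> tr_omega {0} (bessel_X \<theta>) (bessel_Y \<theta>) uminus"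

lemma bessel_omega_02: "bessel_omega \<theta> 0 [a, b] = 1 / (a - b)\<^sup>2"
  by (simp add: tr_omega.simps)

text \<open>At most one summand is nonzero: for genus 0 with two arguments the stable part is built
  from \<open>conn 0\<close> and vanishes, and in all other cases the \<open>w02\<close> term
  vanishes.\<close>

lemma bessel_omega_decompose:
  assumes IH: "2 * h + length u + 1 > 2 \<Longrightarrow> bessel_omega \<theta> h (z # u) = evl N (z # u) (conn (2 * h + length u
      - 1)) / \<theta> ^ (2 * h + length u - 1)"
    and "0 \<notin> set u" "\<not> (h = 0 \<and> u = [])"
  shows "bessel_omega \<theta> h (z # u) = stable_part \<theta> N h z u + (if h = 0 then w02 z u else 0)"
proof (cases "h = 0 \<and> length u = 1")
  case True
  then obtain w where "u = [w]" by (auto simp: length_Suc_conv)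
  then show ?thesis using True assms(2) by (simp add: bessel_omega_02 stable_part_def evl_conn_0 w02_def del: evl.simps)
next
  case False
  then have "2 * h + length u + 1 > 2" using assms(3) by (cases u) auto
  moreover have "w02 z u = 0" if "h = 0" using False that by (auto simp: w02_def split: list.split)
  ultimately show ?thesis using IH by (simp add: stable_part_def)
qed

lemma w02_nonzero: "w02 z u \<noteq> 0 \<Longrightarrow> length u = 1"
  by (auto simp: w02_def split: list.splits)

lemma evl_conn_nonzero:
  assumes "evl N (z # u) (conn l) \<noteq> 0"
  shows "\<exists>h. l + 1 = 2 * h + length u"
proof (rule ccontr)
  assume c: "\<not> ?thesis"
  have "conn l x = 0" if "length x = length (z # u)" for x
    using conn_nonzero[of l x] c that by fastforce
  then have "evl N (z # u) (conn l) = evl N (z # u) (\<lambda>_. 0)" by (intro evl_cong) auto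
  then show False using assms evl_zero by metis
qed

definition rec_integrand :: "complex \<Rightarrow> nat \<Rightarrow> complex list \<Rightarrow> complex \<Rightarrow> complex" where
  "rec_integrand \<theta> g ws z =
    (if g = 0 then 0 else bessel_omega \<theta> (g - 1) (z # - z # ws) * deriv uminus z) +
         (\<Sum>h\<in>{0..g}. \<Sum>I\<in>Pow {..<length ws}.
           if (h = 0 \<and> I = {}) \<or> (g - h = 0 \<and> {..<length ws} - I = {}) then 0
           else bessel_omega \<theta> h (z # nths ws I) * (bessel_omega \<theta> (g - h) (- z # nths ws ({..<length ws} - I))
               * deriv uminus z))"

text \<open>The overall minus sign is the derivative of the conjugation, and 1/4 (1/z)^2 is the
  two-point function at (z, -z). The last line is the product of two such functions; like the 1/4
  term, it carries no power of theta.\<close>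

definition rec_stable :: "complex \<Rightarrow> nat \<Rightarrow> nat \<Rightarrow> complex list \<Rightarrow> complex \<Rightarrow> complex" where
  "rec_stable \<theta> N k ws z =
    - (1 / \<theta> ^ k * (evl N (z # z # ws) (conn k)
        + (\<Sum>l\<le>k. shuffle ws (\<lambda>u. evl N (z # u) (conn l)) (\<lambda>u. evl N (z # u) (conn (k - l))))
        + shuffle ws (\<lambda>u. w02 z u + w02 (- z) u) (\<lambda>u. evl N (z # u) (conn k)))
      + (if k = 0 \<and> ws = [] then 1 / 4 * (1 / z)\<^sup>2 else 0)
      + (if k = 0 then 1 else 0) * shuffle ws (w02 z) (w02 (- z)))"

lemma rec_integrand_eq:
  fixes \<theta> z :: complex and g N :: nat and ws :: "complex list"
  defines "k \<equiv> 2 * g + length ws - 2"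
  assumes th: "\<theta> \<noteq> 0" and z: "z \<noteq> 0" and ws: "0 \<notin> set ws" and st: "2 * g + length ws \<ge> 2"
    and IH: "\<And>h zs. 2 * h + length zs < 2 * g + length ws + 1 \<Longrightarrow> 0 \<notin> set zs \<Longrightarrow> zs \<noteq> [] \<Longrightarrow> 2 * h + length zs > 2 \<Longrightarrow>
       bessel_omega \<theta> h zs = evl N zs (conn (2 * h + length zs - 2)) / \<theta> ^ (2 * h + length zs - 2)"
  shows "rec_integrand \<theta> g ws z = rec_stable \<theta> N k ws z"
proof -
  let ?n = "length ws"
  have du: "deriv uminus z = (- 1 :: complex)"
    by (rule DERIV_imp_deriv) (auto intro!: derivative_eq_intros)
  define uI where "uI I = nths ws I" for I
  define uJ where "uJ I = nths ws ({..<?n} - I)" for I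
  have len: "length (uI I) = card I" "length (uJ I) = ?n - card I" "card I \<le> ?n" if "I \<in> Pow {..<?n}" for I
  proof -
    have I: "I \<subseteq> {..<?n}" using that by auto
    have "{i. i < ?n \<and> i \<in> I} = I" "{i. i < ?n \<and> i \<in> {..<?n} - I} = {..<?n} - I" using I by auto
    then show "length (uI I) = card I" "length (uJ I) = ?n - card I"
      using I by (simp_all add: uI_def uJ_def length_nths card_Diff_subset finite_subset[OF I])
    show "card I \<le> ?n" using card_mono[OF _ I] by simp
  qed
  have sub: "0 \<notin> set (uI I)" "0 \<notin> set (uJ I)" for I
    using ws set_nths_subset[of ws] by (auto simp: uI_def uJ_def)
  have k2: "k + 2 = 2 * g + ?n" using st by (simp add: k_def)
  have shP: "shuffle ws f1 f2 = (\<Sum>I\<in>Pow {..<?n}. f1 (uI I) * f2 (uJ I))" for f1 f2 :: "complex list \<Rightarrow> complex"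
    unfolding shuffle_Pow uI_def uJ_def ..
  define A where "A h I = stable_part \<theta> N h z (uI I) + (if h = 0 then w02 z (uI I) else 0)" for h I
  define B where "B h I = stable_part \<theta> N h z (uJ I) + (if h = 0 then w02 (- z) (uJ I) else 0)" for h I
  have zero: "stable_part \<theta> N 0 z [] = 0" "w02 y [] = 0" for y
    by (simp_all add: stable_part_def evl_conn_0 w02_def del: evl.simps)
  \<comment> \<open>The terms excluded from the recursion vanish automatically after the
    decomposition, so the sums may run over all genera and all subsets.\<close>
  have trm: "(if (h = 0 \<and> I = {}) \<or> (g - h = 0 \<and> {..<?n} - I = {}) then 0
           else bessel_omega \<theta> h (z # nths ws I) * (bessel_omega \<theta> (g - h) (- z # nths ws ({..<?n} - I))
               * deriv uminus z))
      = - (A h I * B (g - h) I)" if I: "I \<in> Pow {..<?n}" and h: "h \<in> {0..g}" for h I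
  proof (cases "(h = 0 \<and> I = {}) \<or> (g - h = 0 \<and> {..<?n} - I = {})")
    case True
    then have "A h I = 0 \<or> B (g - h) I = 0"
    proof (elim disjE conjE)
      assume "h = 0" "I = {}"
      then show ?thesis by (simp add: A_def uI_def zero)
    next
      assume *: "g - h = 0" "{..<?n} - I = {}"
      have "uJ I = []" unfolding uJ_def *(2) by simp
      then show ?thesis unfolding B_def *(1) by (simp add: zero)
    qed
    then show ?thesis using True by auto
  next
    case False
    have "finite I" using I by (auto intro: finite_subset)
    then have cI: "card I = 0 \<longleftrightarrow> I = {}" by simp
    have cJ: "card I = ?n \<longleftrightarrow> {..<?n} - I = {}"
      using I card_subset_eq[of "{..<?n}" I] by auto
    have "bessel_omega \<theta> h (z # uI I) = A h I" unfolding A_def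
    proof (rule bessel_omega_decompose)
      show "0 \<notin> set (uI I)" by (rule sub)
      show "\<not> (h = 0 \<and> uI I = [])" using False len[OF I] cI by force
      assume s: "2 < 2 * h + length (uI I) + 1"
      have "h < g \<or> card I < ?n" using False h cJ len(3)[OF I] by fastforce
      then have "2 * h + length (z # uI I) < 2 * g + length ws + 1" using len[OF I] h by auto
      from IH[OF this] show "bessel_omega \<theta> h (z # uI I) = evl N (z # uI I) (conn (2 * h + length (uI I)
          - 1)) / \<theta> ^ (2 * h + length (uI I) - 1)"
        using sub z s by simp
    qed
    moreover have "bessel_omega \<theta> (g - h) (- z # uJ I) = B (g - h) I" unfolding B_def stable_part_minus[of \<theta> N "g
        - h" z, symmetric]
    proof (rule bessel_omega_decompose)
      show "0 \<notin> set (uJ I)" by (rule sub)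
      show "\<not> (g - h = 0 \<and> uJ I = [])" using False len[OF I] cJ by fastforce
      assume s: "2 < 2 * (g - h) + length (uJ I) + 1"
      have "h > 0 \<or> card I > 0" using False cI by auto
      then have "2 * (g - h) + length (- z # uJ I) < 2 * g + length ws + 1" using len[OF I] h by auto
      from IH[OF this] show "bessel_omega \<theta> (g - h) (- z # uJ I) = evl N (- z # uJ I) (conn (2 * (g - h)
          + length (uJ I) - 1)) / \<theta> ^ (2 * (g - h) + length (uJ I) - 1)"
        using sub z s by simp
    qed
    ultimately show ?thesis unfolding if_not_P[OF False] by (simp add: du uI_def uJ_def)
  qed
  have SS: "(\<Sum>h\<in>{0..g}. stable_part \<theta> N h z (uI I) * stable_part \<theta> N (g - h) z (uJ I))
      = 1 / \<theta> ^ k * (\<Sum>l\<le>k. evl N (z # uI I) (conn l) * evl N (z # uJ I) (conn (k - l)))" if I: "I \<in> Pow {..<?n}" for I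
  proof -
    define p where "p = length (uI I)"
    define q where "q = length (uJ I)"
    have pq: "p + q = ?n" using len[OF I] by (simp add: p_def q_def)
    have "stable_part \<theta> N h z (uI I) * stable_part \<theta> N (g - h) z (uJ I)
       = 1 / \<theta> ^ k * (evl N (z # uI I) (conn (2 * h + p - 1)) * evl N (z # uJ I) (conn (2 * (g - h) + q
           - 1)))" if "h \<in> {0..g}" for h
    proof (cases "2 * h + p = 0 \<or> 2 * (g - h) + q = 0")
      case True
      then show ?thesis by (auto simp: stable_part_def p_def[symmetric] q_def[symmetric] evl_conn_0 simp del: evl.simps)
    next
      case False
      then have "k = (2 * h + p - 1) + (2 * (g - h) + q - 1)" using k2 pq that by auto
      then show ?thesis by (simp add: stable_part_def p_def[symmetric] q_def[symmetric] power_add del: evl.simps)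
    qed
    then have "(\<Sum>h\<in>{0..g}. stable_part \<theta> N h z (uI I) * stable_part \<theta> N (g - h) z (uJ I))
       = 1 / \<theta> ^ k * (\<Sum>h\<in>{0..g}. evl N (z # uI I) (conn (2 * h + p - 1)) * evl N (z # uJ I) (conn (2 * (g - h) + q
           - 1)))"
      unfolding sum_distrib_left by (rule sum.cong[OF refl])
    also have "(\<Sum>h\<in>{0..g}. evl N (z # uI I) (conn (2 * h + p - 1)) * evl N (z # uJ I) (conn (2 * (g - h) + q - 1)))
       = (\<Sum>l\<le>k. evl N (z # uI I) (conn l) * evl N (z # uJ I) (conn (k - l)))"
      by (rule genus_sum[where e = "\<lambda>l. evl N (z # uI I) (conn l)" and f = "\<lambda>l. evl N (z # uJ I) (conn l)"])
         (use evl_conn_nonzero evl_conn_0 k2 pq in \<open>auto simp: p_def q_def simp del: evl.simps\<close>)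
    finally show ?thesis .
  qed
  have AB: "(\<Sum>h\<in>{0..g}. A h I * B (g - h) I) = (\<Sum>h\<in>{0..g}. stable_part \<theta> N h z (uI I) * stable_part \<theta> N (g
      - h) z (uJ I))
     + w02 z (uI I) * stable_part \<theta> N g z (uJ I) + stable_part \<theta> N g z (uI I) * w02 (- z) (uJ I)
     + (if g = 0 then w02 z (uI I) * w02 (- z) (uJ I) else 0)" for I
  proof -
    have "(\<Sum>h\<in>{0..g}. A h I * B (g - h) I) = (\<Sum>h\<in>{0..g}. stable_part \<theta> N h z (uI I) * stable_part \<theta> N (g - h) z (uJ I)
     + (if h = 0 then w02 z (uI I) * stable_part \<theta> N g z (uJ I) else 0) + (if h = g then stable_part \<theta> N g z (uI I)
         * w02 (- z) (uJ I) else 0)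
     + (if h = 0 then (if g = 0 then w02 z (uI I) * w02 (- z) (uJ I) else 0) else 0))"
      by (rule sum.cong) (auto simp: A_def B_def algebra_simps)
    then show ?thesis by (simp add: sum.distrib)
  qed
  have w1: "(\<Sum>I\<in>Pow {..<?n}. w02 y (uI I) * stable_part \<theta> N g z (uJ I)) = 1 / \<theta> ^ k
      * shuffle ws (w02 y) (\<lambda>u. evl N (z # u) (conn k))" for y
    unfolding shP sum_distrib_left
  proof (rule sum.cong)
    fix I assume I: "I \<in> Pow {..<?n}"
    show "w02 y (uI I) * stable_part \<theta> N g z (uJ I) = 1 / \<theta> ^ k * (w02 y (uI I) * evl N (z # uJ I) (conn k))"
    proof (cases "w02 y (uI I) = 0")
      case False
      \<comment> \<open>A nonzero \<open>w02\<close> takes exactly one argument, so the other factor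
        has index k for every I that contributes.\<close>
      then have "card I = 1" using w02_nonzero len[OF I] by metis
      then have "2 * g + length (uJ I) - 1 = k" using len[OF I] k2 by auto
      then show ?thesis by (simp add: stable_part_def del: evl.simps)
    qed simp
  qed simp
  have w2: "(\<Sum>I\<in>Pow {..<?n}. stable_part \<theta> N g z (uI I) * w02 (- z) (uJ I)) = 1 / \<theta> ^ k
      * shuffle ws (w02 (- z)) (\<lambda>u. evl N (z # u) (conn k))"
  proof -
    have "(\<Sum>I\<in>Pow {..<?n}. stable_part \<theta> N g z (uI I) * w02 (- z) (uJ I))
        = shuffle ws (stable_part \<theta> N g z) (w02 (- z))" by (simp only: shP)
    also have "\<dots> = shuffle ws (w02 (- z)) (stable_part \<theta> N g z)" by (rule shuffle_comm)
    also have "\<dots> = (\<Sum>I\<in>Pow {..<?n}. w02 (- z) (uI I) * stable_part \<theta> N g z (uJ I))" by (simp only: shP)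
    finally show ?thesis by (simp only: w1)
  qed
  have w3: "(\<Sum>I\<in>Pow {..<?n}. if g = 0 then w02 z (uI I) * w02 (- z) (uJ I) else 0) = (if k = 0 then 1 else 0)
      * shuffle ws (w02 z) (w02 (- z))"
    unfolding shP sum_distrib_left
  proof (rule sum.cong)
    fix I assume I: "I \<in> Pow {..<?n}"
    show "(if g = 0 then w02 z (uI I) * w02 (- z) (uJ I) else 0) = (if k = 0 then 1 else 0) * (w02 z (uI I)
        * w02 (- z) (uJ I))"
    proof (cases "w02 z (uI I) * w02 (- z) (uJ I) = 0")
      case False
      then have "length (uI I) = 1" "length (uJ I) = 1" using w02_nonzero by auto
      then have "?n = 2" using len[OF I] by auto
      then have "g = 0 \<longleftrightarrow> k = 0" using k2 by auto
      then show ?thesis by simp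
    qed simp
  qed simp
  let ?D = "(\<Sum>h\<in>{0..g}. \<Sum>I\<in>Pow {..<?n}.
           if (h = 0 \<and> I = {}) \<or> (g - h = 0 \<and> {..<?n} - I = {}) then 0
           else bessel_omega \<theta> h (z # nths ws I) * (bessel_omega \<theta> (g - h) (- z # nths ws ({..<?n} - I))
               * deriv uminus z))"
  have "?D
     = (\<Sum>h\<in>{0..g}. \<Sum>I\<in>Pow {..<?n}. - (A h I * B (g - h) I))"
    by (intro sum.cong refl trm)
  also have "\<dots> = - (\<Sum>I\<in>Pow {..<?n}. \<Sum>h\<in>{0..g}. A h I * B (g - h) I)"
    by (subst sum.swap) (simp add: sum_negf)
  also have "(\<Sum>I\<in>Pow {..<?n}. \<Sum>h\<in>{0..g}. A h I * B (g - h) I)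
     = (\<Sum>I\<in>Pow {..<?n}. 1 / \<theta> ^ k * (\<Sum>l\<le>k. evl N (z # uI I) (conn l) * evl N (z # uJ I) (conn (k - l)))
        + w02 z (uI I) * stable_part \<theta> N g z (uJ I) + stable_part \<theta> N g z (uI I) * w02 (- z) (uJ I)
        + (if g = 0 then w02 z (uI I) * w02 (- z) (uJ I) else 0))"
    by (rule sum.cong) (simp_all only: AB SS)
  also have "\<dots> = 1 / \<theta> ^ k * (\<Sum>l\<le>k. shuffle ws (\<lambda>u. evl N (z # u) (conn l)) (\<lambda>u. evl N (z # u) (conn (k - l))))
      + 1 / \<theta> ^ k * shuffle ws (w02 z) (\<lambda>u. evl N (z # u) (conn k)) + 1 / \<theta> ^ k
          * shuffle ws (w02 (- z)) (\<lambda>u. evl N (z # u) (conn k))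
      + (if k = 0 then 1 else 0) * shuffle ws (w02 z) (w02 (- z))"
    unfolding sum.distrib w1 w2 w3 sum_distrib_left[symmetric] by (subst sum.swap) (simp only: shP)
  also note 1 = calculation
  \<comment> \<open>For g = 0 there are k + 4 arguments in index k, too many for a nonzero
    \<open>conn\<close>. For g > 0 and k = 0 the correlator is the unstable two-point function;
    otherwise the induction hypothesis applies, together with evenness in z.\<close>
  have 2: "(if g = 0 then 0 else bessel_omega \<theta> (g - 1) (z # - z # ws) * deriv uminus z)
     = - (1 / \<theta> ^ k * evl N (z # z # ws) (conn k) + (if k = 0 \<and> ws = [] then 1 / 4 * (1 / z)\<^sup>2 else 0))"
  proof (cases "g = 0")
    case True
    then have "conn k x = 0" if "length x = length (z # z # ws)" for x
      using conn_eq_0[of k x] k2 that by simp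
    then have "evl N (z # z # ws) (conn k) = evl N (z # z # ws) (\<lambda>_. 0)" by (intro evl_cong) auto
    then have "evl N (z # z # ws) (conn k) = 0" by (simp only: evl_zero)
    moreover have "\<not> (k = 0 \<and> ws = [])" using True k2 by auto
    ultimately show ?thesis using True by (simp only: if_True if_False) simp
  next
    case False
    show ?thesis
    proof (cases "k = 0")
      case True
      then have "?n = 0" "g = 1" using False k2 by linarith+
      then have "g = 1" "ws = []" by simp_all
      moreover have "(z + z)\<^sup>2 = 4 * z\<^sup>2" by (simp add: power2_eq_square)
      ultimately show ?thesis using True z by (simp add: bessel_omega_02 du evl_conn_0 power_one_over del: evl.simps)
    next
      case k0: False
      have e: "2 * (g - 1) + length (z # - z # ws) = k + 2" using k2 False by simp
      have "bessel_omega \<theta> (g - 1) (z # - z # ws) = evl N (z # - z # ws) (conn k) / \<theta> ^ k"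
        using IH[of "g - 1" "z # - z # ws"] unfolding e using k2 k0 ws z by simp
      moreover have "evl N (z # - z # ws) (conn k) = evl N (z # z # ws) (conn k)"
        unfolding evl.simps(2)[of N z] evl_minus ..
      ultimately show ?thesis using False k0 by (simp add: du del: evl.simps)
    qed
  qed
  show ?thesis unfolding rec_integrand_def rec_stable_def 1 2 shuffle_add by
      (simp only: distrib_left minus_add_distrib add_ac)
qed

subsection \<open>The symplectic invariants\<close>

definition conn_quad :: "nat \<Rightarrow> nat \<Rightarrow> nat \<Rightarrow> nat list \<Rightarrow> complex" where
  "conn_quad k i j x = conn k (i # j # x) + (\<Sum>l\<le>k. shuffle x (\<lambda>u. conn l (i # u)) (\<lambda>u. conn (k - l) (j # u)))"

lemma conn_quad_eq_0: "i + j > 2 * k \<Longrightarrow> conn_quad k i j x = 0"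
proof -
  assume ij: "i + j > 2 * k"
  have "conn k (i # j # x) = 0" using conn_nonzero[of k "i # j # x"] ij by fastforce
  moreover have "shuffle x (\<lambda>u. conn l (i # u)) (\<lambda>u. conn (k - l) (j # u)) = 0" if "l \<le> k" for l
  proof (rule ccontr)
    assume "\<not> ?thesis"
    then obtain ys zs where "conn l (i # ys) \<noteq> 0" "conn (k - l) (j # zs) \<noteq> 0" using shuffle_nonzero by blast
    then have "i + sum_list ys \<le> 2 * l" "j + sum_list zs \<le> 2 * (k - l)"
      using conn_nonzero by fastforce+
    then show False using ij that by simp
  qed
  ultimately show ?thesis by (simp add: conn_quad_def)
qed

lemma conn_Cons_eq_0: "e > 2 * k \<Longrightarrow> (\<lambda>x. conn k (e # x)) = (\<lambda>_. 0)"
  using conn_nonzero[of k "e # _"] by (fastforce simp: fun_eq_iff)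

lemma evl_two_zeros: "evl N ws (\<lambda>x. if x = [0, 0] then 2 else 0) = shuffle ws (pole 0) (pole 0)" if "N > 0"
proof -
  have 1: "(\<lambda>x. if x = [0, 0] then 2 else (0 :: complex)) = (\<lambda>x. shuffle x (\<lambda>x. if x
      = [0 :: nat] then 1 else 0) (\<lambda>x. if x = [0] then 1 else 0))"
  proof
    fix x :: "nat list"
    have c: "shuffle y (\<lambda>x. if a = 0 \<and> x = [] then 1 else 0) g = (if a
        = 0 then g y else (0 :: complex))" for a :: nat and y g
      using shuffle_unit[of y 1 g] by (cases "a = 0") (simp_all add: shuffle_zero)
    have c': "shuffle y g (\<lambda>x. if a = 0 \<and> x = [] then 1 else 0) = (if a
        = 0 then g y else (0 :: complex))" for a :: nat and y g
      using c[of y a g] by (simp add: shuffle_comm)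
    show "(if x = [0, 0] then 2 else (0 :: complex)) = shuffle x (\<lambda>x. if x = [0 :: nat] then 1 else 0) (\<lambda>x. if x
        = [0] then 1 else 0)"
      by (cases x) (auto simp: c c')
  qed
  have "evl N u (\<lambda>x. if x = [0] then 1 else 0) = pole 0 u" for u
  proof (cases u)
    case (Cons w v)
    have e: "evl N v (\<lambda>x. if x = [] then c else 0) = (if v = [] then c else 0)" for c
      by (cases v) (simp_all add: evl_zero)
    have "evl N u (\<lambda>x. if x = [0] then 1 else 0) = (\<Sum>d<N. if d = 0 then (1 / w) ^ 2 * (if v = [] then 1 else 0) else 0)"
      unfolding Cons evl.simps
    proof (rule sum.cong)
      fix d
      show "(1 / w) ^ (2 * d + 2) * evl N v (\<lambda>x. if d # x = [0] then 1 else 0) = (if d = 0 then (1 / w) ^ 2 * (if v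
          = [] then 1 else 0) else 0)"
        using e[of 1] by (cases "d = 0") (simp_all add: evl_zero power2_eq_square)
    qed simp
    then show ?thesis using that by (simp add: Cons pole_Cons power2_eq_square)
  qed (simp add: pole_Nil)
  then have "(\<lambda>u. evl N u (\<lambda>x. if x = [0] then 1 else 0)) = pole 0" by (rule ext)
  then show ?thesis unfolding 1 evl_shuffle by simp
qed

lemma evl_conn_src:
  assumes "N > 0"
  shows "evl N ws (conn_src k m) = (\<Sum>i<m - 1. evl N ws (conn_quad k i (m - 2 - i)))
    + (\<Sum>b<N. if m + b = 0 then 0 else
        2 * of_nat (2 * b + 1) * shuffle ws (pole b) (\<lambda>u. evl N u (\<lambda>x. conn k ((m + b - 1) # x))))
    + (if k = 0 \<and> m = 1 \<and> ws = [] then 1 / 4 else 0) + (if k = 0 \<and> m = 0 then shuffle ws (pole 0) (pole 0) else 0)"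
proof -
  have s: "conn_src k m = (\<lambda>xs. (\<Sum>i<m - 1. conn_quad k i (m - 2 - i) xs) + lin_op_list xs m (\<lambda>e x. conn k (e # x))
      + (if k = 0 \<and> m = 1 then 1 / 4 else 0) * (if xs = [] then 1 else 0)
      + (if k = 0 \<and> m = 0 then 1 else 0) * (if xs = [0, 0] then 2 else 0))"
    by (auto simp: fun_eq_iff conn_src_def conn_quad_def)
  have 1: "evl N ws (\<lambda>xs. if xs = [] then 1 else 0) = (if ws = [] then 1 else 0)"
    by (cases ws) (simp_all add: evl_zero)
  show ?thesis unfolding s evl_add evl_scale evl_sum[OF finite_lessThan] evl_lin_op_list 1 evl_two_zeros[OF assms]
      by simp
qed

text \<open>Sorts the pairs by e = m + b - 1, the index of the differentiated coefficient; this is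
  the order in which products of power series collect them.\<close>

lemma sum_box_pairs:
  fixes X :: "nat \<Rightarrow> nat \<Rightarrow> complex" and P :: "nat \<Rightarrow> complex"
  assumes X: "\<And>b e. e \<ge> N - 1 \<Longrightarrow> X b e = 0"
  shows "(\<Sum>m<N. \<Sum>b<N. if m + b = 0 then 0 else X b (m + b - 1) * P m) = (\<Sum>e<N. \<Sum>b\<le>e + 1. X b e * P (e + 1 - b))"
proof -
  let ?A = "{(m, b). 0 < m + b \<and> m + b - 1 < N - 1}" and ?B = "Sigma {..<N - 1} (\<lambda>e. {..e + 1})"
  have "(\<Sum>m<N. \<Sum>b<N. if m + b = 0 then 0 else X b (m + b - 1) * P m)
     = (\<Sum>a\<in>{..<N} \<times> {..<N}. case a of (m, b) \<Rightarrow> if m + b = 0 then 0 else X b (m + b - 1) * P m)"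
    by (simp add: sum.cartesian_product)
  also have "\<dots> = (\<Sum>a\<in>?A. case a of (m, b) \<Rightarrow> X b (m + b - 1) * P m)"
  proof (rule sum.mono_neutral_cong_right)
    have N: "e < N - 1" if "X b e \<noteq> 0" for b e using X[of e b] that by (meson not_le)
    show "\<forall>a\<in>{..<N} \<times> {..<N} - ?A. (case a of (m, b) \<Rightarrow> if m + b = 0 then 0 else X b (m + b - 1) * P m) = 0"
    proof
      fix a assume a: "a \<in> {..<N} \<times> {..<N} - ?A"
      obtain m b where ab: "a = (m, b)" by (cases a)
      have "X b (m + b - 1) = 0" if "m + b \<noteq> 0" using N[of b "m + b - 1"] a that unfolding ab by auto
      then show "(case a of (m, b) \<Rightarrow> if m + b = 0 then 0 else X b (m + b - 1) * P m) = 0" by (simp add: ab)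
    qed
  qed auto
  also have "\<dots> = (\<Sum>a\<in>?B. case a of (e, b) \<Rightarrow> X b e * P (e + 1 - b))"
    by (rule sum.reindex_bij_witness[of _ "\<lambda>(e, b). (e + 1 - b, b)" "\<lambda>(m, b). (m + b - 1, b)"]) auto
  also have "\<dots> = (\<Sum>e<N - 1. \<Sum>b\<le>e + 1. X b e * P (e + 1 - b))"
    by (rule sum.Sigma[symmetric]; simp)
  also have "\<dots> = (\<Sum>e<N. \<Sum>b\<le>e + 1. X b e * P (e + 1 - b))"
    by (rule sum.mono_neutral_left) (auto simp: X)
  finally show ?thesis .
qed

text \<open>All contributions reduce to one sum of s m * P m, where \<open>P m\<close> is the
  coefficient of z^(2m) in the kernel and \<open>s m\<close> the evaluated source. Summation by
  parts then yields the differences that define \<open>conn (Suc k)\<close>.\<close>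

lemma residue_step:
  fixes \<theta> z0 :: complex and N k :: nat and ws :: "complex list"
  defines "Kf \<equiv> bkerf \<theta> z0"
  assumes th: "\<theta> \<noteq> 0" and z0: "z0 \<noteq> 0" and ws: "0 \<notin> set ws" and N: "N \<ge> 2 * k + 6"
  shows "has_res (\<lambda>z. bker \<theta> z0 z * (1 / z) * rec_stable \<theta> N k ws z)
     (evl N (z0 # ws) (conn (Suc k)) / \<theta> ^ Suc k)"
proof -
  define F where "F e u = evl N u (\<lambda>x. conn k (e # x))" for e u
  define Q where "Q i j = evl N ws (conn_quad k i j)" for i j
  define P where "P m = fps_nth Kf (2 * m)" for m
  define s where "s m = evl N ws (conn_src k m)" for m
  define y where "y = 1 / z0"
  have K: "bker \<theta> z0 has_fps_expansion Kf" unfolding Kf_def by (rule bker_expansion[OF z0])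
  have odd: "fps_nth Kf n = 0" if "odd n" for n unfolding Kf_def by (rule bkerf_nth(2)[OF that])
  have F0: "F e u = 0" if "e > 2 * k" for e u
    unfolding F_def conn_Cons_eq_0[OF that] by (rule evl_zero)
  have Q0: "Q i j = 0" if "i + j > 2 * k" for i j
  proof -
    have "conn_quad k i j = (\<lambda>_. 0)" using conn_quad_eq_0[OF that] by auto
    then show ?thesis by (simp add: Q_def evl_zero)
  qed
  have e1: "evl N (z # z # ws) (conn k) + (\<Sum>l\<le>k. shuffle ws (\<lambda>u. evl N (z # u) (conn l)) (\<lambda>u. evl N (z # u) (conn (k
      - l))))
     = (\<Sum>i<N. \<Sum>j<N. Q i j * (1 / z) ^ (2 * i + 2 * j + 4))" for z
  proof -
    have "(\<Sum>l\<le>k. shuffle ws (\<lambda>u. evl N (z # u) (conn l)) (\<lambda>u. evl N (z # u) (conn (k - l))))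
      = (\<Sum>l\<le>k. \<Sum>i<N. \<Sum>j<N. (1 / z) ^ (2 * i + 2) * ((1 / z) ^ (2 * j + 2)
          * evl N ws (\<lambda>x. shuffle x (\<lambda>u. conn l (i # u)) (\<lambda>u. conn (k - l) (j # u)))))"
    proof -
      have "shuffle ws (\<lambda>u. evl N (z # u) f) (\<lambda>u. evl N (z # u) g)
        = (\<Sum>i<N. \<Sum>j<N. (1 / z) ^ (2 * i + 2) * ((1 / z) ^ (2 * j + 2)
            * evl N ws (\<lambda>x. shuffle x (\<lambda>u. f (i # u)) (\<lambda>u. g (j # u)))))" for f g
        unfolding evl.simps shuffle_sum_scale_right(2)[OF finite_lessThan]
        unfolding shuffle_sum_scale_right(1)[OF finite_lessThan] evl_shuffle sum_distrib_left ..
      then show ?thesis by (simp only:)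
    qed
    also have "\<dots> = (\<Sum>i<N. \<Sum>j<N. \<Sum>l\<le>k. (1 / z) ^ (2 * i + 2) * ((1 / z) ^ (2 * j + 2)
        * evl N ws (\<lambda>x. shuffle x (\<lambda>u. conn l (i # u)) (\<lambda>u. conn (k - l) (j # u)))))"
      by (subst sum.swap, rule sum.cong[OF refl], rule sum.swap)
    finally have "(\<Sum>l\<le>k. shuffle ws (\<lambda>u. evl N (z # u) (conn l)) (\<lambda>u. evl N (z # u) (conn (k - l))))
      = (\<Sum>i<N. \<Sum>j<N. (1 / z) ^ (2 * i + 2) * ((1 / z) ^ (2 * j + 2)
          * (\<Sum>l\<le>k. evl N ws (\<lambda>x. shuffle x (\<lambda>u. conn l (i # u)) (\<lambda>u. conn (k - l) (j # u))))))"
      by (simp only: sum_distrib_left)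
    moreover have "evl N (z # z # ws) (conn k) = (\<Sum>i<N. \<Sum>j<N. (1 / z) ^ (2 * i + 2) * ((1 / z) ^ (2 * j + 2)
        * evl N ws (\<lambda>x. conn k (i # j # x))))"
      by (simp only: evl.simps sum_distrib_left)
    ultimately have "evl N (z # z # ws) (conn k) + (\<Sum>l\<le>k. shuffle ws (\<lambda>u. evl N (z # u) (conn l)) (\<lambda>u. evl N (z # u)
        (conn (k - l))))
      = (\<Sum>i<N. \<Sum>j<N. (1 / z) ^ (2 * i + 2) * ((1 / z) ^ (2 * j + 2) * Q i j))"
      unfolding Q_def conn_quad_def[abs_def] evl_add evl_sum[OF finite_atMost] by (simp only: distrib_left sum.distrib)
    also have "\<dots> = (\<Sum>i<N. \<Sum>j<N. Q i j * (1 / z) ^ (2 * i + 2 * j + 4))"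
    proof (intro sum.cong refl)
      fix i j :: nat
      have "2 * i + 2 * j + 4 = (2 * i + 2) + (2 * j + 2)" by simp
      then show "(1 / z) ^ (2 * i + 2) * ((1 / z) ^ (2 * j + 2) * Q i j) = Q i j * (1 / z) ^ (2 * i + 2 * j + 4)"
        by (simp only: power_add mult_ac)
    qed
    finally show ?thesis .
  qed
  have e2: "shuffle ws (\<lambda>u. w02 z u + w02 (- z) u) (\<lambda>u. evl N (z # u) (conn k))
     = (\<Sum>e<N. shuffle ws (\<lambda>u. w02 z u + w02 (- z) u) (F e) * (1 / z) ^ (2 * e + 2))" for z
    unfolding evl.simps shuffle_sum_scale_right(1)[OF finite_lessThan] F_def by (simp only: mult.commute)
  define Wf where "Wf e = shuffle ws (\<lambda>u. w02f 1 u + w02f (- 1) u) (\<lambda>u. fps_const (F e u))" for e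
  have Wf: "(\<lambda>z. shuffle ws (\<lambda>u. w02 z u + w02 (- z) u) (F e)) has_fps_expansion Wf e" for e
    unfolding Wf_def by (rule has_fps_expansion_shuffle) (intro fps_expansion_intros w02_expansion w02_expansion_neg)+
  have Wfn: "fps_nth (Wf e) n = (if even n then 2 * of_nat (n + 1) * shuffle ws (pole (n div 2)) (F e) else 0)" for e n
  proof -
    have "fps_nth (Wf e) n = shuffle ws (\<lambda>u. fps_nth (w02f 1 u + w02f (- 1) u) n) (F e)"
      unfolding Wf_def shuffle_comm[of ws _ "\<lambda>u. fps_const (F e u)"] fps_nth_shuffle_const
      by (rule shuffle_comm)
    also have "\<dots> = shuffle ws (\<lambda>u. (if even n then 2 * of_nat (n + 1) else 0) * pole (n div 2) u) (F e)"
    proof (rule shuffle_cong_set)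
      fix u assume "set u \<subseteq> set ws"
      then have "0 \<notin> set u" using ws by auto
      then show "fps_nth (w02f 1 u + w02f (- 1) u) n = (if even n then 2 * of_nat (n + 1) else 0) * pole (n div 2) u"
        by (simp add: w02f_sum_nth del: fps_add_nth)
    qed
    finally show ?thesis by (simp add: shuffle_scale)
  qed
  define Uf where "Uf = shuffle ws (w02f 1) (w02f (- 1))"
  have Uf: "(\<lambda>z. shuffle ws (w02 z) (w02 (- z))) has_fps_expansion Uf"
    unfolding Uf_def by (rule has_fps_expansion_shuffle) (rule w02_expansion w02_expansion_neg)+
  \<comment> \<open>Only the constant coefficient is needed: the product of the two unstable
    functions meets just the simple pole of the kernel.\<close>
  have U0: "fps_nth Uf 0 = shuffle ws (pole 0) (pole 0)"
  proof -
    have "fps_nth Uf 0 = shuffle ws (\<lambda>x. fps_nth (w02f 1 x) 0) (\<lambda>x. fps_nth (w02f (- 1) x) 0)"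
      by (simp add: Uf_def fps_nth_shuffle)
    also have "\<dots> = shuffle ws (pole 0) (\<lambda>x. fps_nth (w02f (- 1) x) 0)"
      by (rule shuffle_cong_set) (use ws in \<open>auto intro!: w02f_nth_0\<close>)
    also have "\<dots> = shuffle ws (\<lambda>x. fps_nth (w02f (- 1) x) 0) (pole 0)" by (rule shuffle_comm)
    also have "\<dots> = shuffle ws (pole 0) (pole 0)"
      by (rule shuffle_cong_set) (use ws in \<open>auto intro!: w02f_nth_0\<close>)
    finally show ?thesis .
  qed
  \<comment> \<open>Kernel and symmetrized two-point functions are even, so only even indices occur
    in the Cauchy product.\<close>
  have KW: "fps_nth (Kf * Wf e) (2 * e + 2) = (\<Sum>b\<le>e + 1. 2 * of_nat (2 * b + 1) * shuffle ws (pole b) (F e) * P (e + 1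
      - b))" for e
  proof -
    have "fps_nth (Kf * Wf e) (2 * e + 2) = fps_nth (Wf e * Kf) (2 * (e + 1))" by (simp add: mult.commute)
    also have "\<dots> = (\<Sum>i=0..2 * (e + 1). fps_nth (Wf e) i * fps_nth Kf (2 * (e + 1) - i))" by (rule fps_mult_nth)
    also have "\<dots> = (\<Sum>b\<le>e + 1. fps_nth (Wf e) (2 * b) * fps_nth Kf (2 * (e + 1) - 2 * b))"
      by (rule sum_even) (simp add: Wfn)
    also have "\<dots> = (\<Sum>b\<le>e + 1. 2 * of_nat (2 * b + 1) * shuffle ws (pole b) (F e) * P (e + 1 - b))"
      by (rule sum.cong) (simp_all add: Wfn P_def diff_mult_distrib2)
    finally show ?thesis .
  qed
  define c1 :: complex where "c1 = (if k = 0 \<and> ws = [] then 1 / 4 else 0)"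
  define c2 :: complex where "c2 = (if k = 0 then 1 else 0)"
  have r1: "has_res (\<lambda>z. \<Sum>i<N. \<Sum>j<N. Q i j * (bker \<theta> z0 z * (1 / z) ^ Suc (2 * i + 2 * j + 4))) (\<Sum>i<N. \<Sum>j<N. Q i j
      * P (i + j + 2))"
  proof (intro has_res_sum has_res_scale finite_lessThan)
    fix i j :: nat
    have "2 * i + 2 * j + 4 = 2 * (i + j + 2)" by simp
    then show "has_res (\<lambda>z. bker \<theta> z0 z * (1 / z) ^ Suc (2 * i + 2 * j + 4)) (P (i + j + 2))"
      using has_res_I[OF K, of "2 * i + 2 * j + 4"] unfolding P_def by metis
  qed
  have r2: "has_res (\<lambda>z. \<Sum>e<N. (bker \<theta> z0 z * shuffle ws (\<lambda>u. w02 z u + w02 (- z) u) (F e)) * (1 / z) ^ Suc (2 * e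
      + 2)) (\<Sum>e<N. fps_nth (Kf * Wf e) (2 * e + 2))"
    by (intro has_res_sum finite_lessThan has_res_I has_fps_expansion_mult K Wf)
  have r3: "has_res (\<lambda>z. c1 * (bker \<theta> z0 z * (1 / z) ^ Suc 2)) (c1 * P 1)"
    using has_res_scale[OF has_res_I[OF K, of 2], of c1] by (simp add: P_def)
  have r4: "has_res (\<lambda>z. c2 * ((bker \<theta> z0 z * shuffle ws (w02 z) (w02 (- z))) * (1 / z) ^ Suc 0)) (c2 * (P 0
      * shuffle ws (pole 0) (pole 0)))"
    using has_res_scale[OF has_res_I[OF has_fps_expansion_mult[OF K Uf], of 0], of c2] by (simp add: P_def U0)
  define T where "T z = (- 1) * (1 / \<theta> ^ k * ((\<Sum>i<N. \<Sum>j<N. Q i j * (bker \<theta> z0 z * (1 / z) ^ Suc (2 * i + 2 * j + 4)))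
        + (\<Sum>e<N. (bker \<theta> z0 z * shuffle ws (\<lambda>u. w02 z u + w02 (- z) u) (F e)) * (1 / z) ^ Suc (2 * e + 2)))
        + c1 * (bker \<theta> z0 z * (1 / z) ^ Suc 2) + c2 * ((bker \<theta> z0 z * shuffle ws (w02 z) (w02 (- z)))
            * (1 / z) ^ Suc 0))" for z
  define V where "V = (- 1) * (1 / \<theta> ^ k * ((\<Sum>i<N. \<Sum>j<N. Q i j * P (i + j + 2)) + (\<Sum>e<N. fps_nth (Kf * Wf e) (2 * e
      + 2)))
        + c1 * P 1 + c2 * (P 0 * shuffle ws (pole 0) (pole 0)))"
  have tot: "has_res T V"
    unfolding T_def[abs_def] V_def by (intro has_res_scale has_res_add r1 r2 r3 r4)
  have fn: "bker \<theta> z0 z * (1 / z) * rec_stable \<theta> N k ws z = T z" for z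
  proof -
    have c1': "(if k = 0 \<and> ws = [] then 1 / 4 * (1 / z)\<^sup>2 else 0) = c1 * (1 / z)\<^sup>2" by (simp add: c1_def)
    have 1: "(\<Sum>i<N. \<Sum>j<N. Q i j * (bker \<theta> z0 z * (1 / z) ^ Suc (2 * i + 2 * j + 4)))
      = bker \<theta> z0 z * (1 / z) * (\<Sum>i<N. \<Sum>j<N. Q i j * (1 / z) ^ (2 * i + 2 * j + 4))"
      unfolding sum_distrib_left power_Suc by (simp only: mult_ac)
    have 2: "(\<Sum>e<N. (bker \<theta> z0 z * shuffle ws (\<lambda>u. w02 z u + w02 (- z) u) (F e)) * (1 / z) ^ Suc (2 * e + 2))
      = bker \<theta> z0 z * (1 / z) * (\<Sum>e<N. shuffle ws (\<lambda>u. w02 z u + w02 (- z) u) (F e) * (1 / z) ^ (2 * e + 2))"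
      unfolding sum_distrib_left power_Suc by (simp only: mult_ac)
    have alg: "B * Z * - (t * (X + Y) + c1 * Z\<^sup>2 + d * S) = (- 1) * (t * (B * Z * X + B * Z * Y) + c1 * (B
        * Z ^ Suc 2) + d * ((B * S) * Z ^ Suc 0))"
      for B Z t X Y d S :: complex
      by (simp add: algebra_simps power2_eq_square power3_eq_cube)
    show ?thesis unfolding T_def rec_stable_def e1 e2 c1' 1 2 c2_def[symmetric] by (rule alg)
  qed
  have sN: "s m = 0" if "m > 2 * k + 2" for m
  proof -
    have "conn_src k m = (\<lambda>_. 0)" using conn_src_eq_0[OF that] by auto
    then show ?thesis by (simp add: s_def evl_zero)
  qed
  have val: "(\<Sum>m<N. s m * P m) = (\<Sum>i<N. \<Sum>j<N. Q i j * P (i + j + 2)) + (\<Sum>e<N. fps_nth (Kf * Wf e) (2 * e + 2))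
        + c1 * P 1 + c2 * (P 0 * shuffle ws (pole 0) (pole 0))"
  proof -
    define X where "X b e = 2 * of_nat (2 * b + 1) * shuffle ws (pole b) (F e)" for b e
    have sm: "s m = (\<Sum>i<m - 1. Q i (m - 2 - i)) + (\<Sum>b<N. if m + b = 0 then 0 else X b (m + b - 1))
       + (if m = 1 then c1 else 0) + (if m = 0 then c2 * shuffle ws (pole 0) (pole 0) else 0)" for m
    proof -
      have "N > 0" using N by simp
      moreover have Fe: "F e = (\<lambda>u. evl N u (\<lambda>x. conn k (e # x)))" for e by (simp add: fun_eq_iff F_def)
      moreover have "(if k = 0 \<and> m = 1 \<and> ws = [] then 1 / 4 else 0) = (if m = 1 then c1 else 0)"
        "(if k = 0 \<and> m = 0 then shuffle ws (pole 0) (pole 0) else 0) = (if m = 0 then c2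
            * shuffle ws (pole 0) (pole 0) else 0)"
        by (simp_all add: c1_def c2_def)
      ultimately show ?thesis unfolding s_def Q_def X_def by (simp only: evl_conn_src)
    qed
    have "(\<Sum>m<N. s m * P m) = (\<Sum>m<N. (\<Sum>i<m - 1. Q i (m - 2 - i)) * P m) + (\<Sum>m<N. \<Sum>b<N. if m + b = 0 then 0 else X b (m
        + b - 1) * P m)
       + (\<Sum>m<N. if m = 1 then c1 * P 1 else 0) + (\<Sum>m<N. if m = 0 then c2 * (P 0 * shuffle ws (pole 0) (pole 0)) else 0)"
      unfolding sum.distrib[symmetric]
    proof (rule sum.cong)
      fix m
      have "(\<Sum>b<N. if m + b = 0 then 0 else X b (m + b - 1)) * P m = (\<Sum>b<N. if m + b = 0 then 0 else X b (m + b - 1)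
          * P m)"
        unfolding sum_distrib_right by (rule sum.cong) auto
      then show "s m * P m = (\<Sum>i<m - 1. Q i (m - 2 - i)) * P m + (\<Sum>b<N. if m + b = 0 then 0 else X b (m + b - 1) * P m)
        + (if m = 1 then c1 * P 1 else 0) + (if m = 0 then c2 * (P 0 * shuffle ws (pole 0) (pole 0)) else 0)"
        unfolding sm by (auto simp: distrib_right)
    qed simp
    also have "(\<Sum>m<N. \<Sum>b<N. if m + b = 0 then 0 else X b (m + b - 1) * P m) = (\<Sum>e<N. fps_nth (Kf * Wf e) (2 * e + 2))"
    proof -
      have "X b e = 0" if "e \<ge> N - 1" for b e
      proof -
        have "F e = (\<lambda>_. 0)" using F0[of e] N that by auto
        then show ?thesis by (simp add: X_def shuffle_comm[of ws "pole b"] shuffle_zero)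
      qed
      from sum_box_pairs[of N X P, OF this] show ?thesis unfolding KW X_def .
    qed
    also have "(\<Sum>m<N. (\<Sum>i<m - 1. Q i (m - 2 - i)) * P m) = (\<Sum>i<N. \<Sum>j<N. Q i j * P (i + j + 2))"
    proof -
      define n where "n = N - 2"
      have n: "N = n + 2" "n > 2 * k" using N by (simp_all add: n_def)
      have "(\<Sum>i<N. \<Sum>j<N. Q i j * P (i + j + 2)) = (\<Sum>b<N. \<Sum>i\<le>b. Q i (b - i) * P (i + (b - i) + 2))"
        by (rule box_to_triangle) (use Q0 N in auto)
      also have "\<dots> = (\<Sum>b<N. (\<Sum>i\<le>b. Q i (b - i)) * P (b + 2))"
        unfolding sum_distrib_right by (intro sum.cong) auto
      also have "\<dots> = (\<Sum>b<n. (\<Sum>i\<le>b. Q i (b - i)) * P (b + 2))"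
        by (rule sum.mono_neutral_right) (use n Q0 in \<open>auto intro!: sum.neutral\<close>)
      also have "\<dots> = (\<Sum>m<N. (\<Sum>i<m - 1. Q i (m - 2 - i)) * P m)"
        unfolding n(1) add_2_eq_Suc' by (subst sum.lessThan_Suc_shift, subst sum.lessThan_Suc_shift)
            (simp add: lessThan_Suc_atMost)
      finally show ?thesis by simp
    qed
    finally show ?thesis using N by simp
  qed
  have "evl N (z0 # ws) (conn (Suc k)) = (\<Sum>a<N. y ^ (2 * a + 2) * ((s (Suc a) - s a) / 2))"
  proof -
    have "evl N ws (\<lambda>x. conn (Suc k) (a # x)) = (s (Suc a) - s a) / 2" for a
    proof -
      have "(\<lambda>x. conn (Suc k) (a # x)) = (\<lambda>x. 1 / 2 * (conn_src k (Suc a) x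
          - conn_src k a x))" by (simp add: fun_eq_iff conn_Suc)
      then show ?thesis by (simp only: evl_scale evl_diff s_def) simp
    qed
    then show ?thesis by (simp only: evl.simps y_def)
  qed
  also have "\<dots> = 1 / 2 * ((\<Sum>a<N. y ^ (2 * a + 2) * s (Suc a)) - (\<Sum>a<N. y ^ (2 * a + 2) * s a))"
    unfolding sum_subtractf[symmetric] sum_distrib_left by (rule sum.cong) (simp_all add: right_diff_distrib)
  also have "(\<Sum>a<N. y ^ (2 * a + 2) * s (Suc a)) = (\<Sum>m<N. (if m = 0 then 0 else y ^ (2 * m)) * s m)"
  proof -
    have "(\<Sum>m<Suc N. (if m = 0 then 0 else y ^ (2 * m)) * s m) = (\<Sum>a<N. y ^ (2 * a + 2) * s (Suc a))"
      by (subst sum.lessThan_Suc_shift) simp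
    then show ?thesis using sN[of N] N by simp
  qed
  \<comment> \<open>For m > 0, (y^(2m) - y^(2m+2)) / 2 is -theta times \<open>P m\<close>; for m = 0
    both sides lack the first power.\<close>
  also have "1 / 2 * ((\<Sum>m<N. (if m = 0 then 0 else y ^ (2 * m)) * s m) - (\<Sum>a<N. y ^ (2 * a + 2) * s a)) = - \<theta>
      * (\<Sum>m<N. s m * P m)"
    unfolding sum_subtractf[symmetric] sum_distrib_left P_def Kf_def bkerf_nth(1)
    by (rule sum.cong) (use th in \<open>auto simp: y_def field_simps\<close>)
  finally have "evl N (z0 # ws) (conn (Suc k)) / \<theta> ^ Suc k = (- 1) * (1 / \<theta> ^ k * (\<Sum>m<N. s m * P m))"
    using th by simp
  also have "\<dots> = V"
    \<comment> \<open>The constants \<open>c1\<close> and \<open>c2\<close> vanish unless k = 0,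
      where the prefactor 1 / theta^k is 1; hence they may stand inside or outside of it.\<close>
    unfolding V_def val by (cases "k = 0") (simp_all add: c1_def c2_def)
  finally show ?thesis using tot unfolding fn by simp
qed

text \<open>Strong induction on 2g + n: the kernel contributes one factor 1 / theta, and the
  unstable two-point function contributes none, which gives the exponent 2g - 2 + n. The bound on
  \<open>N\<close> is uniform, so the same truncation serves all smaller correlators.\<close>

theorem tr_omega_bessel:
  assumes "\<theta> \<noteq> 0" "zs \<noteq> []" "0 \<notin> set zs" "2 * g + length zs > 2" "N \<ge> 2 * (2 * g + length zs)"
  shows "bessel_omega \<theta> g zs = evl N zs (conn (2 * g + length zs - 2)) / \<theta> ^ (2 * g + length zs - 2)"
  using assms(2-5)
proof (induction "2 * g + length zs" arbitrary: g zs rule: less_induct)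
  case less
  obtain z0 ws where zs: "zs = z0 # ws" using less.prems by (cases zs) auto
  define k where "k = 2 * g + length ws - 2"
  have k: "2 * g + length zs - 2 = Suc k" "2 * g + length ws \<ge> 2" using less.prems zs by (auto simp: k_def)
  have z0: "z0 \<noteq> 0" and ws: "0 \<notin> set ws" using less.prems zs by auto
  have N: "N \<ge> 2 * k + 6" using less.prems zs by (auto simp: k_def)
  have IH: "bessel_omega \<theta> h us = evl N us (conn (2 * h + length us - 2)) / \<theta> ^ (2 * h + length us - 2)"
    if "2 * h + length us < 2 * g + length ws + 1" "0 \<notin> set us" "us \<noteq> []" "2 * h + length us > 2" for h us
    by (rule less.hyps) (use that less.prems zs in auto)
  have st: "\<not> (g = 0 \<and> length ws = 0)" "\<not> (g = 0 \<and> length ws = 1)" using k(2) by auto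
  \<comment> \<open>The disc must avoid z0, for the primitive in the kernel, and the poles of
    \<open>Y\<close> at 1 and -1.\<close>
  have ev: "eventually (\<lambda>z. z \<noteq> 0 \<and> cmod z < cmod z0 \<and> cmod z < 1) (at 0)"
  proof -
    have "eventually (\<lambda>z::complex. z \<in> ball 0 (min (cmod z0) 1) - {0}) (at 0)"
      by (intro eventually_at_in_open) (use z0 in auto)
    then show ?thesis by eventually_elim auto
  qed
  have "bessel_omega \<theta> g zs = residue (\<lambda>z. tr_kernel (bessel_X \<theta>) (bessel_Y \<theta>) uminus z0 z *
      rec_integrand \<theta> g ws z) 0"
    unfolding zs rec_integrand_def tr_omega.simps(2)[of "{0}" "bessel_X \<theta>"
        "bessel_Y \<theta>" uminus g z0 ws] if_not_P[OF st(1)] if_not_P[OF st(2)] by simp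
  also have "\<dots> = evl N (z0 # ws) (conn (Suc k)) / \<theta> ^ Suc k"
  proof (rule has_res_residue, rule has_res_cong[OF residue_step[OF assms(1) z0 ws N]])
    show "eventually (\<lambda>z. tr_kernel (bessel_X \<theta>) (bessel_Y \<theta>) uminus z0 z *
      rec_integrand \<theta> g ws z
      = bker \<theta> z0 z * (1 / z) * rec_stable \<theta> N k ws z) (at 0)"
      using ev
    proof eventually_elim
      case (elim z)
      show ?case
        unfolding k_def
      proof (rule arg_cong2[where f = "(*)"])
        show "tr_kernel (bessel_X \<theta>) (bessel_Y \<theta>) uminus z0 z = bker \<theta> z0 z * (1 / z)"
          using tr_kernel_bessel assms(1) elim by blast
      qed (rule rec_integrand_eq[OF assms(1) _ ws k(2)], use elim in simp, rule IH)
    qed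
  qed
  finally show ?case unfolding zs k_def using k unfolding zs k_def by simp
qed

section \<open>The primitive of the curve differential and the final residue\<close>

lemma bessel_YdX:
  assumes "\<theta> \<noteq> 0"
  shows "bessel_Y \<theta> w * deriv (bessel_X \<theta>) w = \<theta> * w\<^sup>2 / (w\<^sup>2 - 1)"
  using assms by (simp add: bessel_Y_def deriv_bessel_X power2_eq_square)

definition bessel_Phi_fps :: "complex \<Rightarrow> complex \<Rightarrow> complex fps" where
  "bessel_Phi_fps \<theta> c = Abs_fps (\<lambda>n. if n = 0 then c else if odd n \<and> n \<ge> 3 then - \<theta> / of_nat n else 0)"

text \<open>The path to 0 contributes only the additive constant c; on the unit disc
  \<open>Y dX\<close> is holomorphic and the segment from 0 adds a power series without constant
  term.\<close>

lemma bessel_Phi_expansion: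
  assumes th: "\<theta> \<noteq> 0"
    and g: "valid_path \<gamma>" "pathfinish \<gamma> = 0" "path_image \<gamma> \<inter> {1, -1} = {}"
  shows "\<exists>c. bessel_Phi \<theta> \<gamma> has_fps_expansion
    bessel_Phi_fps \<theta> c"
proof -
  define f where "f w = \<theta> * w\<^sup>2 / (w\<^sup>2 - 1)" for w :: complex
  have fe: "(\<lambda>w. bessel_Y \<theta> w * deriv (bessel_X \<theta>) w) = f"
    by (simp add: fun_eq_iff bessel_YdX[OF th] f_def)
  have nz: "w\<^sup>2 - 1 \<noteq> 0" if "w \<noteq> 1" "w \<noteq> - 1" for w :: complex
    using that by (simp add: power2_eq_1_iff)
  have hol: "f holomorphic_on - {1, -1}"
    unfolding f_def by (intro holomorphic_intros) (use nz in auto)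
  have op: "open (- {1, -1 :: complex})" by (intro open_Compl finite_imp_closed) auto
  have ig: "f contour_integrable_on \<gamma>"
    by (rule contour_integrable_holomorphic_simple[OF hol op g(1)]) (use g(3) in auto)
  have b1: "w \<noteq> 1 \<and> w \<noteq> - 1" if "w \<in> ball 0 1" for w :: complex using that by auto
  have holb: "f holomorphic_on ball 0 1"
    by (rule holomorphic_on_subset[OF hol]) (use b1 in auto)
  obtain G where G: "\<And>w. w \<in> ball 0 1 \<Longrightarrow> (G has_field_derivative f w) (at w within ball 0 1)"
    using holomorphic_convex_primitive'[OF convex_ball open_ball holb] by metis
  define c where "c = contour_integral \<gamma> f"
  have Phi: "bessel_Phi \<theta> \<gamma> z = c + (G z - G 0)" if z: "z \<in> ball 0 1" for z
  proof -
    have sub: "path_image (linepath 0 z) \<subseteq> ball 0 1"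
      unfolding path_image_linepath by (intro closed_segment_subset) (use z in auto)
    have "(f has_contour_integral (G (pathfinish (linepath 0 z)) - G (pathstart (linepath 0 z)))) (linepath 0 z)"
      by (rule contour_integral_primitive[OF G _ sub]) auto
    then have l: "(f has_contour_integral (G z - G 0)) (linepath 0 z)" by simp
    have "contour_integral (\<gamma> +++ linepath 0 z) f = contour_integral \<gamma> f + contour_integral (linepath 0 z) f"
      by (rule contour_integral_join) (use ig l g in \<open>auto intro: has_contour_integral_integrable\<close>)
    then show ?thesis unfolding bessel_Phi_def fe c_def using contour_integral_unique[OF l] by simp
  qed
  have Gh: "G holomorphic_on ball 0 1"
    unfolding holomorphic_on_def field_differentiable_def using G by blast
  have Ge: "G has_fps_expansion fps_expansion G 0"
    by (rule has_fps_expansion_fps_expansion[OF open_ball _ Gh]) simp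
  have dG: "deriv G has_fps_expansion fps_deriv (fps_expansion G 0)"
    by (rule has_fps_expansion_deriv[OF Ge])
  have near: "eventually (\<lambda>w :: complex. w \<in> ball 0 1) (nhds 0)"
    by (intro eventually_nhds_in_open) auto
  have dGf: "eventually (\<lambda>w. deriv G w = f w) (nhds 0)"
    using near
  proof eventually_elim
    case (elim w)
    then show ?case using G[OF elim] by (metis DERIV_imp_deriv at_within_open open_ball)
  qed
  have fE: "f has_fps_expansion fps_deriv (fps_expansion G 0)"
    using has_fps_expansion_cong[OF dGf refl] dG by blast
  \<comment> \<open>The series of theta w^2 / (w^2 - 1), identified by multiplying with w^2 - 1 and
    cancelling.\<close>
  define A where "A = Abs_fps (\<lambda>n. if even n \<and> n \<ge> 2 then - \<theta> else 0 :: complex)"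
  have h1: "(\<lambda>w. f w * (w ^ 2 - 1)) has_fps_expansion fps_deriv (fps_expansion G 0) * (fps_X ^ 2 - 1)"
    by (intro fps_expansion_intros fE)
  have h2: "eventually (\<lambda>w. f w * (w ^ 2 - 1) = \<theta> * w ^ 2) (nhds 0)"
    using near by eventually_elim (use nz b1 in \<open>auto simp: f_def\<close>)
  have "(\<lambda>w. \<theta> * w ^ 2) has_fps_expansion fps_deriv (fps_expansion G 0) * (fps_X ^ 2 - 1)"
    using has_fps_expansion_cong[OF h2 refl] h1 by simp
  moreover have "(\<lambda>w. \<theta> * w ^ 2) has_fps_expansion fps_const \<theta> * fps_X ^ 2"
    by (intro fps_expansion_intros)
  ultimately have "fps_deriv (fps_expansion G 0) * (fps_X ^ 2 - 1) = fps_const \<theta> * fps_X ^ 2"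
    using fps_expansion_unique_complex by blast
  moreover have "A * (fps_X ^ 2 - 1) = fps_const \<theta> * fps_X ^ 2"
  proof (rule fps_ext)
    fix n :: nat
    have "n = 0 \<or> n = 1 \<or> n = 2 \<or> n = 3 \<or> n \<ge> 4" by linarith
    then show "fps_nth (A * (fps_X ^ 2 - 1)) n = fps_nth (fps_const \<theta> * fps_X ^ 2) n"
      by (auto simp: A_def right_diff_distrib fps_X_power_mult_right_nth fps_X_power_nth)
  qed
  moreover have "fps_X ^ 2 - 1 \<noteq> (0 :: complex fps)"
  proof -
    have "fps_nth (fps_X ^ 2 - 1 :: complex fps) 0 \<noteq> fps_nth 0 0" by simp
    then show ?thesis by metis
  qed
  ultimately have D: "fps_deriv (fps_expansion G 0) = A" by (metis mult_right_cancel)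
  have Gn: "fps_nth (fps_expansion G 0) (Suc n) = fps_nth A n / of_nat (Suc n)" for n
    using arg_cong[OF D, of "\<lambda>F. fps_nth F n"] by (simp add: field_simps del: of_nat_Suc)
  have h3: "(\<lambda>z. (c - G 0) + G z) has_fps_expansion fps_const (c - G 0) + fps_expansion G 0"
    by (intro fps_expansion_intros Ge)
  have h4: "eventually (\<lambda>z. (c - G 0) + G z = bessel_Phi \<theta> \<gamma> z) (nhds 0)"
    using near by eventually_elim (simp add: Phi)
  have E: "bessel_Phi \<theta> \<gamma> has_fps_expansion fps_const (c - G 0) + fps_expansion G 0"
    using has_fps_expansion_cong[OF h4 refl] h3 by simp
  have "fps_const (c - G 0) + fps_expansion G 0 =
    bessel_Phi_fps \<theta> (c - G 0 + fps_nth (fps_expansion G 0) 0)"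
  proof (rule fps_ext)
    fix n
    show "fps_nth (fps_const (c - G 0) + fps_expansion G 0) n =
      fps_nth (bessel_Phi_fps \<theta> (c - G 0 + fps_nth (fps_expansion G 0) 0)) n"
      by (cases n) (auto simp: Gn A_def bessel_Phi_fps_def)
  qed
  then show ?thesis using E by (intro exI[of _ "c - G 0 + fps_nth (fps_expansion G 0) 0"]) simp
qed

text \<open>The one-point function contains only powers z^(-2d-2), so the residue selects odd
  coefficients of the primitive: the constant depending on the path drops out, and
  \<open>dil_time\<close> appears. What remains is theta^(2-2g) times
  \<open>dil_coeff (2 * g - 1)\<close>.\<close>

theorem theorem4p3:
  fixes \<theta> z_o :: complex and \<gamma> :: "real \<Rightarrow> complex" and g :: nat
  assumes "\<theta> \<noteq> 0"
    and "valid_path \<gamma>" "pathstart \<gamma> = z_o" "pathfinish \<gamma> = 0" "path_image \<gamma> \<inter> {1, -1} = {}"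
    and "g \<ge> 2"
  shows "bessel_F \<theta> \<gamma> g =
    bernoulli (2 * g) / (of_nat (2 * g) * of_nat (2 * g - 2) * \<theta> ^ (2 * g - 2))"
proof -
  define k where "k = 2 * g - 1"
  define N where "N = 2 * (2 * g + 1)"
  have k: "k = Suc (2 * g - 2)" "k \<ge> 2" "k + 1 = 2 * g" using assms(6) by (auto simp: k_def)
  obtain c where Phi: "bessel_Phi \<theta> \<gamma> has_fps_expansion
    bessel_Phi_fps \<theta> c"
    using bessel_Phi_expansion[OF assms(1,2,4,5)] by blast
  have W: "bessel_omega \<theta> g [z] = (\<Sum>d<N. (1 / z) ^ (2 * d + 2) * part k {#d#}) / \<theta> ^ k" if "z \<noteq> 0" for z
    using tr_omega_bessel[OF assms(1), of "[z]" g N] assms(6) that by (simp add: N_def k_def conn_eq_part)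
  have "has_res (\<lambda>z. \<Sum>d<N. part k {#d#} / \<theta> ^ k * (bessel_Phi \<theta> \<gamma> z * (1 / z) ^ Suc (2 * d + 1)))
     (\<Sum>d<N. part k {#d#} / \<theta> ^ k * fps_nth (bessel_Phi_fps \<theta> c) (2 * d + 1))"
    by (intro has_res_sum finite_lessThan has_res_scale has_res_I Phi)
  then have "has_res (\<lambda>z. bessel_Phi \<theta> \<gamma> z * bessel_omega \<theta> g [z])
     (\<Sum>d<N. part k {#d#} / \<theta> ^ k * fps_nth (bessel_Phi_fps \<theta> c) (2 * d + 1))"
  proof (rule has_res_cong)
    have "eventually (\<lambda>z :: complex. z \<noteq> 0) (at 0)" by (simp add: eventually_at_filter)
    then show "eventually (\<lambda>z. bessel_Phi \<theta> \<gamma> z * bessel_omega \<theta> g [z] = (\<Sum>d<N. part k {#d#} / \<theta> ^ k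
        * (bessel_Phi \<theta> \<gamma> z * (1 / z) ^ Suc (2 * d + 1)))) (at 0)"
    proof eventually_elim
      case (elim z)
      show ?case unfolding W[OF elim] sum_divide_distrib sum_distrib_left
        by (rule sum.cong) (simp_all add: mult_ac)
    qed
  qed
  then have R: "residue (\<lambda>z. bessel_Phi \<theta> \<gamma> z * bessel_omega \<theta> g [z]) 0
     = (\<Sum>d<N. part k {#d#} / \<theta> ^ k * fps_nth (bessel_Phi_fps \<theta> c) (2 * d + 1))"
    by (rule has_res_residue)
  also have "\<dots> = (\<Sum>d<N. \<theta> / \<theta> ^ k * (dil_time d * part k {#d#}))"
    by (rule sum.cong) (auto simp: dil_time_def bessel_Phi_fps_def)
  also have "\<dots> = \<theta> / \<theta> ^ k * dd N dil_time (part k) {#}"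
    by (simp add: dd_def pd_def sum_distrib_left)
  also have "dd N dil_time (part k) {#} = dil_coeff k" by (rule dil_coeff_eq) (simp add: N_def k_def)
  also have "dil_coeff k = - bernoulli (2 * g) / of_nat (2 * g)"
    using dil_coeff_bernoulli[OF k(2)] by (simp only: k(3))
  also have "\<theta> / \<theta> ^ k = 1 / \<theta> ^ (2 * g - 2)" using assms(1) by (simp add: k(1))
  finally have R: "residue (\<lambda>z. bessel_Phi \<theta> \<gamma> z * bessel_omega \<theta> g [z]) 0 = 1 / \<theta> ^ (2 * g - 2) * (- bernoulli (2
      * g) / of_nat (2 * g))" .
  \<comment> \<open>The sign of 2 - 2g cancels the minus sign in front of the Bernoulli
    number.\<close>
  have "2 - 2 * of_nat g = - (of_nat (2 * g - 2) :: complex)" using assms(6) by (simp add: of_nat_diff)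
  then show ?thesis unfolding bessel_F_def tr_F_def using R assms(1) by simp
qed

end
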